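(* Let $s,t\ge1$ be relatively prime integers and let $p\neq0$ be an $(s,t)$-quasi-homogeneous polynomial, with associated reduction $p(z,w)=z^aw^bq(z^t,w^s)$ and Verblunsky coefficients $(\alpha_m)_{m\ge0}$ of the normalized measure $|q(\cdot,1)|^2dm/\|q(\cdot,1)\|_2^2$. Then the non-zero singular values of $P_zP_w$ for the submodule $[p]$ are (counted with multiplicity, zero terms discarded) $$1,|\alpha_0|,|\alpha_1|,\ldots .$$ They are exactly the non-zero singular values of the operator $P_zP_w$ for the submodule $[q]\subset H^2(\mathbb D^2)$ generated by the ordinary homogeneous polynomial $q$. The weights $s,t$ and the monomial factor $z^aw^b$ contribute only mutually orthogonal zero blocks: in the matrix of $P_zP_w$ with respect to the orthonormal bases $(f_{m,\sigma})$ of $[p]\ominus w[p]$ and $(e_{m,\rho})$ of $[p]\ominus z[p]$, every block indexed by a residue pair $(\rho,\sigma)\ne(0,0)$ is zero.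
   Context: $H^2(\mathbb D^2)$ is the Hardy space of the bidisc and $[p]$ is the closure of $p\,\mathbb C[z,w]$ in it. For a submodule $\mathcal M$, $P_z=P_{\mathcal M\ominus z\mathcal M}$ and $P_w=P_{\mathcal M\ominus w\mathcal M}$ are the orthogonal projections, acting on $\mathcal M$. $m$ as a measure denotes normalized Haar measure on $\mathbb T$, $\|\cdot\|_2$ the norm of $L^2(\mathbb T,m)$. $p$ is $(s,t)$-quasi-homogeneous if $p=\sum_{si+tj=N}c_{ij}z^iw^j\ne0$ for some $N$. Then there are unique integers $0\le a<t$, $0\le b<s$, $d\ge0$ with $N=sa+tb+std$ and $p(z,w)=z^aw^bq(Z,W)$, $Z=z^t$, $W=w^s$, where $q$ is an ordinary homogeneous polynomial of degree $d$. Put $Q(\zeta)=q(\zeta,1)$; let $(\varphi_m)$ be the orthonormal polynomials (positive leading coefficients) of $|Q|^2dm/\|Q\|_2^2$, $\varphi_m^*(\zeta)=\zeta^m\overline{\varphi_m(1/\overline\zeta)}$, and define the Verblunsky coefficients $\alpha_m\in\mathbb D$ by $(1-|\alpha_m|^2)^{1/2}\varphi_{m+1}(\zeta)=\zeta\varphi_m(\zeta)-\overline{\alpha_m}\varphi_m^*(\zeta)$. For $m\ge0$, $0\le\rho<s$, $0\le\sigma<t$, $$e_{m,\rho}=\frac{p}{\|p\|}w^\rho W^m\varphi_m^*(Z/W),\qquad f_{m,\sigma}=\frac{p}{\|p\|}z^\sigma W^m\varphi_m(Z/W);$$ these are orthonormal bases of $[p]\ominus z[p]$ and $[p]\ominus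 w[p]$, respectively. *)

theory Defs
  imports "HOL-Analysis.Analysis" "HOL-Computational_Algebra.Polynomial"
begin

section \<open>The Hardy space of the bidisc\<close>

definition bidisc :: "(complex \<times> complex) set" where
  "bidisc = ball 0 1 \<times> ball 0 1"

text \<open>Functions on the bidisc are total functions that vanish outside it, so that equality of
  functions on the bidisc is equality in HOL.\<close>

type_synonym bifun = "complex \<times> complex \<Rightarrow> complex"

definition has_taylor :: "bifun \<Rightarrow> (nat \<times> nat \<Rightarrow> complex) \<Rightarrow> bool" where
  "has_taylor f c \<longleftrightarrow>
     (\<forall>z w. (z, w) \<in> bidisc \<longrightarrow> ((\<lambda>(i, j). c (i, j) * z ^ i * w ^ j) has_sum f (z, w)) UNIV)"

definition hardy2 :: "bifun set" where
  "hardy2 = {f. (\<exists>c. has_taylor f c \<and> (\<lambda>x. (cmod (c x))\<^sup>2) summable_on UNIV)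
                \<and> (\<forall>x. x \<notin> bidisc \<longrightarrow> f x = 0)}"

definition taylor :: "bifun \<Rightarrow> nat \<times> nat \<Rightarrow> complex" where
  "taylor f = (THE c. has_taylor f c)"

text \<open>The inner product of the Hardy space (linear in the first argument); it equals the inner
  product of the boundary values with respect to Haar measure on the torus.\<close>

definition hinner :: "bifun \<Rightarrow> bifun \<Rightarrow> complex" where
  "hinner f g = (\<Sum>\<^sub>\<infinity>x\<in>UNIV. taylor f x * cnj (taylor g x))"

definition hnorm :: "bifun \<Rightarrow> real" where
  "hnorm f = sqrt (Re (hinner f f))"

definition hclosure :: "bifun set \<Rightarrow> bifun set" where
  "hclosure S = {f \<in> hardy2. \<forall>\<epsilon>>0. \<exists>g\<in>S. hnorm (\<lambda>x. f x - g x) < \<epsilon>}"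

definition ominus :: "bifun set \<Rightarrow> bifun set \<Rightarrow> bifun set" where
  "ominus M N = {f \<in> M. \<forall>g\<in>N. hinner f g = 0}"

definition proj :: "bifun set \<Rightarrow> bifun \<Rightarrow> bifun" where
  "proj S f = (THE g. g \<in> S \<and> (\<forall>h\<in>S. hinner (\<lambda>x. f x - g x) h = 0))"

definition mult_z :: "bifun \<Rightarrow> bifun" where
  "mult_z f = (\<lambda>(z, w). z * f (z, w))"

definition mult_w :: "bifun \<Rightarrow> bifun" where
  "mult_w f = (\<lambda>(z, w). w * f (z, w))"

definition P_z :: "bifun set \<Rightarrow> bifun \<Rightarrow> bifun" where
  "P_z M = proj (ominus M (mult_z ` M))"

definition P_w :: "bifun set \<Rightarrow> bifun \<Rightarrow> bifun" where
  "P_w M = proj (ominus M (mult_w ` M))"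

text \<open>A maximal orthonormal family in a closed subspace \<open>S\<close>.\<close>

definition orthonormal_basis :: "'i set \<Rightarrow> ('i \<Rightarrow> bifun) \<Rightarrow> bifun set \<Rightarrow> bool" where
  "orthonormal_basis I u S \<longleftrightarrow>
     (\<forall>i\<in>I. u i \<in> S) \<and>
     (\<forall>i\<in>I. \<forall>j\<in>I. hinner (u i) (u j) = (if i = j then 1 else 0)) \<and>
     (\<forall>f\<in>S. (\<forall>i\<in>I. hinner f (u i) = 0) \<longrightarrow> f = (\<lambda>x. 0))"


section \<open>Singular values of operators on a closed subspace of the Hardy space\<close>

definition adjoint_on :: "bifun set \<Rightarrow> (bifun \<Rightarrow> bifun) \<Rightarrow> bifun \<Rightarrow> bifun" where
  "adjoint_on M T g = (THE h. h \<in> M \<and> (\<forall>f\<in>M. hinner (T f) g = hinner f h))"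

definition compact_op :: "bifun set \<Rightarrow> (bifun \<Rightarrow> bifun) \<Rightarrow> bool" where
  "compact_op M T \<longleftrightarrow>
     (\<forall>f :: nat \<Rightarrow> bifun. (\<forall>n. f n \<in> M \<and> hnorm (f n) \<le> 1) \<longrightarrow>
        (\<exists>g\<in>M. \<exists>r. strict_mono r \<and> (\<lambda>n. hnorm (\<lambda>x. T (f (r n)) x - g x)) \<longlonglongrightarrow> 0))"

text \<open>The non-zero singular values of a compact operator \<open>T\<close> on \<open>M\<close> are the square roots of the
  positive eigenvalues of \<open>T\<^sup>* T\<close>, repeated according to the dimension of the eigenspace.  The
  predicate says that this multiset consists of the non-zero terms of the sequence \<open>\<sigma>\<close>: for
  every \<open>\<tau> > 0\<close> the Hilbert space dimension of the eigenspace for \<open>\<tau>\<^sup>2\<close> is the number of indices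
  \<open>n\<close> with \<open>\<sigma> n = \<tau>\<close>.\<close>

definition sv_eigenspace :: "bifun set \<Rightarrow> (bifun \<Rightarrow> bifun) \<Rightarrow> real \<Rightarrow> bifun set" where
  "sv_eigenspace M T \<tau> =
     {f \<in> M. adjoint_on M T (T f) = (\<lambda>x. complex_of_real (\<tau>\<^sup>2) * f x)}"

definition nonzero_singular_values ::
    "bifun set \<Rightarrow> (bifun \<Rightarrow> bifun) \<Rightarrow> (nat \<Rightarrow> real) \<Rightarrow> bool" where
  "nonzero_singular_values M T \<sigma> \<longleftrightarrow>
     compact_op M T \<and> (\<forall>n. \<sigma> n \<ge> 0) \<and>
     (\<forall>\<tau>>0. \<exists>u. orthonormal_basis {n. \<sigma> n = \<tau>} u (sv_eigenspace M T \<tau>))"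


section \<open>Polynomials in two variables\<close>

text \<open>A polynomial in \<open>z, w\<close> is a polynomial in \<open>w\<close> whose coefficients are polynomials in \<open>z\<close>.\<close>

definition coeff2 :: "complex poly poly \<Rightarrow> nat \<Rightarrow> nat \<Rightarrow> complex" where
  "coeff2 p i j = coeff (coeff p j) i"

definition eval2 :: "complex poly poly \<Rightarrow> complex \<Rightarrow> complex \<Rightarrow> complex" where
  "eval2 p z w = poly (poly p [:w:]) z"

definition polyfun :: "complex poly poly \<Rightarrow> bifun" where
  "polyfun p = (\<lambda>(z, w). if (z, w) \<in> bidisc then eval2 p z w else 0)"

definition submodule_gen :: "complex poly poly \<Rightarrow> bifun set" where
  "submodule_gen p = hclosure (range (\<lambda>r. polyfun (p * r)))"

definition homogeneous :: "nat \<Rightarrow> complex poly poly \<Rightarrow> bool" where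
  "homogeneous d q \<longleftrightarrow> (\<forall>i j. coeff2 q i j \<noteq> 0 \<longrightarrow> i + j = d)"

definition quasi_homogeneous :: "nat \<Rightarrow> nat \<Rightarrow> complex poly poly \<Rightarrow> bool" where
  "quasi_homogeneous s t p \<longleftrightarrow>
     p \<noteq> 0 \<and> (\<exists>N. \<forall>i j. coeff2 p i j \<noteq> 0 \<longrightarrow> s * i + t * j = N)"

definition reduction ::
    "nat \<Rightarrow> nat \<Rightarrow> complex poly poly \<Rightarrow> nat \<Rightarrow> nat \<Rightarrow> nat \<Rightarrow> complex poly poly \<Rightarrow> bool" where
  "reduction s t p a b d q \<longleftrightarrow>
     a < t \<and> b < s \<and> homogeneous d q \<and>
     (\<forall>z w. eval2 p z w = z ^ a * w ^ b * eval2 q (z ^ t) (w ^ s))"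

lemma eval2_altdef:
  assumes "\<And>i j. coeff2 p i j \<noteq> 0 \<Longrightarrow> i \<le> N \<and> j \<le> N"
  shows "eval2 p z w = (\<Sum>(i, j)\<in>{..N} \<times> {..N}. coeff2 p i j * z ^ i * w ^ j)"
proof -
  have c0: "coeff p j = 0" if "j > N" for j
    using assms[of _ j] that by (intro poly_eqI) (auto simp: coeff2_def)
  have dp: "degree p \<le> N" using c0 by (intro degree_le) auto
  have dc: "degree (coeff p j) \<le> N" for j
    using assms[of _ j] by (intro degree_le) (force simp: coeff2_def)
  have gen: "poly r x = (\<Sum>i\<le>N. coeff r i * x ^ i)" if "degree r \<le> N"
    for r :: "'b :: comm_semiring_1 poly" and x
    unfolding poly_altdef using that by (intro sum.mono_neutral_left) (auto simp: coeff_eq_0)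
  have "eval2 p z w = (\<Sum>j\<le>N. poly (coeff p j) z * w ^ j)"
    unfolding eval2_def gen[OF dp] by (simp add: poly_sum)
  also have "\<dots> = (\<Sum>j\<le>N. \<Sum>i\<le>N. coeff2 p i j * z ^ i * w ^ j)"
    by (simp add: gen[OF dc] sum_distrib_right coeff2_def)
  also have "\<dots> = (\<Sum>i\<le>N. \<Sum>j\<le>N. coeff2 p i j * z ^ i * w ^ j)" by (rule sum.swap)
  finally show ?thesis by (simp add: sum.cartesian_product)
qed

lemma reduction_exists:
  assumes "s \<ge> 1" "t \<ge> 1" "coprime s t" "quasi_homogeneous s t p"
  shows "\<exists>a b d q. reduction s t p a b d q"
proof -
  from assms obtain N where N: "\<And>i j. coeff2 p i j \<noteq> 0 \<Longrightarrow> s * i + t * j = N" and "p \<noteq> 0"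
    by (auto simp: quasi_homogeneous_def)
  obtain j0 i0 where ij0: "coeff2 p i0 j0 \<noteq> 0"
    using \<open>p \<noteq> 0\<close> by (metis coeff2_def coeff_0 poly_eqI)
  define a b d where "a = i0 mod t" and "b = j0 mod s" and "d = i0 div t + j0 div s"
  have N0: "s * i0 + t * j0 = N" using N[OF ij0] .
  have i0: "i0 = a + t * (i0 div t)" and j0: "j0 = b + s * (j0 div s)"
    by (simp_all add: a_def b_def)
  have Nd: "N = s * a + t * b + s * t * d"
  proof -
    have "N = s * (a + t * (i0 div t)) + t * (b + s * (j0 div s))"
      using N0 i0 j0 by simp
    then show ?thesis by (simp add: d_def algebra_simps)
  qed
  define h where "h = (\<lambda>k. (a + t * k, b + s * (d - k)))"
  have supp: "(i, j) \<in> h ` {..d}" if nz: "coeff2 p i j \<noteq> 0" for i j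
  proof -
    have e: "s * i + t * j = s * i0 + t * j0" using N[OF nz] N0 by simp
    have ei: "int s * int i + int t * int j = int s * int i0 + int t * int j0"
      using e by (metis of_nat_add of_nat_mult)
    have "int s * (int i - int i0) = int t * (int j0 - int j)"
      using ei by (simp add: algebra_simps)
    then have "int t dvd int s * (int i - int i0)" "int s dvd int t * (int j0 - int j)"
      by (metis dvd_triv_left)+
    then have "int t dvd int i - int i0" "int s dvd int j0 - int j"
      using assms(3) by (simp_all add: coprime_dvd_mult_right_iff coprime_commute)
    then have "i mod t = a" "j mod s = b"
      unfolding a_def b_def by (metis mod_eq_dvd_iff of_nat_eq_iff zmod_int)+
    then have i: "i = a + t * (i div t)" and j: "j = b + s * (j div s)" by auto
    have "s * (a + t * (i div t)) + t * (b + s * (j div s)) = s * a + t * b + s * t * d"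
      using N[OF nz] Nd i j by simp
    then have "s * t * (i div t + j div s) = s * t * d" by (simp add: algebra_simps)
    then have d: "i div t + j div s = d" using assms(1,2) by simp
    then have "(i, j) = h (i div t)" using i j by (auto simp: h_def)
    then show ?thesis using d by auto
  qed
  define q where "q = (\<Sum>k\<le>d. monom (monom (coeff2 p (a + t * k) (b + s * (d - k))) k) (d - k))"
  have "homogeneous d q"
    unfolding homogeneous_def
  proof (intro allI impI)
    fix i j assume "coeff2 q i j \<noteq> 0"
    then have "(\<Sum>k\<le>d. coeff (coeff (monom (monom (coeff2 p (a + t * k) (b + s * (d - k))) k)
        (d - k)) j) i) \<noteq> 0"
      unfolding q_def coeff2_def coeff_sum .
    then obtain k where "k \<le> d"
      "coeff (coeff (monom (monom (coeff2 p (a + t * k) (b + s * (d - k))) k) (d - k)) j) i \<noteq> 0"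
      by (metis (no_types, lifting) atMost_iff sum.not_neutral_contains_not_neutral)
    then show "i + j = d" by (auto split: if_splits)
  qed
  moreover have "eval2 p z w = z ^ a * w ^ b * eval2 q (z ^ t) (w ^ s)" for z w
  proof -
    have bd: "i \<le> N \<and> j \<le> N" if "(i, j) \<in> h ` {..d}" for i j
    proof -
      from that obtain k where k: "k \<le> d" "i = a + t * k" "j = b + s * (d - k)"
        by (auto simp: h_def)
      have "s * i + t * j = s * a + t * b + s * t * (k + (d - k))"
        unfolding k(2,3) by (simp add: algebra_simps)
      then have "s * i + t * j = N" using k(1) Nd by simp
      moreover have "i \<le> s * i" "j \<le> t * j" using assms(1,2) by auto
      ultimately show ?thesis by linarith
    qed
    have inj: "inj_on h {..d}" using assms(2) by (auto simp: inj_on_def h_def)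
    have "eval2 p z w = (\<Sum>(i, j)\<in>{..N} \<times> {..N}. coeff2 p i j * z ^ i * w ^ j)"
      using supp bd by (intro eval2_altdef) blast
    also have "\<dots> = (\<Sum>(i, j)\<in>h ` {..d}. coeff2 p i j * z ^ i * w ^ j)"
      using supp bd by (intro sum.mono_neutral_right) fastforce+
    also have "\<dots> = (\<Sum>k\<le>d. coeff2 p (a + t * k) (b + s * (d - k))
                        * z ^ (a + t * k) * w ^ (b + s * (d - k)))"
      by (subst sum.reindex[OF inj]) (simp add: h_def)
    also have "\<dots> = z ^ a * w ^ b * eval2 q (z ^ t) (w ^ s)"
      by (simp add: q_def eval2_def poly_sum poly_monom sum_distrib_left power_add
          power_mult[symmetric] mult.assoc mult.left_commute)
    finally show ?thesis .
  qed
  moreover have "a < t" "b < s" using assms(1,2) by (auto simp: a_def b_def)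
  ultimately show ?thesis unfolding reduction_def by blast
qed


section \<open>Orthonormal polynomials on the unit circle and Verblunsky coefficients\<close>

definition circle_measure :: "complex measure" where
  "circle_measure = distr (uniform_measure lborel {0..2 * pi}) borel cis"

text \<open>The probability measure with density \<open>\<bar>Q\<bar>\<^sup>2 / \<parallel>Q\<parallel>\<^sub>2\<^sup>2\<close> with respect to Haar measure.\<close>

definition weighted_measure :: "complex poly \<Rightarrow> complex measure" where
  "weighted_measure Q = density circle_measure
     (\<lambda>\<zeta>. ennreal ((cmod (poly Q \<zeta>))\<^sup>2 / (\<integral>\<xi>. (cmod (poly Q \<xi>))\<^sup>2 \<partial>circle_measure)))"

definition orthonormal_polys :: "complex measure \<Rightarrow> nat \<Rightarrow> complex poly" where
  "orthonormal_polys \<mu> = (THE \<phi>.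
     (\<forall>m. degree (\<phi> m) = m \<and> (\<exists>\<kappa>>0. lead_coeff (\<phi> m) = complex_of_real \<kappa>)) \<and>
     (\<forall>m n. (\<integral>\<zeta>. poly (\<phi> m) \<zeta> * cnj (poly (\<phi> n) \<zeta>) \<partial>\<mu>) = (if m = n then 1 else 0)))"

text \<open>The reversed polynomial \<open>\<phi>\<^sup>*(\<zeta>) = \<zeta>\<^sup>m cnj (\<phi> (1 / cnj \<zeta>))\<close> of a polynomial of degree at
  most \<open>m\<close>.\<close>

definition star_poly :: "nat \<Rightarrow> complex poly \<Rightarrow> complex poly" where
  "star_poly m \<phi> = (\<Sum>k\<le>m. monom (cnj (coeff \<phi> (m - k))) k)"

lemma poly_star_poly:
  assumes "degree \<phi> \<le> m" "\<zeta> \<noteq> 0"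
  shows "poly (star_poly m \<phi>) \<zeta> = \<zeta> ^ m * cnj (poly \<phi> (1 / cnj \<zeta>))"
proof -
  have "poly \<phi> x = (\<Sum>i\<le>m. coeff \<phi> i * x ^ i)" for x
    unfolding poly_altdef using assms(1)
    by (intro sum.mono_neutral_left) (auto simp: coeff_eq_0)
  then have "\<zeta> ^ m * cnj (poly \<phi> (1 / cnj \<zeta>)) = (\<Sum>i\<le>m. cnj (coeff \<phi> i) * \<zeta> ^ (m - i))"
    using assms(2) by (simp add: sum_distrib_left power_diff field_simps)
  also have "\<dots> = (\<Sum>i\<le>m. cnj (coeff \<phi> (m - i)) * \<zeta> ^ i)"
    by (rule sum.reindex_bij_witness[of _ "\<lambda>i. m - i" "\<lambda>i. m - i"]) auto
  finally show ?thesis by (simp add: star_poly_def poly_sum poly_monom)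
qed

definition verblunsky :: "complex measure \<Rightarrow> nat \<Rightarrow> complex" where
  "verblunsky \<mu> m = (THE \<alpha>. cmod \<alpha> < 1 \<and>
     smult (complex_of_real (sqrt (1 - (cmod \<alpha>)\<^sup>2))) (orthonormal_polys \<mu> (Suc m)) =
       [:0, 1:] * orthonormal_polys \<mu> m - smult (cnj \<alpha>) (star_poly m (orthonormal_polys \<mu> m)))"


section \<open>The bases adapted to a quasi-homogeneous polynomial\<close>

text \<open>The polynomial \<open>W\<^sup>m \<phi>(Z / W)\<close> in \<open>Z, W\<close>, for \<open>\<phi>\<close> of degree at most \<open>m\<close>.\<close>

definition homog_eval :: "nat \<Rightarrow> complex poly \<Rightarrow> complex \<Rightarrow> complex \<Rightarrow> complex" where
  "homog_eval m \<phi> Z W = (\<Sum>k\<le>m. coeff \<phi> k * Z ^ k * W ^ (m - k))"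

lemma homog_eval_eq:
  assumes "degree \<phi> \<le> m" "W \<noteq> 0"
  shows "homog_eval m \<phi> Z W = W ^ m * poly \<phi> (Z / W)"
proof -
  have "poly \<phi> x = (\<Sum>i\<le>m. coeff \<phi> i * x ^ i)" for x
    unfolding poly_altdef using assms(1)
    by (intro sum.mono_neutral_left) (auto simp: coeff_eq_0)
  then show ?thesis
    using assms(2) by (simp add: homog_eval_def sum_distrib_left power_diff field_simps)
qed

definition basis_e ::
    "nat \<Rightarrow> nat \<Rightarrow> complex poly poly \<Rightarrow> (nat \<Rightarrow> complex poly) \<Rightarrow> nat \<times> nat \<Rightarrow> bifun" where
  "basis_e s t p \<phi> = (\<lambda>(m, \<rho>) (z, w).
     polyfun p (z, w) / complex_of_real (hnorm (polyfun p)) * w ^ \<rho> *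
       homog_eval m (star_poly m (\<phi> m)) (z ^ t) (w ^ s))"

definition basis_f ::
    "nat \<Rightarrow> nat \<Rightarrow> complex poly poly \<Rightarrow> (nat \<Rightarrow> complex poly) \<Rightarrow> nat \<times> nat \<Rightarrow> bifun" where
  "basis_f s t p \<phi> = (\<lambda>(m, \<sigma>) (z, w).
     polyfun p (z, w) / complex_of_real (hnorm (polyfun p)) * z ^ \<sigma> *
       homog_eval m (\<phi> m) (z ^ t) (w ^ s))"

end

(* p z^i w^j has its Taylor coefficients on a line with direction (t, -s), so the inner product of
   two such functions is zero unless the exponents i mod t, j mod s and i div t + j div s agree, and
   otherwise it is an inner product in L^2(|Q|^2 dm) of two powers of zeta.  This makes the
   (e_(n,rho)) and (f_(m,sigma)) orthonormal bases, and P_z P_w is diagonal with respect to them: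
   <f_(m,sigma), e_(n,rho)> vanishes unless m = n and sigma = rho = 0, when it equals
   <phi_m, phi_m*> = phi_m(0) / kappa_m, that is 1 for m = 0 and -cnj alpha_(m-1) for m > 0, where
   kappa_m is the leading coefficient of phi_m.  Compactness is alpha_m --> 0.  It holds since
   kappa_m / kappa_(m+1) = sqrt (1 - |alpha_m|^2) and the increasing sequence (kappa_m) is bounded:
   the norm of phi_m is at least the modulus of the leading coefficient of Q phi_m over ||Q||. *)

theory Submission
  imports Defs "HOL-Complex_Analysis.Great_Picard"
begin

section \<open>Power series on the bidisc\<close>

text \<open>\<open>taylor\<close>, \<open>proj\<close>, \<open>adjoint_on\<close>,
  \<open>orthonormal_polys\<close> and \<open>verblunsky\<close> are definite descriptions, so each
  needs existence and uniqueness before it can be computed. No projection or representation theorem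
  is invoked: elements are handled through square summable Taylor coefficients, and projections and
  adjoints are exhibited as series over explicit orthonormal families. The diagonal form suffices
  because T g is the sum of c_n <g, f_n> e_n, so T* T g is the sum of |c_n|^2 <g, f_n> f_n, and the
  arguments of the complex numbers c_n disappear. Reversed polynomials belong to the variable z for
  this reason: phi_m is orthogonal to 1, ..., zeta^(m-1), reversal turns this into orthogonality of
  phi_m* to zeta, ..., zeta^m, and so phi_m* is a multiple of the reproducing kernel at 0 in degree
  at most m. This is also the source of the diagonal entry phi_m(0) / kappa_m. These entries depend
  on Q = q(zeta, 1) alone, so [q] is the same argument with both weights 1 and no monomial
  factor.\<close>

lemma powser_eq_zeroD:
  fixes a :: "nat \<Rightarrow> complex"
  assumes "\<And>z. norm z < 1 \<Longrightarrow> (\<lambda>n. a n * z ^ n) sums 0"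
  shows "a n = 0"
proof (cases "n = 0")
  case True
  have "(\<lambda>n. a n * 0 ^ n) sums 0" by (rule assms) simp
  then show ?thesis using True by (metis powser_sums_zero sums_unique2)
next
  case False
  show ?thesis
  proof (rule ccontr)
    assume "a n \<noteq> 0"
    then obtain r where "r > 0" "\<And>z::complex. z \<in> cball 0 r - {0} \<Longrightarrow> (0::complex) \<noteq> 0"
      using powser_0_nonzero[of 1 0 a "\<lambda>_. 0" n] assms False by auto
    from this(2)[of "of_real r"] this(1) show False by auto
  qed
qed

text \<open>The one-variable identity theorem is applied twice: for fixed w the row sums are the
  coefficients of a vanishing power series in z, and each row sum is then a vanishing power series
  in w.\<close>

lemma has_taylor_unique:
  assumes "has_taylor f c" "has_taylor f d"
  shows "c = d"
proof -
  define e where "e = (\<lambda>x. c x - d x)"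
  have hs: "((\<lambda>(i, j). e (i, j) * z ^ i * w ^ j) has_sum 0) (UNIV \<times> UNIV)"
    if "norm z < 1" "norm w < 1" for z w
  proof -
    have "(z, w) \<in> bidisc" using that by (auto simp: bidisc_def)
    with assms have "((\<lambda>(i, j). c (i, j) * z ^ i * w ^ j) has_sum f (z, w)) UNIV"
      "((\<lambda>(i, j). d (i, j) * z ^ i * w ^ j) has_sum f (z, w)) UNIV"
      by (auto simp: has_taylor_def)
    from has_sum_add[OF this(1) has_sum_uminusI[OF this(2)]] show ?thesis
      by (simp add: e_def case_prod_unfold algebra_simps)
  qed
  have sm: "(\<lambda>j. e (i, j) * w ^ j) summable_on UNIV" if "norm w < 1" for i w
  proof -
    \<comment> \<open>Any nonzero z in the disc would do; it makes the factor \<open>z ^ i\<close>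
      cancellable, which leaves summability of the single row.\<close>
    have "(\<lambda>(i, j). e (i, j) * (1/2) ^ i * w ^ j) summable_on (UNIV \<times> UNIV)"
      using hs[of "1/2" w] that by (auto intro: has_sum_imp_summable)
    from summable_on_SigmaD1[OF this, of i]
    have "(\<lambda>j. (1/2) ^ i * (e (i, j) * w ^ j)) summable_on UNIV" by (simp add: mult_ac)
    then show ?thesis by (subst (asm) summable_on_cmult_right') auto
  qed
  have z0: "(\<Sum>\<^sub>\<infinity>j. e (i, j) * w ^ j) = 0" if w: "norm w < 1" for i w
  proof (rule powser_eq_zeroD)
    fix z :: complex assume z: "norm z < 1"
    have "((\<lambda>i. (\<Sum>\<^sub>\<infinity>j. e (i, j) * w ^ j) * z ^ i) has_sum 0) UNIV"
    proof (rule has_sum_SigmaD[OF hs[OF z w]], simp)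
      fix i
      have "((\<lambda>j. e (i, j) * w ^ j * z ^ i) has_sum (\<Sum>\<^sub>\<infinity>j. e (i, j) * w ^ j) * z ^ i) UNIV"
        by (intro has_sum_cmult_left has_sum_infsum sm w)
      then show "((\<lambda>j. e (i, j) * z ^ i * w ^ j) has_sum (\<Sum>\<^sub>\<infinity>j. e (i, j) * w ^ j) * z ^ i) UNIV"
        by (simp add: mult_ac)
    qed
    then show "(\<lambda>i. (\<Sum>\<^sub>\<infinity>j. e (i, j) * w ^ j) * z ^ i) sums 0"
      by (rule has_sum_imp_sums)
  qed
  have "e (i, j) = 0" for i j
  proof (rule powser_eq_zeroD)
    fix w :: complex assume w: "norm w < 1"
    have "((\<lambda>j. e (i, j) * w ^ j) has_sum 0) UNIV"
      using has_sum_infsum[OF sm[OF w, of i]] z0[OF w, of i] by simp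
    then show "(\<lambda>j. e (i, j) * w ^ j) sums 0" by (rule has_sum_imp_sums)
  qed
  then show ?thesis by (auto simp: e_def fun_eq_iff)
qed

lemma taylor_eqI: "has_taylor f c \<Longrightarrow> taylor f = c"
  unfolding taylor_def by (rule the_equality) (auto intro: has_taylor_unique)

section \<open>Square summable families\<close>

definition l2 :: "('i \<Rightarrow> complex) \<Rightarrow> 'i set \<Rightarrow> bool" where
  "l2 c I \<longleftrightarrow> (\<lambda>i. (cmod (c i))\<^sup>2) summable_on I"

lemma l2_mult_summable:
  assumes "l2 c I" "l2 d I"
  shows "(\<lambda>i. norm (c i * d i)) summable_on I"
proof (rule abs_summable_product)
  show "(\<lambda>i. norm (c i * c i)) summable_on I" "(\<lambda>i. norm (d i * d i)) summable_on I"
    using assms by (simp_all add: l2_def norm_mult power2_eq_square)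
qed

lemma l2_cnj [simp]: "l2 (\<lambda>i. cnj (c i)) I \<longleftrightarrow> l2 c I"
  by (simp add: l2_def)

lemma l2_mult_cnj_summable:
  assumes "l2 c I" "l2 d I"
  shows "(\<lambda>i. c i * cnj (d i)) summable_on I"
  by (rule abs_summable_summable, rule l2_mult_summable) (use assms in simp_all)

lemma l2_scale: "l2 c I \<Longrightarrow> l2 (\<lambda>i. k * c i) I"
  unfolding l2_def norm_mult power_mult_distrib by (rule summable_on_cmult_right)

lemma l2_add:
  assumes "l2 c I" "l2 d I"
  shows "l2 (\<lambda>i. c i + d i) I"
  unfolding l2_def
proof (rule summable_on_comparison_test)
  show "(\<lambda>i. 2 * (cmod (c i))\<^sup>2 + 2 * (cmod (d i))\<^sup>2) summable_on I"
    using assms unfolding l2_def by (intro summable_on_add summable_on_cmult_right)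
  fix i
  have "(cmod (c i + d i))\<^sup>2 \<le> (cmod (c i) + cmod (d i))\<^sup>2"
    by (intro power_mono norm_triangle_ineq) auto
  also have "\<dots> \<le> 2 * (cmod (c i))\<^sup>2 + 2 * (cmod (d i))\<^sup>2"
    using sum_squares_bound[of "cmod (c i)" "cmod (d i)"] by (simp add: power2_sum)
  finally show "(cmod (c i + d i))\<^sup>2 \<le> 2 * (cmod (c i))\<^sup>2 + 2 * (cmod (d i))\<^sup>2" .
qed auto

lemma l2_diff: "l2 c I \<Longrightarrow> l2 d I \<Longrightarrow> l2 (\<lambda>i. c i - d i) I"
  using l2_add[of c I "\<lambda>i. (-1) * d i"] l2_scale[of d I "-1"] by simp

lemma l2_mono:
  assumes "l2 c I" "\<And>i. i \<in> I \<Longrightarrow> cmod (d i) \<le> K * cmod (c i)"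
  shows "l2 d I"
  unfolding l2_def
proof (rule summable_on_comparison_test)
  show "(\<lambda>i. K\<^sup>2 * (cmod (c i))\<^sup>2) summable_on I"
    using assms(1) unfolding l2_def by (rule summable_on_cmult_right)
  show "(cmod (d i))\<^sup>2 \<le> K\<^sup>2 * (cmod (c i))\<^sup>2" if "i \<in> I" for i
    using power_mono[OF assms(2)[OF that], of 2] by (simp add: power_mult_distrib)
qed auto

text \<open>The squared moduli form a product of two geometric series. Paired with
  \<open>l2_mult_summable\<close>, this makes the series of any square summable coefficient family
  converge at every point of the bidisc.\<close>

lemma l2_geometric:
  assumes "norm z < 1" "norm w < 1"
  shows "l2 (\<lambda>(i, j). z ^ i * w ^ j) (UNIV \<times> UNIV :: (nat \<times> nat) set)"
proof -
  have g: "((\<lambda>n. ((cmod u)\<^sup>2) ^ n) has_sum (1 / (1 - (cmod u)\<^sup>2))) UNIV" if "norm u < 1" for u :: complex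
  proof (rule norm_summable_imp_has_sum)
    have "(cmod u)\<^sup>2 < 1" using that by (simp add: power_less_one_iff abs_square_less_1)
    then show "summable (\<lambda>n. norm (((cmod u)\<^sup>2) ^ n))" "(\<lambda>n. ((cmod u)\<^sup>2) ^ n) sums (1 / (1 - (cmod u)\<^sup>2))"
      by (auto intro!: geometric_sums)
  qed
  show ?thesis unfolding l2_def
  proof (rule summable_on_SigmaI)
    show "((\<lambda>j. (cmod (case (i, j) of (i, j) \<Rightarrow> z ^ i * w ^ j))\<^sup>2) has_sum
             (((cmod z)\<^sup>2) ^ i * (1 / (1 - (cmod w)\<^sup>2)))) UNIV" for i
      using has_sum_cmult_right[OF g[OF assms(2)], of "((cmod z)\<^sup>2) ^ i"]
      by (simp add: norm_mult norm_power power_mult_distrib power_mult[symmetric] mult.commute)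
    show "(\<lambda>i. ((cmod z)\<^sup>2) ^ i * (1 / (1 - (cmod w)\<^sup>2))) summable_on UNIV"
      using g[OF assms(1)] by (intro summable_on_cmult_left) (rule has_sum_imp_summable)
  qed auto
qed

definition hfun :: "(nat \<times> nat \<Rightarrow> complex) \<Rightarrow> bifun" where
  "hfun c = (\<lambda>(z, w). if (z, w) \<in> bidisc then \<Sum>\<^sub>\<infinity>(i, j). c (i, j) * z ^ i * w ^ j else 0)"

lemma has_taylor_hfun:
  assumes "l2 c UNIV"
  shows "has_taylor (hfun c) c"
  unfolding has_taylor_def
proof (intro allI impI)
  fix z w assume zw: "(z, w) \<in> bidisc"
  then have "l2 (\<lambda>(i, j). z ^ i * w ^ j) (UNIV :: (nat \<times> nat) set)"
    using l2_geometric[of z w] by (auto simp: bidisc_def)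
  from abs_summable_summable[OF l2_mult_summable[OF assms this]]
  have "(\<lambda>(i, j). c (i, j) * z ^ i * w ^ j) summable_on UNIV"
    by (simp add: case_prod_unfold mult.assoc)
  from has_sum_infsum[OF this]
  show "((\<lambda>(i, j). c (i, j) * z ^ i * w ^ j) has_sum hfun c (z, w)) UNIV"
    using zw by (simp add: hfun_def)
qed

lemma taylor_hfun: "l2 c UNIV \<Longrightarrow> taylor (hfun c) = c"
  by (rule taylor_eqI) (rule has_taylor_hfun)

lemma hfun_in_hardy2: "l2 c UNIV \<Longrightarrow> hfun c \<in> hardy2"
  using has_taylor_hfun[of c] by (auto simp: hardy2_def l2_def hfun_def)

lemma
  assumes "f \<in> hardy2"
  shows has_taylor_taylor: "has_taylor f (taylor f)" and l2_taylor: "l2 (taylor f) UNIV"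
    and hardy2_outside: "x \<notin> bidisc \<Longrightarrow> f x = 0"
proof -
  from assms obtain c where c: "has_taylor f c" "l2 c UNIV" and "\<forall>x. x \<notin> bidisc \<longrightarrow> f x = 0"
    unfolding hardy2_def l2_def by blast
  then show "has_taylor f (taylor f)" "l2 (taylor f) UNIV" "x \<notin> bidisc \<Longrightarrow> f x = 0"
    using taylor_eqI[OF c(1)] by blast+
qed

lemma hardy2I: "has_taylor f c \<Longrightarrow> l2 c UNIV \<Longrightarrow> (\<And>x. x \<notin> bidisc \<Longrightarrow> f x = 0) \<Longrightarrow> f \<in> hardy2"
  by (auto simp: hardy2_def l2_def)

lemma hardy2_eqI:
  assumes "f \<in> hardy2" "g \<in> hardy2" "taylor f = taylor g"
  shows "f = g"
proof
  fix x
  show "f x = g x"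
  proof (cases "x \<in> bidisc")
    case True
    then obtain z w where x: "x = (z, w)" "(z, w) \<in> bidisc" by (cases x) auto
    with has_taylor_taylor[OF assms(1)] has_taylor_taylor[OF assms(2)]
    have "((\<lambda>(i, j). taylor g (i, j) * z ^ i * w ^ j) has_sum f (z, w)) UNIV"
      "((\<lambda>(i, j). taylor g (i, j) * z ^ i * w ^ j) has_sum g (z, w)) UNIV"
      unfolding has_taylor_def assms(3) by blast+
    then show ?thesis unfolding x(1) by (rule has_sum_unique)
  qed (simp add: assms hardy2_outside)
qed

lemma has_taylor_add:
  assumes "has_taylor f c" "has_taylor g d"
  shows "has_taylor (\<lambda>x. f x + g x) (\<lambda>x. c x + d x)"
  unfolding has_taylor_def
proof (intro allI impI)
  fix z w assume "(z, w) \<in> bidisc"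
  with assms have "((\<lambda>(i, j). c (i, j) * z ^ i * w ^ j) has_sum f (z, w)) UNIV"
    "((\<lambda>(i, j). d (i, j) * z ^ i * w ^ j) has_sum g (z, w)) UNIV" by (auto simp: has_taylor_def)
  from has_sum_add[OF this]
  show "((\<lambda>(i, j). (c (i, j) + d (i, j)) * z ^ i * w ^ j) has_sum f (z, w) + g (z, w)) UNIV"
    by (simp add: case_prod_unfold algebra_simps)
qed

lemma has_taylor_scale:
  assumes "has_taylor f c"
  shows "has_taylor (\<lambda>x. k * f x) (\<lambda>x. k * c x)"
  unfolding has_taylor_def
proof (intro allI impI)
  fix z w assume "(z, w) \<in> bidisc"
  with assms have "((\<lambda>(i, j). c (i, j) * z ^ i * w ^ j) has_sum f (z, w)) UNIV"
    by (auto simp: has_taylor_def)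
  from has_sum_cmult_right[OF this, of k]
  show "((\<lambda>(i, j). k * c (i, j) * z ^ i * w ^ j) has_sum k * f (z, w)) UNIV"
    by (simp add: case_prod_unfold algebra_simps)
qed

lemma
  assumes "f \<in> hardy2" "g \<in> hardy2"
  shows hardy2_add: "(\<lambda>x. f x + g x) \<in> hardy2"
    and taylor_add: "taylor (\<lambda>x. f x + g x) = (\<lambda>x. taylor f x + taylor g x)"
proof -
  have *: "has_taylor (\<lambda>x. f x + g x) (\<lambda>x. taylor f x + taylor g x)"
    using assms by (intro has_taylor_add has_taylor_taylor)
  then show "taylor (\<lambda>x. f x + g x) = (\<lambda>x. taylor f x + taylor g x)" by (rule taylor_eqI)
  from * show "(\<lambda>x. f x + g x) \<in> hardy2"
    by (rule hardy2I) (use assms in \<open>simp_all add: l2_add l2_taylor hardy2_outside\<close>)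
qed

lemma
  assumes "f \<in> hardy2"
  shows hardy2_scale: "(\<lambda>x. k * f x) \<in> hardy2"
    and taylor_scale: "taylor (\<lambda>x. k * f x) = (\<lambda>x. k * taylor f x)"
proof -
  have *: "has_taylor (\<lambda>x. k * f x) (\<lambda>x. k * taylor f x)"
    using assms by (intro has_taylor_scale has_taylor_taylor)
  then show "taylor (\<lambda>x. k * f x) = (\<lambda>x. k * taylor f x)" by (rule taylor_eqI)
  from * show "(\<lambda>x. k * f x) \<in> hardy2"
    by (rule hardy2I) (use assms in \<open>simp_all add: l2_scale l2_taylor hardy2_outside\<close>)
qed

lemma
  assumes "f \<in> hardy2" "g \<in> hardy2"
  shows hardy2_diff: "(\<lambda>x. f x - g x) \<in> hardy2"
    and taylor_diff: "taylor (\<lambda>x. f x - g x) = (\<lambda>x. taylor f x - taylor g x)"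
  using hardy2_add[OF assms(1) hardy2_scale[OF assms(2), of "-1"]]
    taylor_add[OF assms(1) hardy2_scale[OF assms(2), of "-1"]] taylor_scale[OF assms(2), of "-1"]
  by auto

lemma hardy2_zero: "(\<lambda>x. 0) \<in> hardy2" and taylor_zero: "taylor (\<lambda>x. 0) = (\<lambda>x. 0)"
proof -
  have *: "has_taylor (\<lambda>x. 0) (\<lambda>x. 0)" by (simp add: has_taylor_def case_prod_unfold)
  then show "(\<lambda>x. 0) \<in> hardy2" by (rule hardy2I) (auto simp: l2_def)
  from * show "taylor (\<lambda>x. 0) = (\<lambda>x. 0)" by (rule taylor_eqI)
qed

lemma
  assumes "\<And>i. i \<in> I \<Longrightarrow> f i \<in> hardy2"
  shows hardy2_sum: "(\<lambda>x. \<Sum>i\<in>I. f i x) \<in> hardy2"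
    and taylor_sum: "taylor (\<lambda>x. \<Sum>i\<in>I. f i x) = (\<lambda>x. \<Sum>i\<in>I. taylor (f i) x)"
  using assms
  by (induction I rule: infinite_finite_induct)
    (simp_all add: hardy2_zero taylor_zero hardy2_add taylor_add)

section \<open>Inner product and norm\<close>

lemma hinner_has_sum:
  assumes "f \<in> hardy2" "g \<in> hardy2"
  shows "((\<lambda>x. taylor f x * cnj (taylor g x)) has_sum hinner f g) UNIV"
  unfolding hinner_def using assms by (intro has_sum_infsum l2_mult_cnj_summable l2_taylor)

lemma hinner_add_left:
  assumes "f \<in> hardy2" "g \<in> hardy2" "h \<in> hardy2"
  shows "hinner (\<lambda>x. f x + g x) h = hinner f h + hinner g h"
  unfolding hinner_def taylor_add[OF assms(1,2)] distrib_right
  using assms by (intro infsum_add l2_mult_cnj_summable l2_taylor)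

lemma hinner_scale_left:
  assumes "f \<in> hardy2"
  shows "hinner (\<lambda>x. k * f x) h = k * hinner f h"
  unfolding hinner_def taylor_scale[OF assms] mult.assoc by (rule infsum_cmult_right')

lemma hinner_sym: "hinner f g = cnj (hinner g f)"
  unfolding hinner_def by (simp add: mult.commute flip: infsum_cnj)

lemma hinner_diff_left:
  assumes "f \<in> hardy2" "g \<in> hardy2" "h \<in> hardy2"
  shows "hinner (\<lambda>x. f x - g x) h = hinner f h - hinner g h"
  using hinner_add_left[OF assms(1) hardy2_scale[OF assms(2), of "-1"] assms(3)]
    hinner_scale_left[OF assms(2), of "-1" h] by simp

lemma hinner_add_right:
  assumes "f \<in> hardy2" "g \<in> hardy2" "h \<in> hardy2"
  shows "hinner h (\<lambda>x. f x + g x) = hinner h f + hinner h g"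
  by (metis hinner_add_left[OF assms] hinner_sym complex_cnj_add)

lemma hinner_diff_right:
  assumes "f \<in> hardy2" "g \<in> hardy2" "h \<in> hardy2"
  shows "hinner h (\<lambda>x. f x - g x) = hinner h f - hinner h g"
  by (metis hinner_diff_left[OF assms] hinner_sym complex_cnj_diff)

lemma hinner_scale_right:
  assumes "f \<in> hardy2"
  shows "hinner h (\<lambda>x. k * f x) = cnj k * hinner h f"
  by (metis hinner_scale_left[OF assms] hinner_sym complex_cnj_mult)

lemma hinner_zero_left [simp]: "hinner (\<lambda>x. 0) h = 0"
  by (simp add: hinner_def taylor_zero)

lemma hinner_zero_right [simp]: "hinner h (\<lambda>x. 0) = 0"
  by (simp add: hinner_def taylor_zero)

lemma hinner_sum_left:
  assumes "\<And>i. i \<in> I \<Longrightarrow> f i \<in> hardy2" "h \<in> hardy2"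
  shows "hinner (\<lambda>x. \<Sum>i\<in>I. f i x) h = (\<Sum>i\<in>I. hinner (f i) h)"
  using assms
  by (induction I rule: infinite_finite_induct) (simp_all add: hinner_add_left hardy2_sum)

lemma hinner_sum_right:
  assumes "\<And>i. i \<in> I \<Longrightarrow> f i \<in> hardy2" "h \<in> hardy2"
  shows "hinner h (\<lambda>x. \<Sum>i\<in>I. f i x) = (\<Sum>i\<in>I. hinner h (f i))"
  using assms
  by (induction I rule: infinite_finite_induct) (simp_all add: hinner_add_right hardy2_sum)

lemma
  assumes "f \<in> hardy2"
  shows hinner_self_has_sum: "((\<lambda>x. (cmod (taylor f x))\<^sup>2) has_sum (hnorm f)\<^sup>2) UNIV"
    and hinner_self: "hinner f f = of_real ((hnorm f)\<^sup>2)"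
proof -
  have hs: "((\<lambda>x. (cmod (taylor f x))\<^sup>2) has_sum (\<Sum>\<^sub>\<infinity>x. (cmod (taylor f x))\<^sup>2)) UNIV" (is "(_ has_sum ?S) _")
    using l2_taylor[OF assms] unfolding l2_def by (rule has_sum_infsum)
  then have "?S \<ge> 0" by (auto intro: infsum_nonneg)
  have "((\<lambda>x. complex_of_real ((cmod (taylor f x))\<^sup>2)) has_sum of_real ?S) UNIV"
    using hs by (rule has_sum_of_real)
  then have "((\<lambda>x. taylor f x * cnj (taylor f x)) has_sum of_real ?S) UNIV"
    by (simp only: complex_norm_square)
  then have "hinner f f = of_real ?S"
    by (rule has_sum_unique[OF hinner_has_sum[OF assms assms]])
  then show "((\<lambda>x. (cmod (taylor f x))\<^sup>2) has_sum (hnorm f)\<^sup>2) UNIV" "hinner f f = of_real ((hnorm f)\<^sup>2)"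
    using hs \<open>?S \<ge> 0\<close> by (auto simp: hnorm_def)
qed

text \<open>The real \<open>sqrt\<close> is negative on negative arguments, so the sign of
  \<open>Re (hinner f f)\<close> matters even for \<open>f\<close> outside the Hardy space. A family
  that is not summable has infinite sum 0 by convention.\<close>

lemma hnorm_nonneg [simp]: "hnorm f \<ge> 0"
proof (cases "Re (hinner f f) \<ge> 0")
  case False
  have "hinner f f \<ge> 0"
  proof (cases "(\<lambda>x. taylor f x * cnj (taylor f x)) summable_on UNIV")
    case True
    then show ?thesis
      unfolding hinner_def by (rule infsum_nonneg_complex) (simp add: less_eq_complex_def)
  qed (simp add: hinner_def infsum_not_exists)
  then show ?thesis using False by (simp add: less_eq_complex_def)
qed (simp add: hnorm_def)

lemma hnorm_eq_zeroD:
  assumes "f \<in> hardy2" "hnorm f = 0"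
  shows "f = (\<lambda>x. 0)"
proof (rule hardy2_eqI[OF assms(1) hardy2_zero])
  have "((\<lambda>x. (cmod (taylor f x))\<^sup>2) has_sum 0) UNIV"
    using hinner_self_has_sum[OF assms(1)] assms(2) by simp
  then have "(cmod (taylor f x))\<^sup>2 = 0" for x
    by (rule nonneg_has_sum_le_0D) auto
  then show "taylor f = taylor (\<lambda>x. 0)" by (auto simp: taylor_zero)
qed

lemma hinner_self_eq_zeroD: "f \<in> hardy2 \<Longrightarrow> hinner f f = 0 \<Longrightarrow> f = (\<lambda>x. 0)"
  by (rule hnorm_eq_zeroD) (simp_all add: hnorm_def)

lemma hnorm_scale: "f \<in> hardy2 \<Longrightarrow> hnorm (\<lambda>x. k * f x) = cmod k * hnorm f"
proof -
  assume f: "f \<in> hardy2"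
  have "hinner (\<lambda>x. k * f x) (\<lambda>x. k * f x) = k * cnj k * hinner f f"
    by (simp add: hinner_scale_left hinner_scale_right f hardy2_scale)
  also have "\<dots> = of_real ((cmod k * hnorm f)\<^sup>2)"
    by (simp add: hinner_self[OF f] power_mult_distrib complex_norm_square[symmetric])
  finally have "(hnorm (\<lambda>x. k * f x))\<^sup>2 = (cmod k * hnorm f)\<^sup>2"
    unfolding hinner_self[OF hardy2_scale[OF f]] by (simp only: of_real_eq_iff)
  then show ?thesis by (rule power2_eq_imp_eq) simp_all
qed

lemma hinner_cauchy_schwarz:
  assumes "f \<in> hardy2" "g \<in> hardy2"
  shows "cmod (hinner f g) \<le> hnorm f * hnorm g"
proof (cases "hnorm g = 0")
  case True
  then show ?thesis using hnorm_eq_zeroD[OF assms(2)] by auto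
next
  case False
  then have gp: "hnorm g > 0" using hnorm_nonneg[of g] by linarith
  \<comment> \<open>The multiple \<open>k * g\<close> is the orthogonal projection of
    \<open>f\<close> onto the line of \<open>g\<close>; the claim is that the squared norm of
    \<open>f - k g\<close> is nonnegative.\<close>
  define k where "k = hinner f g / of_real ((hnorm g)\<^sup>2)"
  have kg: "(\<lambda>x. k * g x) \<in> hardy2" by (rule hardy2_scale[OF assms(2)])
  have "hinner (\<lambda>x. f x - k * g x) (\<lambda>x. f x - k * g x)
      = hinner f f - cnj k * hinner f g - k * hinner g f + k * cnj k * hinner g g"
    using assms kg by (simp add: hinner_diff_left hinner_diff_right hinner_scale_left
        hinner_scale_right hardy2_diff algebra_simps)
  also have "\<dots> = hinner f f - hinner f g * cnj (hinner f g) / of_real ((hnorm g)\<^sup>2)"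
    unfolding hinner_sym[of g f] hinner_self[OF assms(2)] k_def
    using gp by (simp add: field_simps power2_eq_square)
  also have "\<dots> = of_real ((hnorm f)\<^sup>2 - (cmod (hinner f g))\<^sup>2 / (hnorm g)\<^sup>2)"
    by (simp add: hinner_self[OF assms(1)] complex_norm_square[symmetric])
  also have "hinner (\<lambda>x. f x - k * g x) (\<lambda>x. f x - k * g x) = of_real ((hnorm (\<lambda>x. f x - k * g x))\<^sup>2)"
    by (rule hinner_self[OF hardy2_diff[OF assms(1) kg]])
  finally have "(hnorm f)\<^sup>2 - (cmod (hinner f g))\<^sup>2 / (hnorm g)\<^sup>2 \<ge> 0"
    by (metis of_real_eq_iff zero_le_power2)
  then have "(cmod (hinner f g))\<^sup>2 \<le> (hnorm f * hnorm g)\<^sup>2"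
    using gp by (simp add: field_simps power_mult_distrib)
  then show ?thesis by (rule power2_le_imp_le) simp
qed

lemma hnorm_triangle:
  assumes "f \<in> hardy2" "g \<in> hardy2"
  shows "hnorm (\<lambda>x. f x + g x) \<le> hnorm f + hnorm g"
proof (rule power2_le_imp_le)
  have "complex_of_real ((hnorm (\<lambda>x. f x + g x))\<^sup>2) = hinner (\<lambda>x. f x + g x) (\<lambda>x. f x + g x)"
    by (rule hinner_self[symmetric]) (rule hardy2_add[OF assms])
  also have "\<dots> = hinner f f + hinner g g + hinner f g + cnj (hinner f g)"
    using assms by (simp add: hinner_add_left hinner_add_right hardy2_add flip: hinner_sym)
  finally have "(hnorm (\<lambda>x. f x + g x))\<^sup>2 = (hnorm f)\<^sup>2 + (hnorm g)\<^sup>2 + 2 * Re (hinner f g)"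
    unfolding hinner_self[OF assms(1)] hinner_self[OF assms(2)]
    by (metis (no_types, lifting) Re_complex_of_real complex_add_cnj of_real_add add.assoc)
  also have "\<dots> \<le> (hnorm f)\<^sup>2 + (hnorm g)\<^sup>2 + 2 * (hnorm f * hnorm g)"
    using hinner_cauchy_schwarz[OF assms] complex_Re_le_cmod[of "hinner f g"] by linarith
  finally show "(hnorm (\<lambda>x. f x + g x))\<^sup>2 \<le> (hnorm f + hnorm g)\<^sup>2"
    by (simp add: power2_sum)
qed simp

section \<open>Orthonormal families in the Hardy space\<close>

definition orthonormal :: "'i set \<Rightarrow> ('i \<Rightarrow> bifun) \<Rightarrow> bool" where
  "orthonormal I u \<longleftrightarrow> (\<forall>i\<in>I. u i \<in> hardy2) \<and>
     (\<forall>i\<in>I. \<forall>j\<in>I. hinner (u i) (u j) = (if i = j then 1 else 0))"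

lemma orthonormalD:
  assumes "orthonormal I u"
  shows "i \<in> I \<Longrightarrow> u i \<in> hardy2"
    and "i \<in> I \<Longrightarrow> j \<in> I \<Longrightarrow> hinner (u i) (u j) = (if i = j then 1 else 0)"
  using assms by (auto simp: orthonormal_def)

lemma orthonormal_subset: "orthonormal I u \<Longrightarrow> J \<subseteq> I \<Longrightarrow> orthonormal J u"
  unfolding orthonormal_def by (meson subsetD)

lemma hinner_lincomb_left:
  assumes "orthonormal I u" "J \<subseteq> I" "h \<in> hardy2"
  shows "hinner (\<lambda>y. \<Sum>i\<in>J. x i * u i y) h = (\<Sum>i\<in>J. x i * hinner (u i) h)"
proof -
  have u: "u i \<in> hardy2" if "i \<in> J" for i using assms that by (auto simp: orthonormal_def)
  have "hinner (\<lambda>y. \<Sum>i\<in>J. x i * u i y) h = (\<Sum>i\<in>J. hinner (\<lambda>y. x i * u i y) h)"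
    by (rule hinner_sum_left) (simp_all add: u hardy2_scale assms)
  then show ?thesis by (simp add: hinner_scale_left u)
qed

lemma lincomb_in_hardy2:
  assumes "orthonormal I u" "J \<subseteq> I"
  shows "(\<lambda>y. \<Sum>i\<in>J. x i * u i y) \<in> hardy2"
  by (rule hardy2_sum, rule hardy2_scale) (use assms in \<open>auto simp: orthonormal_def\<close>)

lemma hnorm_lincomb:
  assumes "orthonormal I u" "finite J" "J \<subseteq> I"
  shows "(hnorm (\<lambda>y. \<Sum>i\<in>J. x i * u i y))\<^sup>2 = (\<Sum>i\<in>J. (cmod (x i))\<^sup>2)"
proof -
  let ?s = "\<lambda>y. \<Sum>i\<in>J. x i * u i y"
  have s: "?s \<in> hardy2" by (rule lincomb_in_hardy2[OF assms(1,3)])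
  have us: "hinner (u i) ?s = cnj (x i)" if "i \<in> J" for i
  proof -
    have "hinner ?s (u i) = (\<Sum>j\<in>J. x j * hinner (u j) (u i))"
      by (rule hinner_lincomb_left[OF assms(1,3)]) (use assms that in \<open>auto simp: orthonormal_def\<close>)
    also have "\<dots> = (\<Sum>j\<in>J. if j = i then x j else 0)"
      using assms that by (intro sum.cong) (auto simp: orthonormal_def subset_iff)
    also have "\<dots> = x i" using that assms(2) by simp
    finally show ?thesis using hinner_sym by metis
  qed
  have "complex_of_real ((hnorm ?s)\<^sup>2) = (\<Sum>i\<in>J. x i * hinner (u i) ?s)"
    unfolding hinner_self[OF s, symmetric] by (rule hinner_lincomb_left[OF assms(1,3) s])
  also have "\<dots> = complex_of_real (\<Sum>i\<in>J. (cmod (x i))\<^sup>2)"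
    unfolding of_real_sum by (intro sum.cong refl) (simp only: us complex_norm_square)
  finally show ?thesis by (simp only: of_real_eq_iff)
qed

text \<open>For the partial Fourier sum \<open>s\<close>, both \<open>hinner s f\<close> and
  \<open>hinner s s\<close> equal the left-hand side, so the squared norm of \<open>f - s\<close> is
  the difference of the two sides.\<close>

lemma bessel_finite:
  assumes "orthonormal I u" "f \<in> hardy2" "finite J" "J \<subseteq> I"
  shows "(\<Sum>i\<in>J. (cmod (hinner f (u i)))\<^sup>2) \<le> (hnorm f)\<^sup>2"
proof -
  define s where "s = (\<lambda>y. \<Sum>i\<in>J. hinner f (u i) * u i y)"
  let ?B = "\<Sum>i\<in>J. (cmod (hinner f (u i)))\<^sup>2"
  have s: "s \<in> hardy2" unfolding s_def by (rule lincomb_in_hardy2[OF assms(1,4)])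
  have ss: "hinner s s = of_real ?B"
    unfolding hinner_self[OF s] using hnorm_lincomb[OF assms(1,3,4)] by (simp add: s_def)
  have "hinner s f = (\<Sum>i\<in>J. hinner f (u i) * hinner (u i) f)"
    unfolding s_def by (rule hinner_lincomb_left[OF assms(1,4,2)])
  also have "\<dots> = (\<Sum>i\<in>J. hinner f (u i) * cnj (hinner f (u i)))"
    by (intro sum.cong refl) (metis hinner_sym)
  also have "\<dots> = of_real ?B" unfolding of_real_sum by (simp only: complex_norm_square)
  finally have sf: "hinner s f = of_real ?B" .
  then have fs: "hinner f s = of_real ?B" by (metis hinner_sym complex_cnj_complex_of_real)
  have "hinner (\<lambda>x. f x - s x) (\<lambda>x. f x - s x) = of_real ((hnorm f)\<^sup>2 - ?B)"
    using assms(2) s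
    by (simp add: hinner_diff_left hinner_diff_right hardy2_diff sf fs ss hinner_self[OF assms(2)])
  then have "(hnorm (\<lambda>x. f x - s x))\<^sup>2 = (hnorm f)\<^sup>2 - ?B"
    unfolding hinner_self[OF hardy2_diff[OF assms(2) s]] by (simp only: of_real_eq_iff)
  then show ?thesis by (metis diff_ge_0_iff_ge zero_le_power2)
qed

lemma l2_bessel:
  assumes "orthonormal I u" "f \<in> hardy2"
  shows "l2 (\<lambda>i. hinner f (u i)) I"
  unfolding l2_def
  by (rule nonneg_bdd_above_summable_on)
    (auto intro!: bdd_aboveI2[where M = "(hnorm f)\<^sup>2"] bessel_finite[OF assms])

text \<open>A Taylor coefficient is the inner product with a monomial, so this is Bessel's
  inequality for that monomial. It makes the coefficientwise series over an orthonormal family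
  converge.\<close>

lemma l2_taylor_orthonormal:
  assumes "orthonormal I u"
  shows "l2 (\<lambda>i. taylor (u i) k) I"
proof -
  let ?m = "hfun (\<lambda>x. if x = k then 1 else 0)"
  have l: "l2 (\<lambda>x. if x = k then 1 else 0) UNIV"
    unfolding l2_def by (rule finite_nonzero_values_imp_summable_on) simp
  have "hinner f ?m = taylor f k" if "f \<in> hardy2" for f
  proof -
    have "((\<lambda>x. taylor f x * cnj (taylor ?m x)) has_sum taylor f k) UNIV"
      unfolding taylor_hfun[OF l] by (rule has_sum_finite_neutralI[of "{k}"]) auto
    then show ?thesis
      using has_sum_unique[OF hinner_has_sum[OF that hfun_in_hardy2[OF l]]] by blast
  qed
  then have "hinner ?m (u i) = cnj (taylor (u i) k)" if "i \<in> I" for i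
    using orthonormalD(1)[OF assms that] by (metis hinner_sym)
  moreover have "l2 (\<lambda>i. hinner ?m (u i)) I"
    by (rule l2_bessel[OF assms hfun_in_hardy2[OF l]])
  ultimately have "l2 (\<lambda>i. cnj (taylor (u i) k)) I"
    by (simp add: l2_def cong: summable_on_cong)
  then show ?thesis by simp
qed

text \<open>The sum of the series \<open>x i * u i\<close>, formed coefficientwise; for square summable \<open>x\<close> and
  orthonormal \<open>u\<close> it converges in norm (\<open>hsum_approx_tendsto\<close>).\<close>

definition hsum :: "'i set \<Rightarrow> ('i \<Rightarrow> complex) \<Rightarrow> ('i \<Rightarrow> bifun) \<Rightarrow> bifun" where
  "hsum I x u = hfun (\<lambda>k. \<Sum>\<^sub>\<infinity>i\<in>I. x i * taylor (u i) k)"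

lemma hsum_coeff_has_sum:
  assumes "orthonormal I u" "l2 x I"
  shows "((\<lambda>i. x i * taylor (u i) k) has_sum (\<Sum>\<^sub>\<infinity>i\<in>I. x i * taylor (u i) k)) I"
  by (rule has_sum_infsum, rule abs_summable_summable,
      rule l2_mult_summable[OF assms(2) l2_taylor_orthonormal[OF assms(1)]])

text \<open>A Fatou argument: for finitely many Taylor coefficients the bound holds for every finite
  partial sum, by Pythagoras, and survives the limit. It takes the place of completeness of the
  space.\<close>

lemma hsum_coeff_bound:
  assumes "orthonormal I u" "l2 x I" "finite K"
  shows "(\<Sum>k\<in>K. (cmod (\<Sum>\<^sub>\<infinity>i\<in>I. x i * taylor (u i) k))\<^sup>2) \<le> (\<Sum>\<^sub>\<infinity>i\<in>I. (cmod (x i))\<^sup>2)"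
proof (rule tendsto_upperbound)
  show "((\<lambda>Y. \<Sum>k\<in>K. (cmod (\<Sum>i\<in>Y. x i * taylor (u i) k))\<^sup>2) \<longlongrightarrow>
      (\<Sum>k\<in>K. (cmod (\<Sum>\<^sub>\<infinity>i\<in>I. x i * taylor (u i) k))\<^sup>2)) (finite_subsets_at_top I)"
    using hsum_coeff_has_sum[OF assms(1,2)] unfolding has_sum_def
    by (intro tendsto_sum tendsto_power tendsto_norm)
  show "\<forall>\<^sub>F Y in finite_subsets_at_top I.
      (\<Sum>k\<in>K. (cmod (\<Sum>i\<in>Y. x i * taylor (u i) k))\<^sup>2) \<le> (\<Sum>\<^sub>\<infinity>i\<in>I. (cmod (x i))\<^sup>2)"
    unfolding eventually_finite_subsets_at_top
  proof (intro exI[of _ "{}"] conjI allI impI)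
    fix Y assume "finite Y \<and> {} \<subseteq> Y \<and> Y \<subseteq> I"
    then have Y: "finite Y" "Y \<subseteq> I" by auto
    let ?s = "\<lambda>y. \<Sum>i\<in>Y. x i * u i y"
    have s: "?s \<in> hardy2" by (rule lincomb_in_hardy2[OF assms(1) Y(2)])
    have u: "u i \<in> hardy2" if "i \<in> Y" for i using assms(1) Y that by (auto simp: orthonormal_def)
    have "taylor ?s = (\<lambda>k. \<Sum>i\<in>Y. taylor (\<lambda>y. x i * u i y) k)"
      by (rule taylor_sum) (simp add: u hardy2_scale)
    then have t: "taylor ?s k = (\<Sum>i\<in>Y. x i * taylor (u i) k)" for k
      by (simp add: taylor_scale u)
    have "(\<Sum>k\<in>K. (cmod (\<Sum>i\<in>Y. x i * taylor (u i) k))\<^sup>2) = (\<Sum>k\<in>K. (cmod (taylor ?s k))\<^sup>2)"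
      by (simp only: t)
    also have "\<dots> \<le> (hnorm ?s)\<^sup>2"
      by (rule finite_sum_le_has_sum[OF hinner_self_has_sum[OF s]]) (use assms(3) in auto)
    also have "\<dots> = (\<Sum>i\<in>Y. (cmod (x i))\<^sup>2)" by (rule hnorm_lincomb[OF assms(1) Y])
    also have "\<dots> \<le> (\<Sum>\<^sub>\<infinity>i\<in>I. (cmod (x i))\<^sup>2)"
      using assms(2) Y by (intro finite_sum_le_infsum) (auto simp: l2_def)
    finally show "(\<Sum>k\<in>K. (cmod (\<Sum>i\<in>Y. x i * taylor (u i) k))\<^sup>2) \<le> (\<Sum>\<^sub>\<infinity>i\<in>I. (cmod (x i))\<^sup>2)" .
  qed simp_all
qed (simp add: finite_subsets_at_top_neq_bot)

lemma
  assumes "orthonormal I u" "l2 x I"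
  shows l2_hsum: "l2 (\<lambda>k. \<Sum>\<^sub>\<infinity>i\<in>I. x i * taylor (u i) k) UNIV"
    and infsum_hsum_le: "(\<Sum>\<^sub>\<infinity>k. (cmod (\<Sum>\<^sub>\<infinity>i\<in>I. x i * taylor (u i) k))\<^sup>2) \<le> (\<Sum>\<^sub>\<infinity>i\<in>I. (cmod (x i))\<^sup>2)"
proof -
  show l: "l2 (\<lambda>k. \<Sum>\<^sub>\<infinity>i\<in>I. x i * taylor (u i) k) UNIV"
    unfolding l2_def
    by (rule nonneg_bdd_above_summable_on)
      (auto intro!: bdd_aboveI2[where M = "\<Sum>\<^sub>\<infinity>i\<in>I. (cmod (x i))\<^sup>2"] hsum_coeff_bound[OF assms])
  show "(\<Sum>\<^sub>\<infinity>k. (cmod (\<Sum>\<^sub>\<infinity>i\<in>I. x i * taylor (u i) k))\<^sup>2) \<le> (\<Sum>\<^sub>\<infinity>i\<in>I. (cmod (x i))\<^sup>2)"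
    by (rule infsum_le_finite_sums) (use l hsum_coeff_bound[OF assms] in \<open>auto simp: l2_def\<close>)
qed

lemma hsum_in_hardy2: "orthonormal I u \<Longrightarrow> l2 x I \<Longrightarrow> hsum I x u \<in> hardy2"
  unfolding hsum_def by (intro hfun_in_hardy2 l2_hsum)

text \<open>The error is the series over the remaining indices \<open>I - J\<close>, to which the
  norm bound for series applies again.\<close>

lemma hsum_approx:
  assumes "orthonormal I u" "l2 x I" "finite J" "J \<subseteq> I"
  shows "(hnorm (\<lambda>y. hsum I x u y - (\<Sum>i\<in>J. x i * u i y)))\<^sup>2
           \<le> (\<Sum>\<^sub>\<infinity>i\<in>I. (cmod (x i))\<^sup>2) - (\<Sum>i\<in>J. (cmod (x i))\<^sup>2)"
proof -
  have o: "orthonormal (I - J) u" by (rule orthonormal_subset[OF assms(1)]) auto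
  have lx: "(\<lambda>i. (cmod (x i))\<^sup>2) summable_on I" using assms(2) by (simp add: l2_def)
  have l: "l2 x (I - J)" unfolding l2_def by (rule summable_on_subset[OF lx]) auto
  have s: "(\<lambda>y. \<Sum>i\<in>J. x i * u i y) \<in> hardy2" by (rule lincomb_in_hardy2[OF assms(1,4)])
  have u: "u i \<in> hardy2" if "i \<in> J" for i using assms that by (auto simp: orthonormal_def)
  have t: "taylor (\<lambda>y. \<Sum>i\<in>J. x i * u i y) = (\<lambda>k. \<Sum>i\<in>J. taylor (\<lambda>y. x i * u i y) k)"
    by (rule taylor_sum) (simp add: u hardy2_scale)
  \<comment> \<open>Stated for any Banach space because it serves for complex Taylor coefficients
    and for real squared moduli.\<close>
  have split: "infsum g I - sum g J = infsum g (I - J)" if "g summable_on I" for g :: "'a \<Rightarrow> 'c :: banach"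
  proof -
    have "infsum g (J \<union> (I - J)) = infsum g J + infsum g (I - J)"
    proof (rule infsum_Un_disjoint)
      show "g summable_on J" using assms(3) by simp
      show "g summable_on (I - J)" by (rule summable_on_subset_banach[OF that]) auto
    qed auto
    moreover have "J \<union> (I - J) = I" using assms(4) by auto
    ultimately show ?thesis using assms(3) by simp
  qed
  let ?d = "\<lambda>y. hsum I x u y - (\<Sum>i\<in>J. x i * u i y)"
  have d: "?d \<in> hardy2" by (rule hardy2_diff[OF hsum_in_hardy2[OF assms(1,2)] s])
  have "taylor ?d = (\<lambda>k. taylor (hsum I x u) k - taylor (\<lambda>y. \<Sum>i\<in>J. x i * u i y) k)"
    by (rule taylor_diff[OF hsum_in_hardy2[OF assms(1,2)] s])
  also have "\<dots> = (\<lambda>k. (\<Sum>\<^sub>\<infinity>i\<in>I. x i * taylor (u i) k) - (\<Sum>i\<in>J. x i * taylor (u i) k))"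
    by (simp add: t hsum_def taylor_hfun[OF l2_hsum[OF assms(1,2)]] taylor_scale u)
  also have "\<dots> = (\<lambda>k. \<Sum>\<^sub>\<infinity>i\<in>I - J. x i * taylor (u i) k)"
    using hsum_coeff_has_sum[OF assms(1,2)] by (intro ext split) (rule has_sum_imp_summable)
  finally have td: "taylor ?d = (\<lambda>k. \<Sum>\<^sub>\<infinity>i\<in>I - J. x i * taylor (u i) k)" .
  have "(hnorm ?d)\<^sup>2 = (\<Sum>\<^sub>\<infinity>k. (cmod (taylor ?d k))\<^sup>2)"
    using infsumI[OF hinner_self_has_sum[OF d]] by simp
  also have "\<dots> \<le> (\<Sum>\<^sub>\<infinity>i\<in>I - J. (cmod (x i))\<^sup>2)"
    unfolding td by (rule infsum_hsum_le[OF o l])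
  also have "\<dots> = (\<Sum>\<^sub>\<infinity>i\<in>I. (cmod (x i))\<^sup>2) - (\<Sum>i\<in>J. (cmod (x i))\<^sup>2)"
    by (rule split[OF lx, symmetric])
  finally show ?thesis .
qed

lemma hsum_approx_tendsto:
  assumes "orthonormal I u" "l2 x I"
  shows "((\<lambda>J. hnorm (\<lambda>y. hsum I x u y - (\<Sum>i\<in>J. x i * u i y))) \<longlongrightarrow> 0) (finite_subsets_at_top I)"
proof (rule tendsto_sandwich)
  let ?B = "\<Sum>\<^sub>\<infinity>i\<in>I. (cmod (x i))\<^sup>2"
  show "\<forall>\<^sub>F J in finite_subsets_at_top I. 0 \<le> hnorm (\<lambda>y. hsum I x u y - (\<Sum>i\<in>J. x i * u i y))"
    by simp
  show "\<forall>\<^sub>F J in finite_subsets_at_top I. hnorm (\<lambda>y. hsum I x u y - (\<Sum>i\<in>J. x i * u i y))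
      \<le> sqrt (?B - (\<Sum>i\<in>J. (cmod (x i))\<^sup>2))"
    unfolding eventually_finite_subsets_at_top
    by (intro exI[of _ "{}"]) (auto intro!: real_le_rsqrt hsum_approx[OF assms])
  have "((\<lambda>J. sqrt (?B - (\<Sum>i\<in>J. (cmod (x i))\<^sup>2))) \<longlongrightarrow> sqrt (?B - ?B)) (finite_subsets_at_top I)"
    using assms(2) unfolding l2_def
    by (intro tendsto_real_sqrt tendsto_diff tendsto_const infsum_tendsto)
  then show "((\<lambda>J. sqrt (?B - (\<Sum>i\<in>J. (cmod (x i))\<^sup>2))) \<longlongrightarrow> 0) (finite_subsets_at_top I)" by simp
qed simp

text \<open>Norm convergence of the partial sums passes through the inner product by Cauchy-Schwarz.
  Later facts about series are obtained from this one rather than from coefficients.\<close>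

lemma hinner_hsum_has_sum:
  assumes "orthonormal I u" "l2 x I" "h \<in> hardy2"
  shows "((\<lambda>i. x i * hinner (u i) h) has_sum hinner (hsum I x u) h) I"
  unfolding has_sum_def
proof (rule Lim_null[THEN iffD2], rule Lim_null_comparison)
  show "\<forall>\<^sub>F J in finite_subsets_at_top I. norm ((\<Sum>i\<in>J. x i * hinner (u i) h) - hinner (hsum I x u) h)
      \<le> hnorm (\<lambda>y. hsum I x u y - (\<Sum>i\<in>J. x i * u i y)) * hnorm h"
    unfolding eventually_finite_subsets_at_top
  proof (intro exI[of _ "{}"] conjI allI impI)
    fix J assume "finite J \<and> {} \<subseteq> J \<and> J \<subseteq> I"
    then have J: "J \<subseteq> I" by auto
    have s: "(\<lambda>y. \<Sum>i\<in>J. x i * u i y) \<in> hardy2" by (rule lincomb_in_hardy2[OF assms(1) J])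
    have g: "hsum I x u \<in> hardy2" by (rule hsum_in_hardy2[OF assms(1,2)])
    have "norm ((\<Sum>i\<in>J. x i * hinner (u i) h) - hinner (hsum I x u) h)
        = cmod (hinner (\<lambda>y. hsum I x u y - (\<Sum>i\<in>J. x i * u i y)) h)"
      by (simp only: hinner_diff_left[OF g s assms(3)] hinner_lincomb_left[OF assms(1) J assms(3)]
          norm_minus_commute)
    also have "\<dots> \<le> hnorm (\<lambda>y. hsum I x u y - (\<Sum>i\<in>J. x i * u i y)) * hnorm h"
      by (rule hinner_cauchy_schwarz[OF hardy2_diff[OF g s] assms(3)])
    finally show "norm ((\<Sum>i\<in>J. x i * hinner (u i) h) - hinner (hsum I x u) h)
      \<le> hnorm (\<lambda>y. hsum I x u y - (\<Sum>i\<in>J. x i * u i y)) * hnorm h" .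
  qed simp_all
  show "((\<lambda>J. hnorm (\<lambda>y. hsum I x u y - (\<Sum>i\<in>J. x i * u i y)) * hnorm h) \<longlongrightarrow> 0)
      (finite_subsets_at_top I)"
    by (rule tendsto_mult_left_zero[OF hsum_approx_tendsto[OF assms(1,2)]])
qed

lemma hinner_hsum_basis:
  assumes "orthonormal I u" "l2 x I" "j \<in> I"
  shows "hinner (hsum I x u) (u j) = x j"
proof -
  have "((\<lambda>i. x i * hinner (u i) (u j)) has_sum x j) I"
    by (rule has_sum_finite_neutralI[of "{j}"]) (use assms in \<open>auto simp: orthonormalD\<close>)
  with hinner_hsum_has_sum[OF assms(1,2) orthonormalD(1)[OF assms(1,3)]] show ?thesis
    by (rule has_sum_unique)
qed

lemma hnorm_hsum:
  assumes "orthonormal I u" "l2 x I"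
  shows "((\<lambda>i. (cmod (x i))\<^sup>2) has_sum (hnorm (hsum I x u))\<^sup>2) I"
proof -
  have g: "hsum I x u \<in> hardy2" by (rule hsum_in_hardy2[OF assms])
  have "hinner (u i) (hsum I x u) = cnj (x i)" if "i \<in> I" for i
    using hinner_hsum_basis[OF assms that] by (metis hinner_sym)
  then have "((\<lambda>i. x i * cnj (x i)) has_sum hinner (hsum I x u) (hsum I x u)) I"
    using hinner_hsum_has_sum[OF assms g] by (simp cong: has_sum_cong)
  then have "((\<lambda>i. complex_of_real ((cmod (x i))\<^sup>2)) has_sum complex_of_real ((hnorm (hsum I x u))\<^sup>2)) I"
    by (simp only: complex_norm_square hinner_self[OF g])
  then show ?thesis by (simp only: has_sum_of_real_iff)
qed

lemma diff_eq_zeroD: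
  fixes f g :: bifun
  shows "(\<lambda>x. f x - g x) = (\<lambda>x. 0) \<Longrightarrow> f = g"
  by (simp add: fun_eq_iff)

text \<open>Identities between series are proved by testing against every \<open>h\<close>, where
  \<open>hinner_hsum_has_sum\<close> turns them into identities between scalar sums.\<close>

lemma hardy2_inner_eqI:
  assumes "f \<in> hardy2" "g \<in> hardy2" "\<And>h. h \<in> hardy2 \<Longrightarrow> hinner f h = hinner g h"
  shows "f = g"
proof -
  have "(\<lambda>x. f x - g x) = (\<lambda>x. 0)"
    by (rule hinner_self_eq_zeroD) (simp_all add: hardy2_diff hinner_diff_left assms)
  then show ?thesis by (rule diff_eq_zeroD)
qed

lemma hsum_diff:
  assumes "orthonormal I u" "l2 x I" "l2 y I"
  shows "(\<lambda>v. hsum I x u v - hsum I y u v) = hsum I (\<lambda>i. x i - y i) u"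
proof (rule hardy2_inner_eqI)
  show g: "(\<lambda>v. hsum I x u v - hsum I y u v) \<in> hardy2" "hsum I (\<lambda>i. x i - y i) u \<in> hardy2"
    by (intro hardy2_diff hsum_in_hardy2 l2_diff assms)+
  fix h assume h: "h \<in> hardy2"
  have "((\<lambda>i. (x i - y i) * hinner (u i) h) has_sum hinner (hsum I x u) h - hinner (hsum I y u) h) I"
    using has_sum_add[OF hinner_hsum_has_sum[OF assms(1,2) h]
        has_sum_uminusI[OF hinner_hsum_has_sum[OF assms(1,3) h]]]
    by (simp add: algebra_simps)
  then show "hinner (\<lambda>v. hsum I x u v - hsum I y u v) h = hinner (hsum I (\<lambda>i. x i - y i) u) h"
    using has_sum_unique[OF hinner_hsum_has_sum[OF assms(1) l2_diff[OF assms(2,3)] h]]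
    by (simp add: hinner_diff_left hsum_in_hardy2 assms h)
qed

section \<open>Closed subspaces and orthogonal projections\<close>

definition closed_subspace :: "bifun set \<Rightarrow> bool" where
  "closed_subspace M \<longleftrightarrow> M \<subseteq> hardy2 \<and> (\<lambda>x. 0) \<in> M \<and> hclosure M \<subseteq> M \<and>
     (\<forall>f\<in>M. \<forall>g\<in>M. (\<lambda>x. f x + g x) \<in> M) \<and> (\<forall>f\<in>M. \<forall>k. (\<lambda>x. k * f x) \<in> M)"

lemma closed_subspaceD:
  assumes "closed_subspace M"
  shows "f \<in> M \<Longrightarrow> f \<in> hardy2" "(\<lambda>x. 0) \<in> M" "hclosure M \<subseteq> M"
    "f \<in> M \<Longrightarrow> g \<in> M \<Longrightarrow> (\<lambda>x. f x + g x) \<in> M" "f \<in> M \<Longrightarrow> (\<lambda>x. k * f x) \<in> M"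
  using assms by (auto simp: closed_subspace_def)

lemma closed_subspace_diff:
  assumes "closed_subspace M" "f \<in> M" "g \<in> M"
  shows "(\<lambda>x. f x - g x) \<in> M"
  using closed_subspaceD(4)[OF assms(1,2) closed_subspaceD(5)[OF assms(1,3), of "-1"]] by simp

lemma closed_subspace_sum:
  assumes "closed_subspace M" "\<And>i. i \<in> J \<Longrightarrow> f i \<in> M"
  shows "(\<lambda>x. \<Sum>i\<in>J. f i x) \<in> M"
  using assms(2)
  by (induction J rule: infinite_finite_induct)
    (simp_all add: closed_subspaceD(2,4)[OF assms(1)])

lemma hsum_in_closed_subspace:
  assumes "closed_subspace M" "orthonormal I u" "l2 x I" "\<And>i. i \<in> I \<Longrightarrow> u i \<in> M"
  shows "hsum I x u \<in> M"
proof -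
  have "hsum I x u \<in> hclosure M"
    unfolding hclosure_def
  proof (intro CollectI conjI allI impI)
    show "hsum I x u \<in> hardy2" by (rule hsum_in_hardy2[OF assms(2,3)])
    fix \<epsilon> :: real assume "\<epsilon> > 0"
    with hsum_approx_tendsto[OF assms(2,3)]
    have "\<forall>\<^sub>F J in finite_subsets_at_top I. hnorm (\<lambda>y. hsum I x u y - (\<Sum>i\<in>J. x i * u i y)) < \<epsilon>"
      by (rule order_tendstoD)
    then obtain J where "J \<subseteq> I" and J: "hnorm (\<lambda>y. hsum I x u y - (\<Sum>i\<in>J. x i * u i y)) < \<epsilon>"
      unfolding eventually_finite_subsets_at_top by blast
    have "(\<lambda>y. \<Sum>i\<in>J. x i * u i y) \<in> M"
      using assms(4) \<open>J \<subseteq> I\<close>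
      by (intro closed_subspace_sum[OF assms(1)] closed_subspaceD(5)[OF assms(1)]) auto
    with J show "\<exists>g\<in>M. hnorm (\<lambda>y. hsum I x u y - g y) < \<epsilon>" by (rule bexI)
  qed
  then show ?thesis using closed_subspaceD(3)[OF assms(1)] by blast
qed

text \<open>For closedness, an approximant \<open>g\<close> of \<open>f\<close> that is orthogonal
  to \<open>h\<close> gives |<f, h>| = |<f - g, h>|, which is at most \<epsilon> times the norm of
  \<open>h\<close>; then \<epsilon> tends to 0 from the right.\<close>

lemma closed_subspace_ominus:
  assumes "closed_subspace M" "N \<subseteq> hardy2"
  shows "closed_subspace (ominus M N)"
  unfolding closed_subspace_def
proof (intro conjI ballI allI)
  note M = closed_subspaceD[OF assms(1)]
  show "ominus M N \<subseteq> hardy2" using M(1) by (auto simp: ominus_def)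
  show "(\<lambda>x. 0) \<in> ominus M N" using M(2) by (simp add: ominus_def)
  show "(\<lambda>x. f x + g x) \<in> ominus M N" if "f \<in> ominus M N" "g \<in> ominus M N" for f g
    using that M(1,4) assms(2) by (auto simp: ominus_def hinner_add_left subset_iff)
  show "(\<lambda>x. k * f x) \<in> ominus M N" if "f \<in> ominus M N" for f k
    using that M(1,5) by (auto simp: ominus_def hinner_scale_left)
  show "hclosure (ominus M N) \<subseteq> ominus M N"
  proof
    fix f assume f: "f \<in> hclosure (ominus M N)"
    then have "f \<in> hardy2" by (simp add: hclosure_def)
    have "f \<in> hclosure M" using f unfolding hclosure_def ominus_def by blast
    then have "f \<in> M" using M(3) by blast
    moreover have "hinner f h = 0" if h: "h \<in> N" for h
    proof -
      have "h \<in> hardy2" using h assms(2) by auto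
      have "cmod (hinner f h) \<le> \<epsilon> * hnorm h" if "\<epsilon> > 0" for \<epsilon>
      proof -
        have "\<exists>g\<in>ominus M N. hnorm (\<lambda>x. f x - g x) < \<epsilon>"
          using f that by (simp add: hclosure_def)
        then obtain g where g: "g \<in> ominus M N" "hnorm (\<lambda>x. f x - g x) < \<epsilon>" by (rule bexE)
        then have "g \<in> hardy2" "hinner g h = 0" using M(1) h by (auto simp: ominus_def)
        then have "hinner f h = hinner (\<lambda>x. f x - g x) h"
          using \<open>f \<in> hardy2\<close> \<open>h \<in> hardy2\<close> by (simp add: hinner_diff_left)
        then have "cmod (hinner f h) \<le> hnorm (\<lambda>x. f x - g x) * hnorm h"
          using hinner_cauchy_schwarz[OF hardy2_diff[OF \<open>f \<in> hardy2\<close> \<open>g \<in> hardy2\<close>] \<open>h \<in> hardy2\<close>] by simp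
        also have "\<dots> \<le> \<epsilon> * hnorm h" using g(2) by (intro mult_right_mono) auto
        finally show ?thesis .
      qed
      then have "\<forall>\<^sub>F \<epsilon> in at_right 0. cmod (hinner f h) \<le> \<epsilon> * hnorm h"
        by (auto simp: eventually_at_right_less eventually_at_topological intro: exI[of _ UNIV])
      moreover have "((\<lambda>\<epsilon>. \<epsilon> * hnorm h) \<longlongrightarrow> 0 * hnorm h) (at_right 0)"
        by (intro tendsto_intros)
      ultimately have "cmod (hinner f h) \<le> 0 * hnorm h"
        by (intro tendsto_lowerbound) auto
      then show ?thesis by simp
    qed
    ultimately show "f \<in> ominus M N" by (simp add: ominus_def)
  qed
qed

lemma orthonormal_basisD:
  assumes "closed_subspace S" "orthonormal_basis I u S"
  shows "orthonormal I u"
  using assms by (auto simp: orthonormal_basis_def orthonormal_def closed_subspace_def)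

text \<open>The difference of \<open>h\<close> and its Fourier series lies in \<open>S\<close>, by
  closedness, and is orthogonal to the whole family, so maximality makes it zero.\<close>

lemma orthonormal_basis_expansion:
  assumes "closed_subspace S" "orthonormal_basis I u S" "h \<in> S"
  shows "h = hsum I (\<lambda>i. hinner h (u i)) u"
proof -
  have o: "orthonormal I u" by (rule orthonormal_basisD[OF assms(1,2)])
  have u: "u i \<in> S" if "i \<in> I" for i using assms(2) that by (auto simp: orthonormal_basis_def)
  have h: "h \<in> hardy2" using assms(1,3) by (rule closed_subspaceD)
  let ?g = "hsum I (\<lambda>i. hinner h (u i)) u"
  note l = l2_bessel[OF o h]
  have "(\<lambda>x. h x - ?g x) \<in> S"
    using hsum_in_closed_subspace[OF assms(1) o l] u by (intro closed_subspace_diff assms) auto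
  moreover have "hinner (\<lambda>x. h x - ?g x) (u i) = 0" if "i \<in> I" for i
    using hinner_hsum_basis[OF o l that] orthonormalD(1)[OF o that]
    by (simp add: hinner_diff_left h hsum_in_hardy2[OF o l])
  ultimately have "(\<lambda>x. h x - ?g x) = (\<lambda>x. 0)"
    using assms(2) unfolding orthonormal_basis_def by blast
  then show ?thesis by (rule diff_eq_zeroD)
qed

text \<open>The Fourier series over a known basis of \<open>S\<close> is a solution of the condition
  defining \<open>proj\<close>. A second solution would differ from it by an element of
  \<open>S\<close> orthogonal to itself.\<close>

lemma
  assumes "closed_subspace S" "orthonormal_basis I u S" "f \<in> hardy2"
  shows proj_orthonormal_basis: "proj S f = hsum I (\<lambda>i. hinner f (u i)) u"
    and proj_in: "proj S f \<in> S"
    and hinner_proj: "h \<in> S \<Longrightarrow> hinner (proj S f) h = hinner f h"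
proof -
  have o: "orthonormal I u" by (rule orthonormal_basisD[OF assms(1,2)])
  have u: "u i \<in> S" if "i \<in> I" for i using assms(2) that by (auto simp: orthonormal_basis_def)
  let ?g = "hsum I (\<lambda>i. hinner f (u i)) u"
  note l = l2_bessel[OF o assms(3)]
  have gS: "?g \<in> S" using hsum_in_closed_subspace[OF assms(1) o l] u by auto
  have g: "?g \<in> hardy2" by (rule hsum_in_hardy2[OF o l])
  have d: "(\<lambda>x. f x - ?g x) \<in> hardy2" by (rule hardy2_diff[OF assms(3) g])
  have perp: "hinner (\<lambda>x. f x - ?g x) h = 0" if h: "h \<in> S" for h
  proof -
    have hH: "h \<in> hardy2" using assms(1) h by (rule closed_subspaceD)
    have "hinner (\<lambda>x. f x - ?g x) (u i) = 0" if "i \<in> I" for i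
      using hinner_hsum_basis[OF o l that] orthonormalD(1)[OF o that]
      by (simp add: hinner_diff_left assms g)
    then have "hinner (u i) (\<lambda>x. f x - ?g x) = 0" if "i \<in> I" for i
      using that by (metis hinner_sym complex_cnj_zero)
    then have "((\<lambda>i. 0) has_sum hinner (hsum I (\<lambda>i. hinner h (u i)) u) (\<lambda>x. f x - ?g x)) I"
      using hinner_hsum_has_sum[OF o l2_bessel[OF o hH] d] by (simp cong: has_sum_cong)
    then have "hinner h (\<lambda>x. f x - ?g x) = 0"
      using orthonormal_basis_expansion[OF assms(1,2) h] has_sum_unique[OF _ has_sum_0_simp] by metis
    then show ?thesis by (metis hinner_sym complex_cnj_zero)
  qed
  show eq: "proj S f = ?g"
    unfolding proj_def
  proof (rule the_equality)
    fix g' assume g': "g' \<in> S \<and> (\<forall>h\<in>S. hinner (\<lambda>x. f x - g' x) h = 0)"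
    then have g'H: "g' \<in> hardy2" using closed_subspaceD(1)[OF assms(1)] by blast
    let ?e = "\<lambda>x. g' x - ?g x"
    have e: "?e \<in> S" using g' gS by (intro closed_subspace_diff assms) auto
    then have eH: "?e \<in> hardy2" by (rule closed_subspaceD[OF assms(1)])
    have "hinner (\<lambda>x. f x - g' x) ?e = 0" by (rule bspec[OF conjunct2[OF g'] e])
    then have "hinner ?e ?e = 0"
      using perp[OF e] hinner_diff_left[OF assms(3) g eH] hinner_diff_left[OF assms(3) g'H eH]
      by (simp add: hinner_diff_left[OF g'H g eH])
    then have "?e = (\<lambda>x. 0)" by (rule hinner_self_eq_zeroD[OF eH])
    then show "g' = ?g" by (rule diff_eq_zeroD)
  qed (use gS perp in auto)
  show "proj S f \<in> S" unfolding eq by (rule gS)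
  show "hinner (proj S f) h = hinner f h" if h: "h \<in> S"
    using perp[OF h] unfolding eq
    by (simp add: hinner_diff_left[OF assms(3) g closed_subspaceD(1)[OF assms(1) h]])
qed

section \<open>Compact operators in diagonal form\<close>

lemma hsum_eqI:
  assumes "orthonormal I u" "l2 x I" "g \<in> hardy2"
    "\<And>h. h \<in> hardy2 \<Longrightarrow> ((\<lambda>i. x i * hinner (u i) h) has_sum hinner g h) I"
  shows "hsum I x u = g"
  using assms
  by (intro hardy2_inner_eqI hsum_in_hardy2) (auto intro: has_sum_unique hinner_hsum_has_sum)

lemma hsum_zero:
  assumes "orthonormal I u"
  shows "hsum I (\<lambda>i. 0) u = (\<lambda>x. 0)"
  by (rule hsum_eqI[OF assms]) (simp_all add: l2_def hardy2_zero)

lemma l2_bounded_mult: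
  assumes "l2 x I" "bounded (range c)"
  shows "l2 (\<lambda>i. c i * x i) I"
proof -
  obtain K where "\<And>i. cmod (c i) \<le> K" using assms(2) by (auto simp: bounded_iff)
  then show ?thesis
    by (intro l2_mono[OF assms(1), where K = K]) (simp add: norm_mult mult_right_mono)
qed

text \<open>A Schmidt decomposition whose coefficients may be complex. The families \<open>e\<close>
  and \<open>f\<close> are only orthonormal in \<open>M\<close>, not complete: in the application
  they are the basis elements with residue 0.\<close>

locale diagonal_operator =
  fixes M :: "bifun set" and T :: "bifun \<Rightarrow> bifun" and c :: "nat \<Rightarrow> complex"
    and e f :: "nat \<Rightarrow> bifun"
  assumes M: "closed_subspace M"
    and e: "orthonormal UNIV e" "\<And>n. e n \<in> M"
    and f: "orthonormal UNIV f" "\<And>n. f n \<in> M"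
    and c: "c \<longlonglongrightarrow> 0"
    and T: "\<And>g. g \<in> M \<Longrightarrow> T g = hsum UNIV (\<lambda>n. c n * hinner g (f n)) e"
begin

lemmas M_hardy2 = closed_subspaceD(1)[OF M]

lemma c_bounded: "bounded (range c)" "bounded (range (\<lambda>n. cnj (c n)))"
  using convergent_imp_bounded[OF c] by (auto simp: bounded_iff)

lemma l2_e: "g \<in> M \<Longrightarrow> l2 (\<lambda>n. hinner g (e n)) UNIV"
  and l2_f: "g \<in> M \<Longrightarrow> l2 (\<lambda>n. hinner g (f n)) UNIV"
  using l2_bessel[OF e(1)] l2_bessel[OF f(1)] M_hardy2 by auto

lemma T_in: "g \<in> M \<Longrightarrow> T g \<in> M"
  using l2_bounded_mult[OF l2_f c_bounded(1)] e
  by (simp add: T hsum_in_closed_subspace[OF M])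

lemma hinner_T_e: "g \<in> M \<Longrightarrow> hinner (T g) (e n) = c n * hinner g (f n)"
  using hinner_hsum_basis[OF e(1) l2_bounded_mult[OF l2_f c_bounded(1)]] by (simp add: T)

text \<open>Conjugating the scalar series of <h, k> termwise gives the scalar series of <T k, g>.
  Uniqueness follows by testing with the difference of two candidates, which itself lies in
  \<open>M\<close>.\<close>

lemma adjoint_T:
  assumes g: "g \<in> M"
  shows "adjoint_on M T g = hsum UNIV (\<lambda>n. cnj (c n) * hinner g (e n)) f"
  unfolding adjoint_on_def
proof (rule the_equality)
  let ?h = "hsum UNIV (\<lambda>n. cnj (c n) * hinner g (e n)) f"
  have l: "l2 (\<lambda>n. cnj (c n) * hinner g (e n)) UNIV"
    by (rule l2_bounded_mult[OF l2_e[OF g] c_bounded(2)])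
  have hM: "?h \<in> M" using f by (intro hsum_in_closed_subspace[OF M _ l]) auto
  have adj: "hinner (T k) g = hinner k ?h" if k: "k \<in> M" for k
  proof -
    have "((\<lambda>n. cnj (c n) * hinner g (e n) * hinner (f n) k) has_sum hinner ?h k) UNIV"
      by (rule hinner_hsum_has_sum[OF f(1) l M_hardy2[OF k]])
    then have "((\<lambda>n. cnj (cnj (c n) * hinner g (e n) * hinner (f n) k)) has_sum cnj (hinner ?h k)) UNIV"
      by (simp only: has_sum_cnj_iff)
    moreover have "(\<lambda>n. cnj (cnj (c n) * hinner g (e n) * hinner (f n) k))
        = (\<lambda>n. c n * hinner k (f n) * hinner (e n) g)"
      unfolding hinner_sym[of "e _" g] hinner_sym[of k "f _"] by (simp add: mult_ac)
    moreover have "cnj (hinner ?h k) = hinner k ?h" by (metis hinner_sym)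
    ultimately have "((\<lambda>n. c n * hinner k (f n) * hinner (e n) g) has_sum hinner k ?h) UNIV"
      by (simp only:)
    moreover have "((\<lambda>n. c n * hinner k (f n) * hinner (e n) g) has_sum hinner (T k) g) UNIV"
      unfolding T[OF k]
      by (rule hinner_hsum_has_sum[OF e(1) l2_bounded_mult[OF l2_f[OF k] c_bounded(1)] M_hardy2[OF g]])
    ultimately show ?thesis using has_sum_unique by blast
  qed
  then show "?h \<in> M \<and> (\<forall>k\<in>M. hinner (T k) g = hinner k ?h)" using hM by blast
  fix h' assume h': "h' \<in> M \<and> (\<forall>k\<in>M. hinner (T k) g = hinner k h')"
  have d: "(\<lambda>x. h' x - ?h x) \<in> M" using h' hM by (intro closed_subspace_diff[OF M]) auto
  then have "hinner (\<lambda>x. h' x - ?h x) h' = hinner (\<lambda>x. h' x - ?h x) ?h"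
    using adj[OF d] bspec[OF conjunct2[OF h'] d] by simp
  then have "hinner (\<lambda>x. h' x - ?h x) (\<lambda>x. h' x - ?h x) = 0"
    using h' by (simp add: hinner_diff_right[OF M_hardy2 M_hardy2[OF hM] M_hardy2[OF d]])
  then have "(\<lambda>x. h' x - ?h x) = (\<lambda>x. 0)" by (rule hinner_self_eq_zeroD[OF M_hardy2[OF d]])
  then show "h' = ?h" by (rule diff_eq_zeroD)
qed

lemma adjoint_T_T:
  assumes g: "g \<in> M"
  shows "adjoint_on M T (T g) = hsum UNIV (\<lambda>n. of_real ((cmod (c n))\<^sup>2) * hinner g (f n)) f"
  unfolding adjoint_T[OF T_in[OF g]] hinner_T_e[OF g]
  by (simp add: complex_norm_square mult_ac del: of_real_power)

lemma l2_c2: "g \<in> M \<Longrightarrow> l2 (\<lambda>n. of_real ((cmod (c n))\<^sup>2) * hinner g (f n)) UNIV"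
  using l2_bounded_mult[OF l2_bounded_mult[OF l2_f c_bounded(1)] c_bounded(2)]
  by (simp add: complex_norm_square mult_ac del: of_real_power)

text \<open>Comparing coefficients at \<open>f n\<close> in the eigenvalue equation kills those with
  |c_n| different from \<tau>; the remaining ones vanish by assumption, which is the maximality to
  be shown.\<close>

lemma eigenspace_basis:
  assumes "\<tau> > 0"
  shows "orthonormal_basis {n. cmod (c n) = \<tau>} f (sv_eigenspace M T \<tau>)"
  unfolding orthonormal_basis_def
proof (intro conjI ballI impI)
  fix n assume n: "n \<in> {n. cmod (c n) = \<tau>}"
  have fn: "f n \<in> hardy2" using f(1) by (simp add: orthonormal_def)
  have "hsum UNIV (\<lambda>k. of_real ((cmod (c k))\<^sup>2) * hinner (f n) (f k)) f
      = (\<lambda>x. of_real (\<tau>\<^sup>2) * f n x)"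
  proof (rule hsum_eqI[OF f(1) l2_c2[OF f(2)] hardy2_scale[OF fn]])
    fix h assume "h \<in> hardy2"
    show "((\<lambda>k. of_real ((cmod (c k))\<^sup>2) * hinner (f n) (f k) * hinner (f k) h) has_sum
        hinner (\<lambda>x. of_real (\<tau>\<^sup>2) * f n x) h) UNIV"
      using n by (intro has_sum_finite_neutralI[of "{n}"])
        (auto simp: orthonormalD(2)[OF f(1)] hinner_scale_left[OF fn])
  qed
  then show "f n \<in> sv_eigenspace M T \<tau>"
    by (simp add: sv_eigenspace_def adjoint_T_T f(2))
next
  fix i j show "hinner (f i) (f j) = (if i = j then 1 else 0)"
    by (rule orthonormalD(2)[OF f(1)]) auto
next
  fix g assume g: "g \<in> sv_eigenspace M T \<tau>" and perp: "\<forall>n\<in>{n. cmod (c n) = \<tau>}. hinner g (f n) = 0"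
  then have gM: "g \<in> M" and
    eig: "hsum UNIV (\<lambda>n. of_real ((cmod (c n))\<^sup>2) * hinner g (f n)) f = (\<lambda>x. of_real (\<tau>\<^sup>2) * g x)"
    by (auto simp: sv_eigenspace_def adjoint_T_T)
  have zero: "hinner g (f n) = 0" for n
  proof (cases "cmod (c n) = \<tau>")
    case False
    have "of_real ((cmod (c n))\<^sup>2) * hinner g (f n) = of_real (\<tau>\<^sup>2) * hinner g (f n)"
      using hinner_hsum_basis[OF f(1) l2_c2[OF gM], of n]
      unfolding eig hinner_scale_left[OF M_hardy2[OF gM]] by auto
    moreover have "(cmod (c n))\<^sup>2 \<noteq> \<tau>\<^sup>2" using False assms by (auto simp: power2_eq_iff_nonneg)
    ultimately show ?thesis by (metis mult_cancel_right of_real_eq_iff)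
  qed (use perp in auto)
  \<comment> \<open>Vanishing coefficients alone do not give \<open>g = 0\<close>, as
    \<open>f\<close> need not span \<open>M\<close>. But the left-hand series is then zero, and
    \<tau> > 0 allows cancelling.\<close>
  have "(\<lambda>x. of_real (\<tau>\<^sup>2) * g x) = (\<lambda>x. 0)"
    using eig by (simp add: zero hsum_zero[OF f(1)])
  then show "g = (\<lambda>x. 0)" using assms by (auto simp: fun_eq_iff)
qed

text \<open>Along a diagonal subsequence all coordinates <g_n, f_m> converge. Finitely many
  coordinates are then handled by this convergence and the tail by smallness of \<open>c\<close>,
  uniformly in n.\<close>

lemma compact_T: "compact_op M T"
  unfolding compact_op_def
proof (intro allI impI)
  fix g :: "nat \<Rightarrow> bifun" assume g: "\<forall>n. g n \<in> M \<and> hnorm (g n) \<le> 1"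
  then have gM: "g n \<in> M" and g1: "hnorm (g n) \<le> 1" for n by auto
  define a where "a n m = hinner (g n) (f m)" for n m
  have la: "l2 (a n) UNIV" for n unfolding a_def by (rule l2_f[OF gM])
  have suma: "(\<Sum>m\<in>J. (cmod (a n m))\<^sup>2) \<le> 1" if "finite J" for n J
  proof -
    have "(\<Sum>m\<in>J. (cmod (a n m))\<^sup>2) \<le> (hnorm (g n))\<^sup>2"
      unfolding a_def by (rule bessel_finite[OF f(1) M_hardy2[OF gM] that]) simp
    also have "\<dots> \<le> 1" using g1 by (simp add: power_le_one)
    finally show ?thesis .
  qed
  have "norm (a n m) \<le> 1" for n m
    using suma[of "{m}" n] by (simp add: abs_square_le_1)
  \<comment> \<open>Diagonal extraction: one subsequence serves all coordinates m, since each
    coordinate is bounded by 1.\<close>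
  then obtain r where r: "strict_mono r" "\<And>m. \<exists>l. (\<lambda>n. a (r n) m) \<longlonglongrightarrow> l"
    using function_convergent_subsequence[of "UNIV :: nat set" a 1] by (metis UNIV_I countableI_type)
  then obtain x where x: "\<And>m. (\<lambda>n. a (r n) m) \<longlonglongrightarrow> x m" by metis
  have sumx: "(\<Sum>m\<in>J. (cmod (x m))\<^sup>2) \<le> 1" if "finite J" for J
  proof (rule LIMSEQ_le_const2)
    show "(\<lambda>n. \<Sum>m\<in>J. (cmod (a (r n) m))\<^sup>2) \<longlonglongrightarrow> (\<Sum>m\<in>J. (cmod (x m))\<^sup>2)"
      by (intro tendsto_intros x)
  qed (use suma[OF that] in blast)
  have lx: "l2 x UNIV"
    unfolding l2_def
    by (rule nonneg_bdd_above_summable_on) (auto intro!: bdd_aboveI2[where M = 1] sumx)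
  \<comment> \<open>\<open>x\<close> is the coordinate sequence of a weak limit; only its image
    under the diagonal operator is needed.\<close>
  define G where "G = hsum UNIV (\<lambda>m. c m * x m) e"
  have GM: "G \<in> M"
    unfolding G_def using e
    by (intro hsum_in_closed_subspace[OF M _ l2_bounded_mult[OF lx c_bounded(1)]]) auto
  define y where "y n m = a (r n) m - x m" for n m
  have ly: "l2 (y n) UNIV" for n unfolding y_def by (rule l2_diff[OF la lx])
  \<comment> \<open>The constant is 2 * 1 + 2 * 1, from |u - v|^2 at most 2 |u|^2 + 2 |v|^2 and the
    two bounds by 1.\<close>
  have sumy: "(\<Sum>m\<in>J. (cmod (y n m))\<^sup>2) \<le> 4" if "finite J" for n J
  proof -
    have "(cmod (y n m))\<^sup>2 \<le> 2 * (cmod (a (r n) m))\<^sup>2 + 2 * (cmod (x m))\<^sup>2" for m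
    proof -
      have "(cmod (y n m))\<^sup>2 \<le> (cmod (a (r n) m) + cmod (x m))\<^sup>2"
        unfolding y_def by (intro power_mono norm_triangle_ineq4) auto
      also have "\<dots> \<le> 2 * (cmod (a (r n) m))\<^sup>2 + 2 * (cmod (x m))\<^sup>2"
        using sum_squares_bound[of "cmod (a (r n) m)" "cmod (x m)"] by (simp add: power2_sum)
      finally show ?thesis .
    qed
    then have "(\<Sum>m\<in>J. (cmod (y n m))\<^sup>2) \<le> (\<Sum>m\<in>J. 2 * (cmod (a (r n) m))\<^sup>2 + 2 * (cmod (x m))\<^sup>2)"
      by (intro sum_mono)
    also have "\<dots> = 2 * (\<Sum>m\<in>J. (cmod (a (r n) m))\<^sup>2) + 2 * (\<Sum>m\<in>J. (cmod (x m))\<^sup>2)"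
      by (simp add: sum.distrib sum_distrib_left)
    also have "\<dots> \<le> 4" using suma[OF that, of "r n"] sumx[OF that] by linarith
    finally show ?thesis .
  qed
  have TG: "(\<lambda>v. T (g (r n)) v - G v) = hsum UNIV (\<lambda>m. c m * y n m) e" for n
  proof -
    have "(\<lambda>v. T (g (r n)) v - G v) = hsum UNIV (\<lambda>m. c m * a (r n) m - c m * x m) e"
      unfolding G_def T[OF gM] a_def
      by (rule hsum_diff[OF e(1) l2_bounded_mult[OF l2_f[OF gM] c_bounded(1)]
            l2_bounded_mult[OF lx c_bounded(1)]])
    then show ?thesis by (simp add: y_def algebra_simps)
  qed
  have bound: "(hnorm (\<lambda>v. T (g (r n)) v - G v))\<^sup>2 \<le> (\<Sum>m<N. (cmod (c m))\<^sup>2 * (cmod (y n m))\<^sup>2) + \<delta> * 4"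
    if N: "\<And>m. m \<ge> N \<Longrightarrow> (cmod (c m))\<^sup>2 \<le> \<delta>" and "\<delta> > 0" for n N \<delta>
    unfolding TG
  proof (rule has_sum_le_finite_sums[OF hnorm_hsum[OF e(1) l2_bounded_mult[OF ly c_bounded(1)]]])
    fix J :: "nat set" assume J: "finite J"
    have "(\<Sum>m\<in>J. (cmod (c m * y n m))\<^sup>2)
        \<le> (\<Sum>m\<in>J. (if m < N then (cmod (c m))\<^sup>2 * (cmod (y n m))\<^sup>2 else 0) + \<delta> * (cmod (y n m))\<^sup>2)"
      using N \<open>\<delta> > 0\<close> by (intro sum_mono) (auto simp: norm_mult power_mult_distrib intro!: mult_right_mono)
    also have "\<dots> = (\<Sum>m\<in>J. if m < N then (cmod (c m))\<^sup>2 * (cmod (y n m))\<^sup>2 else 0)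
        + \<delta> * (\<Sum>m\<in>J. (cmod (y n m))\<^sup>2)"
      by (simp add: sum.distrib sum_distrib_left)
    also have "(\<Sum>m\<in>J. if m < N then (cmod (c m))\<^sup>2 * (cmod (y n m))\<^sup>2 else 0)
        = (\<Sum>m\<in>J \<inter> {..<N}. (cmod (c m))\<^sup>2 * (cmod (y n m))\<^sup>2)"
      using J by (simp add: sum.inter_restrict)
    also have "\<dots> \<le> (\<Sum>m<N. (cmod (c m))\<^sup>2 * (cmod (y n m))\<^sup>2)"
      by (intro sum_mono2) auto
    also have "\<delta> * (\<Sum>m\<in>J. (cmod (y n m))\<^sup>2) \<le> \<delta> * 4"
      using sumy[OF J] \<open>\<delta> > 0\<close> by simp
    finally show "(\<Sum>m\<in>J. (cmod (c m * y n m))\<^sup>2)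
        \<le> (\<Sum>m<N. (cmod (c m))\<^sup>2 * (cmod (y n m))\<^sup>2) + \<delta> * 4" by simp
  qed
  have "(\<lambda>n. hnorm (\<lambda>v. T (g (r n)) v - G v)) \<longlonglongrightarrow> 0"
  proof (rule LIMSEQ_I)
    fix \<epsilon> :: real assume "\<epsilon> > 0"
    \<comment> \<open>The tail contributes at most 4 \<delta>, which is half of the square of
      \<epsilon>; the finite part supplies less than the other half.\<close>
    define \<delta> where "\<delta> = \<epsilon>\<^sup>2 / 8"
    have "\<delta> > 0" using \<open>\<epsilon> > 0\<close> by (simp add: \<delta>_def)
    have "(\<lambda>m. (cmod (c m))\<^sup>2) \<longlonglongrightarrow> (cmod 0)\<^sup>2" by (intro tendsto_intros c)
    then have "\<forall>\<^sub>F m in sequentially. (cmod (c m))\<^sup>2 < \<delta>"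
      using \<open>\<delta> > 0\<close> by (intro order_tendstoD(2)) auto
    then obtain N where N: "\<And>m. m \<ge> N \<Longrightarrow> (cmod (c m))\<^sup>2 \<le> \<delta>"
      unfolding eventually_sequentially by (meson less_imp_le)
    have "(\<lambda>n. \<Sum>m<N. (cmod (c m))\<^sup>2 * (cmod (y n m))\<^sup>2) \<longlonglongrightarrow> (\<Sum>m<N. (cmod (c m))\<^sup>2 * (cmod (x m - x m))\<^sup>2)"
      unfolding y_def by (intro tendsto_intros x)
    then have "\<forall>\<^sub>F n in sequentially. (\<Sum>m<N. (cmod (c m))\<^sup>2 * (cmod (y n m))\<^sup>2) < \<epsilon>\<^sup>2 / 2"
      using \<open>\<epsilon> > 0\<close> by (intro order_tendstoD(2)) auto
    then obtain n0 where n0: "\<And>n. n \<ge> n0 \<Longrightarrow> (\<Sum>m<N. (cmod (c m))\<^sup>2 * (cmod (y n m))\<^sup>2) < \<epsilon>\<^sup>2 / 2"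
      unfolding eventually_sequentially by blast
    have "norm (hnorm (\<lambda>v. T (g (r n)) v - G v) - 0) < \<epsilon>" if "n \<ge> n0" for n
    proof -
      have "(hnorm (\<lambda>v. T (g (r n)) v - G v))\<^sup>2 < \<epsilon>\<^sup>2"
        using bound[of N \<delta> n, OF N \<open>\<delta> > 0\<close>] n0[OF that] by (simp add: \<delta>_def)
      then show ?thesis using \<open>\<epsilon> > 0\<close> by (auto intro: power2_less_imp_less)
    qed
    then show "\<exists>n0. \<forall>n\<ge>n0. norm (hnorm (\<lambda>v. T (g (r n)) v - G v) - 0) < \<epsilon>" by blast
  qed
  with r(1) show "\<exists>G\<in>M. \<exists>r. strict_mono r \<and> (\<lambda>n. hnorm (\<lambda>v. T (g (r n)) v - G v)) \<longlonglongrightarrow> 0"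
    by (intro bexI[OF _ GM] exI[of _ r] conjI)
qed

lemma nonzero_singular_values: "nonzero_singular_values M T (\<lambda>n. cmod (c n))"
  unfolding nonzero_singular_values_def
proof (intro conjI allI impI exI)
  show "orthonormal_basis {n. cmod (c n) = \<tau>} f (sv_eigenspace M T \<tau>)" if "\<tau> > 0" for \<tau>
    using that by (rule eigenspace_basis)
qed (simp_all add: compact_T)

end

section \<open>Orthonormal polynomials on the unit circle\<close>

lemma coeff_star_poly: "coeff (star_poly m \<phi>) k = (if k \<le> m then cnj (coeff \<phi> (m - k)) else 0)"
proof -
  have "coeff (star_poly m \<phi>) k = (\<Sum>i\<le>m. if i = k then cnj (coeff \<phi> (m - i)) else 0)"
    unfolding star_poly_def coeff_sum by (intro sum.cong) auto
  then show ?thesis by simp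
qed

lemma degree_star_poly: "degree (star_poly m \<phi>) \<le> m"
  by (rule degree_le) (simp add: coeff_star_poly)

lemma star_poly_monom: "j \<le> m \<Longrightarrow> star_poly m (monom 1 j) = monom 1 (m - j)"
  by (rule poly_eqI) (auto simp: coeff_star_poly)

text \<open>The properties of an inner product L^2(mu) on the unit circle from which the theory is
  developed: multiplication by zeta is isometric (\<open>shift\<close>), reversal is conjugation up
  to a unimodular factor (\<open>star\<close>), and \<open>lower\<close> gives both definiteness and
  a bound on leading coefficients that is uniform in the degree.\<close>

locale opuc =
  fixes L :: "complex poly \<Rightarrow> complex poly \<Rightarrow> complex" and \<delta> :: real
  assumes add_left: "L (A + B) C = L A C + L B C"
    and smult_left: "L (smult k A) C = k * L A C"
    and sym: "L A B = cnj (L B A)"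
    and shift: "L (pCons 0 A) (pCons 0 B) = L A B"
    and star: "degree A \<le> m \<Longrightarrow> degree B \<le> m \<Longrightarrow> L (star_poly m A) (star_poly m B) = L B A"
    and one: "L 1 1 = 1"
    and delta: "\<delta> > 0"
    and lower: "degree A \<le> m \<Longrightarrow> Re (L A A) \<ge> \<delta> * (cmod (coeff A m))\<^sup>2"
begin

lemma pos: "A \<noteq> 0 \<Longrightarrow> Re (L A A) > 0"
  using lower[of A "degree A"] delta by (smt (verit) mult_pos_pos leading_coeff_0_iff
      zero_less_norm_iff zero_less_power order_refl)

lemma add_right: "L C (A + B) = L C A + L C B"
  by (metis sym add_left complex_cnj_add)

lemma smult_right: "L C (smult k A) = cnj k * L C A"
  by (metis sym smult_left complex_cnj_mult)

lemma diff_left: "L (A - B) C = L A C - L B C"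
  using add_left[of A "smult (-1) B" C] smult_left[of "-1" B C] by simp

lemma diff_right: "L C (A - B) = L C A - L C B"
  using add_right[of C A "smult (-1) B"] smult_right[of C "-1" B] by simp

lemma zero_right: "L C 0 = 0"
  using smult_right[of C 0 0] by simp

lemma sum_right: "L C (\<Sum>i\<in>I. F i) = (\<Sum>i\<in>I. L C (F i))"
  by (induction I rule: infinite_finite_induct) (simp_all add: zero_right add_right)

lemma expand_right:
  assumes "degree A \<le> n"
  shows "L C A = (\<Sum>i\<le>n. cnj (coeff A i) * L C (monom 1 i))"
proof -
  have "L C A = L C (\<Sum>i\<le>n. smult (coeff A i) (monom 1 i))"
    using poly_as_sum_of_monoms'[OF assms] by (simp add: smult_monom)
  then show ?thesis by (simp only: sum_right smult_right)
qed

text \<open>Orthogonality is imposed against monomials instead of the other orthonormal polynomials,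
  so that this is a property of one polynomial. Existence then follows by recursion on m and
  uniqueness for each m alone.\<close>

definition is_onp :: "nat \<Rightarrow> complex poly \<Rightarrow> bool" where
  "is_onp m \<phi> \<longleftrightarrow> degree \<phi> \<le> m \<and> (\<exists>\<kappa>>0. coeff \<phi> m = of_real \<kappa>) \<and>
     (\<forall>k<m. L \<phi> (monom 1 k) = 0) \<and> L \<phi> \<phi> = 1"

lemma is_onp_perp:
  assumes "is_onp m \<phi>" "degree A < m"
  shows "L \<phi> A = 0"
  using assms expand_right[of A "degree A" \<phi>] by (auto simp: is_onp_def intro!: sum.neutral)

text \<open>Reversal exchanges the monomials of degrees k and m - k, so orthogonality to degrees
  below m becomes orthogonality to degrees 1 to m. Against such a polynomial only the constant term
  of \<open>A\<close> counts.\<close>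

lemma
  assumes "is_onp m \<phi>"
  shows is_onp_star_monom: "0 < k \<Longrightarrow> k \<le> m \<Longrightarrow> L (star_poly m \<phi>) (monom 1 k) = 0"
    and is_onp_star_self: "L (star_poly m \<phi>) (star_poly m \<phi>) = 1"
    and is_onp_star_inner: "degree A \<le> m \<Longrightarrow> L A (star_poly m \<phi>) = coeff A 0 / coeff \<phi> m"
proof -
  have d: "degree \<phi> \<le> m" using assms by (simp add: is_onp_def)
  show perp: "L (star_poly m \<phi>) (monom 1 k) = 0" if k: "0 < k" "k \<le> m" for k
  proof -
    have "L (star_poly m \<phi>) (star_poly m (monom 1 (m - k))) = L (monom 1 (m - k)) \<phi>"
      by (rule star[OF d]) (simp add: degree_monom_le order_trans[OF degree_monom_le])
    also have "\<dots> = cnj (L \<phi> (monom 1 (m - k)))" by (rule sym)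
    also have "L \<phi> (monom 1 (m - k)) = 0" using assms k by (simp add: is_onp_def)
    finally show ?thesis using k by (simp add: star_poly_monom)
  qed
  show self: "L (star_poly m \<phi>) (star_poly m \<phi>) = 1"
    using star[OF d d] assms by (simp add: is_onp_def)
  have e: "L (star_poly m \<phi>) A = cnj (coeff A 0) * L (star_poly m \<phi>) 1" if "degree A \<le> m" for A
  proof -
    have "L (star_poly m \<phi>) A = (\<Sum>i\<le>m. cnj (coeff A i) * L (star_poly m \<phi>) (monom 1 i))"
      by (rule expand_right[OF that])
    also have "\<dots> = (\<Sum>i\<in>{0}. cnj (coeff A i) * L (star_poly m \<phi>) (monom 1 i))"
      by (rule sum.mono_neutral_right) (auto simp: perp)
    finally show ?thesis by simp
  qed
  \<comment> \<open>The remaining inner product with 1 is fixed by taking \<open>A\<close> to be the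
    reversed polynomial itself, which has norm 1 and constant term the conjugate of
    \<open>coeff \<phi> m\<close>.\<close>
  have "1 = coeff \<phi> m * L (star_poly m \<phi>) 1"
    using e[OF degree_star_poly] self by (simp add: coeff_star_poly)
  then have i: "L (star_poly m \<phi>) 1 = 1 / coeff \<phi> m"
    by (metis mult_zero_left nonzero_mult_div_cancel_left zero_neq_one)
  show "L A (star_poly m \<phi>) = coeff A 0 / coeff \<phi> m" if "degree A \<le> m"
  proof -
    have "cnj (coeff \<phi> m) = coeff \<phi> m" using assms by (auto simp: is_onp_def)
    then show ?thesis using e[OF that] i sym[of A "star_poly m \<phi>"] by simp
  qed
qed

text \<open>Cross-multiplying by the leading coefficients removes degree m, so the difference
  \<open>D\<close> is orthogonal to every monomial that occurs in it. Equality of norms then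
  identifies the two positive leading coefficients.\<close>

lemma is_onp_unique:
  assumes "is_onp m \<phi>" "is_onp m \<psi>"
  shows "\<phi> = \<psi>"
proof -
  obtain \<kappa> \<kappa>' where k: "\<kappa> > 0" "coeff \<phi> m = of_real \<kappa>" "\<kappa>' > 0" "coeff \<psi> m = of_real \<kappa>'"
    using assms by (auto simp: is_onp_def)
  define D where "D = smult (of_real \<kappa>') \<phi> - smult (of_real \<kappa>) \<psi>"
  have "degree D \<le> m"
    unfolding D_def using assms
    by (intro degree_diff_le order_trans[OF degree_smult_le]) (auto simp: is_onp_def)
  moreover have "coeff D m = 0" using k by (simp add: D_def)
  moreover have "L D (monom 1 i) = 0" if "i < m" for i
    using assms that by (simp add: D_def diff_left smult_left is_onp_def)
  ultimately have "L D D = 0"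
    using expand_right[of D m D] by (auto simp: le_less intro!: sum.neutral)
  then have "D = 0" using pos[of D] by auto
  then have eq: "smult (of_real \<kappa>') \<phi> = smult (of_real \<kappa>) \<psi>" by (simp add: D_def)
  have "L (smult (of_real \<kappa>') \<phi>) (smult (of_real \<kappa>') \<phi>) = of_real (\<kappa>'\<^sup>2)"
    "L (smult (of_real \<kappa>) \<psi>) (smult (of_real \<kappa>) \<psi>) = of_real (\<kappa>\<^sup>2)"
    using assms by (simp_all add: smult_left smult_right is_onp_def power2_eq_square)
  then have "\<kappa>'\<^sup>2 = \<kappa>\<^sup>2" unfolding eq by (metis of_real_eq_iff)
  then have "\<kappa>' = \<kappa>" using k by simp
  then show ?thesis using eq k by (metis of_real_eq_0_iff less_irrefl smult_cancel)
qed

text \<open>Both zeta phi and phi* are orthogonal to zeta, ..., zeta^m, so a combination of them has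
  only the constant 1 left to be made orthogonal to. The required factor is the coefficient \<beta>
  of the projection of zeta phi onto the unit vector phi*.\<close>

lemma szego_step:
  assumes "is_onp m \<phi>"
  defines "\<beta> \<equiv> L (pCons 0 \<phi>) (star_poly m \<phi>)"
  shows "cmod \<beta> < 1"
    and "is_onp (Suc m) (smult (1 / of_real (sqrt (1 - (cmod \<beta>)\<^sup>2)))
           (pCons 0 \<phi> - smult \<beta> (star_poly m \<phi>)))" (is "is_onp _ (smult ?r _)")
proof -
  obtain \<kappa> where k: "\<kappa> > 0" "coeff \<phi> m = of_real \<kappa>" using assms(1) by (auto simp: is_onp_def)
  have d: "degree \<phi> \<le> m" using assms(1) by (simp add: is_onp_def)
  define \<psi> where "\<psi> = pCons 0 \<phi> - smult \<beta> (star_poly m \<phi>)"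
  have zp: "L (pCons 0 \<phi>) (monom 1 i) = 0" if "0 < i" "i \<le> m" for i
  proof -
    obtain j where "i = Suc j" using \<open>0 < i\<close> by (cases i) auto
    then show ?thesis using assms(1) that by (simp add: monom_Suc shift is_onp_def)
  qed
  \<comment> \<open>In the expansion of phi* only its constant term, the leading coefficient
    \<kappa> of phi, survives; this expresses \<beta> through the inner product of zeta phi with
    1.\<close>
  have "\<beta> = (\<Sum>i\<le>m. cnj (coeff (star_poly m \<phi>) i) * L (pCons 0 \<phi>) (monom 1 i))"
    unfolding \<beta>_def by (rule expand_right[OF degree_star_poly])
  also have "\<dots> = (\<Sum>i\<in>{0}. cnj (coeff (star_poly m \<phi>) i) * L (pCons 0 \<phi>) (monom 1 i))"
    by (rule sum.mono_neutral_right) (auto simp: zp)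
  finally have b: "\<beta> = of_real \<kappa> * L (pCons 0 \<phi>) 1" by (simp add: coeff_star_poly k)
  have s1: "L (star_poly m \<phi>) 1 = 1 / of_real \<kappa>"
    using is_onp_star_inner[OF assms(1), of 1] sym[of "star_poly m \<phi>" 1] by (simp add: k)
  have perp: "L \<psi> (monom 1 i) = 0" if "i \<le> m" for i
  proof (cases "i = 0")
    case True
    then show ?thesis using b s1 k by (simp add: \<psi>_def diff_left smult_left)
  next
    case False
    then show ?thesis
      using zp[of i] is_onp_star_monom[OF assms(1), of i] that
      by (simp add: \<psi>_def diff_left smult_left)
  qed
  have "L (star_poly m \<phi>) (pCons 0 \<phi>) = cnj \<beta>" unfolding \<beta>_def by (rule sym)
  then have "L \<psi> \<psi> = 1 - \<beta> * cnj \<beta>"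
    using assms(1) is_onp_star_self[OF assms(1)]
    by (simp add: \<psi>_def diff_left diff_right smult_left smult_right shift is_onp_def
        \<beta>_def[symmetric] algebra_simps)
  then have norm: "L \<psi> \<psi> = of_real (1 - (cmod \<beta>)\<^sup>2)"
    by (simp add: complex_norm_square[symmetric])
  have lead: "coeff \<psi> (Suc m) = of_real \<kappa>"
    by (simp add: \<psi>_def k coeff_star_poly)
  then have "\<psi> \<noteq> 0" using k by auto
  \<comment> \<open>Strictness comes from definiteness: the coefficient of degree m + 1 in \<psi> is
    \<kappa>, so \<psi> is not zero.\<close>
  then have "1 - (cmod \<beta>)\<^sup>2 > 0" using pos[of \<psi>] norm by simp
  then show "cmod \<beta> < 1" by (simp add: abs_square_less_1)
  have "degree \<psi> \<le> Suc m"
    unfolding \<psi>_def using d degree_star_poly[of m \<phi>]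
    by (intro degree_diff_le order_trans[OF degree_smult_le]) (auto simp: degree_pCons_eq_if)
  moreover have "\<exists>\<kappa>>0. coeff (smult ?r \<psi>) (Suc m) = of_real \<kappa>"
    using k \<open>1 - (cmod \<beta>)\<^sup>2 > 0\<close>
    by (intro exI[of _ "\<kappa> / sqrt (1 - (cmod \<beta>)\<^sup>2)"]) (simp add: lead)
  moreover have "L (smult ?r \<psi>) (smult ?r \<psi>) = 1"
  proof -
    have "L (smult ?r \<psi>) (smult ?r \<psi>)
        = of_real ((1 - (cmod \<beta>)\<^sup>2) / (sqrt (1 - (cmod \<beta>)\<^sup>2) * sqrt (1 - (cmod \<beta>)\<^sup>2)))"
      unfolding smult_left smult_right norm
      by (simp del: real_sqrt_mult_self real_sqrt_abs2)
    then show ?thesis using \<open>1 - (cmod \<beta>)\<^sup>2 > 0\<close> by simp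
  qed
  ultimately show "is_onp (Suc m) (smult ?r (pCons 0 \<phi> - smult \<beta> (star_poly m \<phi>)))"
    unfolding \<psi>_def[symmetric] is_onp_def
    by (auto simp: smult_left perp less_Suc_eq_le intro: order_trans[OF degree_smult_le])
qed

definition onp :: "nat \<Rightarrow> complex poly" where
  "onp m = (THE \<phi>. is_onp m \<phi>)"

lemma is_onp_onp: "is_onp m (onp m)"
proof -
  have "\<exists>\<phi>. is_onp m \<phi>"
  proof (induction m)
    case 0
    have "is_onp 0 1" by (auto simp: is_onp_def one intro: exI[of _ 1])
    then show ?case by blast
  qed (use szego_step in blast)
  then show ?thesis unfolding onp_def using is_onp_unique by (metis theI)
qed

lemma is_onp_eq: "is_onp m \<phi> \<Longrightarrow> \<phi> = onp m"
  using is_onp_unique is_onp_onp by blast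

lemma onp_orthonormal: "L (onp m) (onp n) = (if m = n then 1 else 0)"
proof (cases m n rule: linorder_cases)
  case less
  have "degree (onp m) < n" using is_onp_onp[of m] less by (simp add: is_onp_def)
  then have "L (onp n) (onp m) = 0" by (rule is_onp_perp[OF is_onp_onp])
  then show ?thesis using less sym[of "onp m" "onp n"] by simp
next
  case greater
  have "degree (onp n) < m" using is_onp_onp[of n] greater by (simp add: is_onp_def)
  then have "L (onp m) (onp n) = 0" by (rule is_onp_perp[OF is_onp_onp])
  then show ?thesis using greater by simp
qed (use is_onp_onp[of n] in \<open>simp add: is_onp_def\<close>)

lemma onp_lead:
  obtains \<kappa> where "\<kappa> > 0" "coeff (onp m) m = of_real \<kappa>" "degree (onp m) = m"
proof -
  obtain \<kappa> where k: "\<kappa> > 0" "coeff (onp m) m = of_real \<kappa>" "degree (onp m) \<le> m"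
    using is_onp_onp[of m] by (auto simp: is_onp_def)
  moreover have "m \<le> degree (onp m)" using k by (intro le_degree) simp
  ultimately show ?thesis using that by (meson antisym)
qed

text \<open>Orthogonality to the lower \<open>\<phi> k\<close> becomes orthogonality to monomials by
  strong induction: \<open>\<phi> k\<close> has a nonzero coefficient in degree k, and its lower
  terms are already known to contribute nothing.\<close>

lemma orthonormal_polys_eq_onp:
  assumes "\<And>m. degree (\<phi> m) = m \<and> (\<exists>\<kappa>>0. lead_coeff (\<phi> m) = complex_of_real \<kappa>)"
    and "\<And>m n. L (\<phi> m) (\<phi> n) = (if m = n then 1 else 0)"
  shows "\<phi> = onp"
proof
  fix m
  have "L (\<phi> m) (monom 1 k) = 0" if "k < m" for k
    using that
  proof (induction k rule: less_induct)
    case (less k)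
    obtain \<kappa> where k: "\<kappa> > 0" "coeff (\<phi> k) k = of_real \<kappa>" using assms(1)[of k] by auto
    have "L (\<phi> m) (\<phi> k) = (\<Sum>i\<le>k. cnj (coeff (\<phi> k) i) * L (\<phi> m) (monom 1 i))"
      using assms(1)[of k] by (intro expand_right) simp
    also have "\<dots> = (\<Sum>i\<in>{k}. cnj (coeff (\<phi> k) i) * L (\<phi> m) (monom 1 i))"
      by (rule sum.mono_neutral_right) (use less in auto)
    finally show ?case using assms(2)[of m k] less(2) k by simp
  qed
  then have "is_onp m (\<phi> m)" using assms(1)[of m] assms(2)[of m m] by (auto simp: is_onp_def)
  then show "\<phi> m = onp m" by (rule is_onp_eq)
qed

text \<open>The conjugate of the number \<beta> in \<open>szego_step\<close>, because the recurrence
  subtracts the conjugate of the Verblunsky coefficient.\<close>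

definition verb :: "nat \<Rightarrow> complex" where
  "verb m = cnj (L (pCons 0 (onp m)) (star_poly m (onp m)))"

lemma cmod_verb: "cmod (verb m) < 1"
  using szego_step(1)[OF is_onp_onp] by (simp add: verb_def)

lemma szego_recurrence:
  "smult (of_real (sqrt (1 - (cmod (verb m))\<^sup>2))) (onp (Suc m))
     = [:0, 1:] * onp m - smult (cnj (verb m)) (star_poly m (onp m))"
proof -
  have "onp (Suc m) = smult (1 / of_real (sqrt (1 - (cmod (verb m))\<^sup>2)))
           (pCons 0 (onp m) - smult (cnj (verb m)) (star_poly m (onp m)))"
    using is_onp_eq[OF szego_step(2)[OF is_onp_onp[of m]]] by (simp add: verb_def)
  moreover have "1 - (cmod (verb m))\<^sup>2 > 0"
    using cmod_verb[of m] by (simp add: abs_square_less_1)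
  ultimately show ?thesis by simp
qed

text \<open>Pairing the recurrence with phi_m* isolates the coefficient: the left-hand side vanishes
  because phi_m* has degree at most m, and phi_m* has norm 1.\<close>

lemma verb_unique:
  assumes "smult c (onp (Suc m)) = [:0, 1:] * onp m - smult (cnj \<alpha>) (star_poly m (onp m))"
  shows "\<alpha> = verb m"
proof -
  have "degree (star_poly m (onp m)) < Suc m" using degree_star_poly[of m "onp m"] by simp
  then have "L (onp (Suc m)) (star_poly m (onp m)) = 0"
    by (rule is_onp_perp[OF is_onp_onp])
  then have "0 = L (smult c (onp (Suc m))) (star_poly m (onp m))" by (simp add: smult_left)
  also have "\<dots> = cnj (verb m) - cnj \<alpha>"
    unfolding assms using is_onp_star_self[OF is_onp_onp[of m]]
    by (simp add: diff_left smult_left verb_def)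
  finally show ?thesis by (metis complex_cnj_cancel_iff eq_iff_diff_eq_0)
qed

text \<open>The recurrence is read off in degrees 0 and m + 1. Dividing the two equations cancels
  the square root and the old leading coefficient.\<close>

lemma onp_star_diagonal:
  shows "L (onp 0) (star_poly 0 (onp 0)) = 1"
    and "L (onp (Suc m)) (star_poly (Suc m) (onp (Suc m))) = - cnj (verb m)"
proof -
  have eq: "L (onp m) (star_poly m (onp m)) = coeff (onp m) 0 / coeff (onp m) m" for m
    using is_onp_star_inner[OF is_onp_onp, of "onp m"] is_onp_onp[of m] by (simp add: is_onp_def)
  show "L (onp 0) (star_poly 0 (onp 0)) = 1"
    using eq[of 0] onp_lead[of 0] by (metis divide_self less_irrefl of_real_eq_0_iff)
  let ?r = "complex_of_real (sqrt (1 - (cmod (verb m))\<^sup>2))"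
  obtain \<kappa> \<kappa>' where k: "\<kappa> > 0" "coeff (onp m) m = of_real \<kappa>"
    "\<kappa>' > 0" "coeff (onp (Suc m)) (Suc m) = of_real \<kappa>'"
    using onp_lead[of m] onp_lead[of "Suc m"] by metis
  have "?r * coeff (onp (Suc m)) 0 = - cnj (verb m) * of_real \<kappa>"
    using arg_cong[OF szego_recurrence[of m], of "\<lambda>P. coeff P 0"] k by (simp add: coeff_star_poly)
  moreover have "?r * of_real \<kappa>' = of_real \<kappa>"
    using arg_cong[OF szego_recurrence[of m], of "\<lambda>P. coeff P (Suc m)"] k
    by (simp add: coeff_star_poly)
  ultimately have "?r * coeff (onp (Suc m)) 0 = ?r * (- cnj (verb m) * of_real \<kappa>')"
    by (simp add: mult_ac)
  moreover have "?r \<noteq> 0" using \<open>?r * of_real \<kappa>' = of_real \<kappa>\<close> k by auto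
  ultimately have "coeff (onp (Suc m)) 0 = - cnj (verb m) * of_real \<kappa>'" by (metis mult_cancel_left)
  then show "L (onp (Suc m)) (star_poly (Suc m) (onp (Suc m))) = - cnj (verb m)"
    using eq[of "Suc m"] k by simp
qed

lemma verb_tendsto_zero: "verb \<longlonglongrightarrow> 0"
proof -
  define \<kappa> where "\<kappa> m = Re (coeff (onp m) m)" for m
  have k: "\<kappa> m > 0" "coeff (onp m) m = of_real (\<kappa> m)" for m
    using onp_lead[of m] by (metis Re_complex_of_real \<kappa>_def)+
  define r where "r m = sqrt (1 - (cmod (verb m))\<^sup>2)" for m
  have r1: "r m \<le> 1" "0 < r m" for m
    using cmod_verb[of m] by (auto simp: r_def abs_square_less_1)
  have "of_real (r m) * complex_of_real (\<kappa> (Suc m)) = of_real (\<kappa> m)" for m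
    using arg_cong[OF szego_recurrence[of m], of "\<lambda>P. coeff P (Suc m)"]
    by (simp add: coeff_star_poly k r_def)
  then have rk: "r m * \<kappa> (Suc m) = \<kappa> m" for m
    by (metis of_real_eq_iff of_real_mult)
  have inc: "incseq \<kappa>"
  proof (rule incseq_SucI)
    fix m show "\<kappa> m \<le> \<kappa> (Suc m)"
      using mult_right_mono[OF r1(1)[of m], of "\<kappa> (Suc m)"] k(1)[of "Suc m"] rk[of m] by simp
  qed
  have "(\<kappa> m)\<^sup>2 \<le> 1 / \<delta>" for m
    using lower[of "onp m" m] is_onp_onp[of m] delta k[of m]
    by (simp add: is_onp_def field_simps)
  then have "\<kappa> m \<le> sqrt (1 / \<delta>)" for m
    by (rule real_le_rsqrt)
  then obtain K where K: "\<kappa> \<longlonglongrightarrow> K" using incseq_convergent[OF inc] by blast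
  have "\<kappa> 0 \<le> K" using inc K by (rule incseq_le)
  then have "K \<noteq> 0" using k(1)[of 0] by simp
  have "(\<lambda>m. 1 - (\<kappa> m / \<kappa> (Suc m))\<^sup>2) \<longlonglongrightarrow> 1 - (K / K)\<^sup>2"
    using \<open>K \<noteq> 0\<close> by (intro tendsto_intros K LIMSEQ_Suc)
  moreover have "1 - (\<kappa> m / \<kappa> (Suc m))\<^sup>2 = (cmod (verb m))\<^sup>2" for m
  proof -
    have "\<kappa> m / \<kappa> (Suc m) = r m" using rk[of m] k(1)[of "Suc m"] by (simp add: field_simps)
    then show ?thesis using cmod_verb[of m] by (simp add: r_def abs_square_le_1)
  qed
  ultimately have "(\<lambda>m. (cmod (verb m))\<^sup>2) \<longlonglongrightarrow> 0" using \<open>K \<noteq> 0\<close> by simp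
  then have "(\<lambda>m. sqrt ((cmod (verb m))\<^sup>2)) \<longlonglongrightarrow> sqrt 0" by (rule tendsto_real_sqrt)
  then show ?thesis by (simp add: tendsto_norm_zero_iff)
qed

end

section \<open>The circle with weight given by a polynomial\<close>

lemma sets_circle_measure [simp, measurable_cong]: "sets circle_measure = sets borel"
  by (simp add: circle_measure_def)

lemma cis_measurable [measurable]: "cis \<in> borel_measurable borel"
  by (intro borel_measurable_continuous_onI continuous_intros)

lemma circle_measurable:
  fixes g :: "complex \<Rightarrow> complex"
  shows "continuous_on UNIV g \<Longrightarrow> g \<in> borel_measurable circle_measure"
  using borel_measurable_continuous_onI[of g] by simp

lemma finite_measure_circle: "finite_measure circle_measure"
proof (rule finite_measureI)
  have "emeasure (uniform_measure lborel {0..2 * pi}) {0..2 * pi} = 1"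
    by (rule emeasure_uniform_measure_1) auto
  moreover have "emeasure (uniform_measure lborel {0..2 * pi}) UNIV
      = emeasure (uniform_measure lborel {0..2 * pi}) {0..2 * pi}"
    by (simp add: emeasure_uniform_measure)
  ultimately show "emeasure circle_measure (space circle_measure) \<noteq> \<infinity>"
    unfolding circle_measure_def by (simp add: emeasure_distr)
qed

lemma AE_circle: "AE \<zeta> in circle_measure. cmod \<zeta> = 1"
  unfolding circle_measure_def by (subst AE_distr_iff) auto

text \<open>Continuity bounds \<open>g\<close> on the compact unit circle only, which is enough
  because the measure is concentrated there.\<close>

lemma circle_integrable:
  fixes g :: "complex \<Rightarrow> complex"
  assumes "continuous_on UNIV g"
  shows "integrable circle_measure g"
proof -
  have "compact (g ` sphere 0 1)"
    using assms by (intro compact_continuous_image) (auto intro: continuous_on_subset)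
  then have "bounded (g ` sphere 0 1)" by (rule compact_imp_bounded)
  then obtain B where "\<forall>x\<in>g ` sphere 0 1. cmod x \<le> B" by (auto simp: bounded_iff)
  then have "AE \<zeta> in circle_measure. norm (g \<zeta>) \<le> B"
    using AE_circle by (auto elim!: eventually_mono)
  moreover have "g \<in> borel_measurable borel" using assms by (rule borel_measurable_continuous_onI)
  ultimately show ?thesis
    by (intro finite_measure.integrable_const_bound[OF finite_measure_circle]) simp_all
qed

lemma circle_integral:
  fixes g :: "complex \<Rightarrow> complex"
  assumes "continuous_on UNIV g"
  shows "(\<integral>\<zeta>. g \<zeta> \<partial>circle_measure)
    = (\<integral>\<theta>. indicator {0..2 * pi} \<theta> *\<^sub>R (g (cis \<theta>) / of_real (2 * pi)) \<partial>lborel)"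
proof -
  have g [measurable]: "g \<in> borel_measurable borel" using assms by (rule borel_measurable_continuous_onI)
  have "(\<integral>\<zeta>. g \<zeta> \<partial>circle_measure) = (\<integral>\<theta>. g (cis \<theta>) \<partial>uniform_measure lborel {0..2 * pi})"
    unfolding circle_measure_def by (rule integral_distr) simp_all
  also have "uniform_measure lborel {0..2 * pi}
      = density lborel (\<lambda>\<theta>. ennreal (indicator {0..2 * pi} \<theta> / (2 * pi)))"
    unfolding uniform_measure_def
    by (intro arg_cong[where f = "density lborel"] ext)
      (auto simp: divide_ennreal indicator_def simp flip: ennreal_1)
  also have "(\<integral>\<theta>. g (cis \<theta>) \<partial>density lborel (\<lambda>\<theta>. ennreal (indicator {0..2 * pi} \<theta> / (2 * pi))))
      = (\<integral>\<theta>. (indicator {0..2 * pi} \<theta> / (2 * pi)) *\<^sub>R g (cis \<theta>) \<partial>lborel)"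
    by (rule integral_density) (auto simp: indicator_def)
  finally show ?thesis
    by (simp add: scaleR_conv_of_real field_simps)
qed

text \<open>With k = m - n the integrand is exp(i k theta). For k nonzero its primitive takes the
  same value at 0 and at 2 pi.\<close>

lemma circle_integral_monomial:
  "(\<integral>\<zeta>. \<zeta> ^ m * cnj \<zeta> ^ n \<partial>circle_measure) = (if m = n then 1 else 0)"
proof -
  define k where "k = int m - int n"
  have mono: "cis \<theta> ^ m * cnj (cis \<theta>) ^ n = exp (\<i> * of_int k * of_real \<theta>)" for \<theta>
  proof -
    have "cis \<theta> ^ m * cnj (cis \<theta>) ^ n = cis (real m * \<theta> - real n * \<theta>)"
      unfolding cis_cnj Complex.DeMoivre cis_mult by simp
    then show ?thesis by (simp add: cis_conv_exp k_def algebra_simps)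
  qed
  have "(\<integral>\<zeta>. \<zeta> ^ m * cnj \<zeta> ^ n \<partial>circle_measure)
      = (\<integral>\<theta>. indicator {0..2 * pi} \<theta> *\<^sub>R (exp (\<i> * of_int k * of_real \<theta>) / of_real (2 * pi)) \<partial>lborel)"
    unfolding mono[symmetric] by (rule circle_integral) (intro continuous_intros)
  also have "\<dots> = (if k = 0 then 1 else 0)"
  proof (cases "k = 0")
    case True
    have "(\<integral>\<theta>. indicator {0..2 * pi} \<theta> *\<^sub>R (1 / complex_of_real (2 * pi)) \<partial>lborel)
        = of_real (2 * pi) / of_real (2 * pi) - of_real 0 / of_real (2 * pi)"
      by (rule integral_FTC_Icc) (auto intro!: derivative_eq_intros continuous_intros
          has_vector_derivative_real_field[where f = "\<lambda>x. x / of_real (2 * pi)"])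
    then show ?thesis using True by simp
  next
    case False
    define c where "c = \<i> * complex_of_int k"
    have "c \<noteq> 0" using False by (simp add: c_def)
    have "(\<integral>\<theta>. indicator {0..2 * pi} \<theta> *\<^sub>R (exp (c * of_real \<theta>) / complex_of_real (2 * pi)) \<partial>lborel)
        = exp (c * of_real (2 * pi)) / (c * of_real (2 * pi)) - exp (c * of_real 0) / (c * of_real (2 * pi))"
    proof (rule integral_FTC_Icc)
      have "((\<lambda>x. exp (c * x) / (c * of_real (2 * pi))) has_field_derivative exp (c * x) / of_real (2 * pi))
          (at x)" for x
        using \<open>c \<noteq> 0\<close> by (auto intro!: derivative_eq_intros)
      then show "((\<lambda>\<theta>. exp (c * of_real \<theta>) / (c * of_real (2 * pi))) has_vector_derivative
          exp (c * of_real \<theta>) / of_real (2 * pi)) (at \<theta> within {0..2 * pi})" for \<theta>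
        by (rule has_vector_derivative_real_field)
    qed (use pi_gt_zero in \<open>auto intro!: continuous_intros\<close>)
    moreover have "exp (c * of_real (2 * pi)) = 1"
      unfolding c_def exp_eq_1 by (auto intro!: exI[of _ k])
    ultimately show ?thesis using False by (simp add: c_def)
  qed
  finally show ?thesis by (simp add: k_def)
qed

section \<open>Inner products of polynomials as coefficient sums and as integrals\<close>

lemma coeff_mult_degree_le:
  fixes A B :: "complex poly"
  assumes "degree A \<le> m" "degree B \<le> n"
  shows "coeff (A * B) (m + n) = coeff A m * coeff B n"
proof (cases "degree A = m \<and> degree B = n")
  case True
  then show ?thesis using coeff_mult_degree_sum[of A B] by auto
next
  case False
  then have "degree A < m \<or> degree B < n" using assms by auto
  moreover have "degree (A * B) < m + n" using calculation degree_mult_le[of A B] assms by linarith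
  ultimately show ?thesis by (auto simp: coeff_eq_0)
qed

text \<open>The L^2 inner product for Haar measure in Parseval form. This is the link between the
  Hardy space, whose inner product is a sum over coefficients, and the integrals defining the
  weighted measure.\<close>

definition cip :: "complex poly \<Rightarrow> complex poly \<Rightarrow> complex" where
  "cip A B = (\<Sum>i\<le>degree A. coeff A i * cnj (coeff B i))"

lemma cip_eq: "degree A \<le> n \<Longrightarrow> cip A B = (\<Sum>i\<le>n. coeff A i * cnj (coeff B i))"
  unfolding cip_def by (rule sum.mono_neutral_left) (auto simp: coeff_eq_0)

lemma poly_eq_sum: "degree A \<le> n \<Longrightarrow> poly A (x :: complex) = (\<Sum>i\<le>n. coeff A i * x ^ i)"
  unfolding poly_altdef by (rule sum.mono_neutral_left) (auto simp: coeff_eq_0)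

lemma circle_integral_poly:
  "(\<integral>\<zeta>. poly A \<zeta> * cnj (poly B \<zeta>) \<partial>circle_measure) = cip A B"
proof -
  define n where "n = max (degree A) (degree B)"
  have n: "degree A \<le> n" "degree B \<le> n" by (simp_all add: n_def)
  have "(\<integral>\<zeta>. poly A \<zeta> * cnj (poly B \<zeta>) \<partial>circle_measure)
      = (\<integral>\<zeta>. (\<Sum>i\<le>n. \<Sum>j\<le>n. coeff A i * cnj (coeff B j) * (\<zeta> ^ i * cnj \<zeta> ^ j)) \<partial>circle_measure)"
    by (simp add: poly_eq_sum[OF n(1)] poly_eq_sum[OF n(2)] sum_product mult_ac)
  also have "\<dots> = (\<Sum>i\<le>n. \<Sum>j\<le>n. coeff A i * cnj (coeff B j) * (\<integral>\<zeta>. \<zeta> ^ i * cnj \<zeta> ^ j \<partial>circle_measure))"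
    by (subst Bochner_Integration.integral_sum,
        intro Bochner_Integration.integrable_sum circle_integrable continuous_intros,
        subst Bochner_Integration.integral_sum,
        intro circle_integrable continuous_intros) simp
  also have "\<dots> = (\<Sum>i\<le>n. coeff A i * cnj (coeff B i))"
    by (simp add: circle_integral_monomial if_distrib cong: if_cong)
  finally show ?thesis by (simp add: cip_eq[OF n(1)])
qed

lemma cip_self: "cip A A = of_real (\<Sum>i\<le>degree A. (cmod (coeff A i))\<^sup>2)"
  unfolding cip_def of_real_sum by (simp only: complex_norm_square)

lemma cip_self_pos: "A \<noteq> 0 \<Longrightarrow> Re (cip A A) > 0"
  unfolding cip_self Re_complex_of_real by (rule sum_pos2[of _ "degree A"]) auto

lemma cip_self_ge: "(cmod (coeff A n))\<^sup>2 \<le> Re (cip A A)"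
proof (cases "n \<le> degree A")
  case True
  then show ?thesis unfolding cip_self Re_complex_of_real by (intro member_le_sum) auto
next
  case False
  then show ?thesis unfolding cip_self Re_complex_of_real by (simp add: coeff_eq_0 sum_nonneg)
qed

lemma circle_integral_norm_sq: "(\<integral>\<zeta>. (cmod (poly Q \<zeta>))\<^sup>2 \<partial>circle_measure) = Re (cip Q Q)"
proof -
  have i: "integrable circle_measure (\<lambda>\<zeta>. poly Q \<zeta> * cnj (poly Q \<zeta>))"
    by (intro circle_integrable continuous_intros)
  have "Re (cip Q Q) = (\<integral>\<zeta>. Re (poly Q \<zeta> * cnj (poly Q \<zeta>)) \<partial>circle_measure)"
    unfolding circle_integral_poly[symmetric] by (rule integral_Re[OF i, symmetric])
  moreover have "Re (x * cnj x) = (cmod x)\<^sup>2" for x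
    by (metis Re_complex_of_real complex_norm_square)
  ultimately show ?thesis by (simp only:)
qed

definition wip :: "complex poly \<Rightarrow> complex poly \<Rightarrow> complex poly \<Rightarrow> complex" where
  "wip Q A B = (\<integral>\<zeta>. poly A \<zeta> * cnj (poly B \<zeta>) \<partial>weighted_measure Q)"

text \<open>The weight is \<open>Q\<close> times its conjugate, so one factor is absorbed into each
  polynomial.\<close>

lemma wip_eq_circle:
  "wip Q A B = (\<integral>\<zeta>. poly (Q * A) \<zeta> * cnj (poly (Q * B) \<zeta>) \<partial>circle_measure) / of_real (Re (cip Q Q))"
proof -
  have mp: "(\<lambda>\<zeta>. poly P \<zeta>) \<in> borel_measurable borel" for P :: "complex poly"
    by (intro borel_measurable_continuous_onI continuous_intros)
  have "wip Q A B = (\<integral>\<zeta>. ((cmod (poly Q \<zeta>))\<^sup>2 / Re (cip Q Q)) *\<^sub>R (poly A \<zeta> * cnj (poly B \<zeta>)) \<partial>circle_measure)"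
    unfolding wip_def weighted_measure_def circle_integral_norm_sq
  proof (rule integral_density)
    show "(\<lambda>\<zeta>. poly A \<zeta> * cnj (poly B \<zeta>)) \<in> borel_measurable circle_measure"
      by (intro circle_measurable continuous_intros)
    show "(\<lambda>\<zeta>. (cmod (poly Q \<zeta>))\<^sup>2 / Re (cip Q Q)) \<in> borel_measurable circle_measure"
      using mp[of Q] by simp
    show "AE \<zeta> in circle_measure. 0 \<le> (cmod (poly Q \<zeta>))\<^sup>2 / Re (cip Q Q)"
      using cip_self_pos[of Q] by (cases "Q = 0") auto
  qed
  also have "\<dots> = (\<integral>\<zeta>. poly (Q * A) \<zeta> * cnj (poly (Q * B) \<zeta>) / of_real (Re (cip Q Q)) \<partial>circle_measure)"
    by (intro Bochner_Integration.integral_cong refl)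
      (simp add: scaleR_conv_of_real complex_norm_square mult_ac del: of_real_power)
  finally show ?thesis by simp
qed

lemma wip_eq: "wip Q A B = cip (Q * A) (Q * B) / of_real (Re (cip Q Q))"
  unfolding wip_eq_circle circle_integral_poly ..

lemma cip_add_left: "cip (A + B) C = cip A C + cip B C"
proof -
  define n where "n = max (degree A) (degree B)"
  have "degree A \<le> n" "degree B \<le> n" "degree (A + B) \<le> n"
    by (auto simp: n_def intro: degree_add_le)
  then show ?thesis by (simp add: cip_eq sum.distrib distrib_right)
qed

lemma cip_smult_left: "cip (smult k A) C = k * cip A C"
  using cip_eq[OF degree_smult_le[of k A], of C] by (simp add: cip_def sum_distrib_left mult_ac)

lemma cip_sym: "cip A B = cnj (cip B A)"
proof -
  define n where "n = max (degree A) (degree B)"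
  have "degree A \<le> n" "degree B \<le> n" by (auto simp: n_def)
  then show ?thesis by (simp add: cip_eq mult.commute)
qed

lemma cip_shift: "cip (pCons 0 A) (pCons 0 B) = cip A B"
proof -
  have "degree (pCons 0 A) \<le> Suc (degree A)" by (simp add: degree_pCons_le)
  then show ?thesis by (simp add: cip_eq sum.atMost_Suc_shift cip_def[of A] del: sum.atMost_Suc)
qed

lemma opuc_wip:
  assumes "Q \<noteq> 0"
  shows "opuc (wip Q) ((cmod (lead_coeff Q))\<^sup>2 / Re (cip Q Q))"
proof
  have I: "Re (cip Q Q) > 0" by (rule cip_self_pos[OF assms])
  show "wip Q (A + B) C = wip Q A C + wip Q B C" for A B C
    by (simp add: wip_eq distrib_left cip_add_left add_divide_distrib)
  show "wip Q (smult k A) C = k * wip Q A C" for k A C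
    by (simp add: wip_eq cip_smult_left)
  show "wip Q A B = cnj (wip Q B A)" for A B
    using cip_sym[of "Q * A" "Q * B"] by (simp add: wip_eq)
  show "wip Q (pCons 0 A) (pCons 0 B) = wip Q A B" for A B
    by (simp add: wip_eq cip_shift)
  \<comment> \<open>Reversal does not commute with multiplication by \<open>Q\<close> on
    coefficients, so this property is checked pointwise on the circle, where the factors of
    \<open>Q\<close> stay untouched.\<close>
  show "wip Q (star_poly m A) (star_poly m B) = wip Q B A" if "degree A \<le> m" "degree B \<le> m" for A B m
  proof -
    have "(\<integral>\<zeta>. poly (Q * star_poly m A) \<zeta> * cnj (poly (Q * star_poly m B) \<zeta>) \<partial>circle_measure)
        = (\<integral>\<zeta>. poly (Q * B) \<zeta> * cnj (poly (Q * A) \<zeta>) \<partial>circle_measure)"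
    proof (rule integral_cong_AE)
      show "AE \<zeta> in circle_measure. poly (Q * star_poly m A) \<zeta> * cnj (poly (Q * star_poly m B) \<zeta>)
          = poly (Q * B) \<zeta> * cnj (poly (Q * A) \<zeta>)"
        using AE_circle
      proof eventually_elim
        case (elim \<zeta>)
        then have "\<zeta> \<noteq> 0" "\<zeta> * cnj \<zeta> = 1" by (auto simp: complex_norm_square[symmetric])
        \<comment> \<open>On the circle the reflected point in \<open>poly_star_poly\<close> is
          \<zeta> itself.\<close>
        then have inv: "1 / cnj \<zeta> = \<zeta>" by (metis nonzero_eq_divide_eq complex_cnj_zero_iff)
        have "\<zeta> ^ m * cnj \<zeta> ^ m = 1" using \<open>\<zeta> * cnj \<zeta> = 1\<close> by (metis power_mult_distrib power_one)
        then have "poly (star_poly m A) \<zeta> * cnj (poly (star_poly m B) \<zeta>) = cnj (poly A \<zeta>) * poly B \<zeta>"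
          using that \<open>\<zeta> \<noteq> 0\<close> by (simp add: poly_star_poly inv)
        then show ?case by (simp add: mult_ac)
      qed
    qed (intro circle_measurable continuous_intros)+
    then show ?thesis by (simp add: wip_eq_circle)
  qed
  show "wip Q 1 1 = 1" using I cip_self[of Q] by (simp add: wip_eq complex_eq_iff)
  show "(cmod (lead_coeff Q))\<^sup>2 / Re (cip Q Q) > 0" using I assms by simp
  show "(cmod (lead_coeff Q))\<^sup>2 / Re (cip Q Q) * (cmod (coeff A m))\<^sup>2 \<le> Re (wip Q A A)"
    if "degree A \<le> m" for A m
  proof -
    have "coeff (Q * A) (degree Q + m) = lead_coeff Q * coeff A m"
      by (rule coeff_mult_degree_le[OF order_refl that])
    then have "(cmod (lead_coeff Q))\<^sup>2 * (cmod (coeff A m))\<^sup>2 \<le> Re (cip (Q * A) (Q * A))"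
      using cip_self_ge[of "Q * A" "degree Q + m"] by (simp add: norm_mult power_mult_distrib)
    then show ?thesis using I by (simp add: wip_eq divide_right_mono)
  qed
qed

lemma orthonormal_polys_weighted:
  assumes "Q \<noteq> 0"
  shows "orthonormal_polys (weighted_measure Q) = opuc.onp (wip Q)"
proof -
  interpret opuc "wip Q" "(cmod (lead_coeff Q))\<^sup>2 / Re (cip Q Q)" by (rule opuc_wip[OF assms])
  show ?thesis
    unfolding orthonormal_polys_def wip_def[symmetric]
  proof (rule the_equality)
    show "(\<forall>m. degree (onp m) = m \<and> (\<exists>\<kappa>>0. lead_coeff (onp m) = complex_of_real \<kappa>)) \<and>
        (\<forall>m n. wip Q (onp m) (onp n) = (if m = n then 1 else 0))"
      using onp_orthonormal onp_lead by metis
  qed (metis orthonormal_polys_eq_onp)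
qed

lemma verblunsky_weighted:
  assumes "Q \<noteq> 0"
  shows "verblunsky (weighted_measure Q) = opuc.verb (wip Q)"
proof
  fix m
  interpret opuc "wip Q" "(cmod (lead_coeff Q))\<^sup>2 / Re (cip Q Q)" by (rule opuc_wip[OF assms])
  show "verblunsky (weighted_measure Q) m = verb m"
    unfolding verblunsky_def orthonormal_polys_weighted[OF assms]
    by (rule the_equality) (use cmod_verb szego_recurrence verb_unique in auto)
qed

section \<open>Submodules generated by a polynomial\<close>

lemma eval2_mult: "eval2 (p * r) z w = eval2 p z w * eval2 r z w"
  by (simp add: eval2_def)

lemma eval2_monom: "eval2 (monom (monom c i) j) z w = c * z ^ i * w ^ j"
  by (simp add: eval2_def poly_monom)

lemma coeff2_bounded: "\<exists>N. \<forall>i j. coeff2 p i j \<noteq> 0 \<longrightarrow> i \<le> N \<and> j \<le> N"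
proof -
  define N where "N = degree p + (\<Sum>j\<le>degree p. degree (coeff p j))"
  have "i \<le> N \<and> j \<le> N" if "coeff2 p i j \<noteq> 0" for i j
  proof -
    have "coeff p j \<noteq> 0" using that by (auto simp: coeff2_def)
    then have "j \<le> degree p" by (rule le_degree)
    moreover have "i \<le> degree (coeff p j)" using that by (auto simp: coeff2_def intro: le_degree)
    moreover have "degree (coeff p j) \<le> (\<Sum>j\<le>degree p. degree (coeff p j))"
      using \<open>j \<le> degree p\<close> by (intro member_le_sum) auto
    ultimately show ?thesis by (simp add: N_def)
  qed
  then show ?thesis by blast
qed

text \<open>For each w the polynomial in z is zero, so every constant \<open>[:w:]\<close> is a root
  of \<open>p\<close> over the integral domain of polynomials in z; a nonzero \<open>p\<close> has
  only finitely many roots.\<close>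

lemma eval2_eq_zeroD:
  assumes "\<And>z w. eval2 p z w = 0"
  shows "p = 0"
proof (rule ccontr)
  assume "p \<noteq> 0"
  have "poly p [:w:] = 0" for w
    using assms[of _ w] by (intro poly_all_0_iff_0[THEN iffD1] allI) (simp add: eval2_def)
  then have "range (\<lambda>w. [:w:]) \<subseteq> {x. poly p x = 0}" by auto
  then have "finite (range (\<lambda>w::complex. [:w:]))"
    using poly_roots_finite[OF \<open>p \<noteq> 0\<close>] finite_subset by blast
  moreover have "inj (\<lambda>w::complex. [:w:])" by (auto simp: inj_def)
  ultimately show False using finite_imageD infinite_UNIV_char_0 by blast
qed

definition hmono :: "nat \<Rightarrow> nat \<Rightarrow> bifun" where
  "hmono i j = (\<lambda>(z, w). if (z, w) \<in> bidisc then z ^ i * w ^ j else 0)"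

lemma hmono_in_hardy2: "hmono i j \<in> hardy2"
  and taylor_hmono: "taylor (hmono i j) = (\<lambda>x. if x = (i, j) then 1 else 0)"
proof -
  have *: "has_taylor (hmono i j) (\<lambda>x. if x = (i, j) then 1 else 0)"
    unfolding has_taylor_def
  proof (intro allI impI)
    fix z w assume "(z, w) \<in> bidisc"
    then show "((\<lambda>(k, l). (if (k, l) = (i, j) then 1 else 0) * z ^ k * w ^ l) has_sum hmono i j (z, w)) UNIV"
      by (intro has_sum_finite_neutralI[of "{(i, j)}"]) (auto simp: hmono_def split: if_splits)
  qed
  then show "taylor (hmono i j) = (\<lambda>x. if x = (i, j) then 1 else 0)" by (rule taylor_eqI)
  have "l2 (\<lambda>x. if x = (i, j) then 1 else 0) UNIV"
    unfolding l2_def by (rule finite_nonzero_values_imp_summable_on) simp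
  with * show "hmono i j \<in> hardy2" by (rule hardy2I) (auto simp: hmono_def)
qed

lemma hinner_hmono: "hinner (hmono i j) (hmono k l) = (if i = k \<and> j = l then 1 else 0)"
proof -
  have "((\<lambda>x. taylor (hmono i j) x * cnj (taylor (hmono k l) x)) has_sum
      (if i = k \<and> j = l then 1 else 0)) UNIV"
    by (rule has_sum_finite_neutralI[of "{(i, j)}"]) (auto simp: taylor_hmono)
  then show ?thesis
    using has_sum_unique[OF hinner_has_sum[OF hmono_in_hardy2 hmono_in_hardy2]] by blast
qed

lemma polyfun_eq_sum:
  assumes "\<forall>i j. coeff2 r i j \<noteq> 0 \<longrightarrow> i \<le> N \<and> j \<le> N"
  shows "polyfun r = (\<lambda>x. \<Sum>(i, j)\<in>{..N} \<times> {..N}. coeff2 r i j * hmono i j x)"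
proof
  fix x :: "complex \<times> complex"
  obtain z w where x: "x = (z, w)" by (cases x)
  show "polyfun r x = (\<Sum>(i, j)\<in>{..N} \<times> {..N}. coeff2 r i j * hmono i j x)"
    unfolding x polyfun_def hmono_def using eval2_altdef[of r N z w] assms
    by (simp add: case_prod_unfold mult_ac)
qed

lemma polyfun_in_hardy2: "polyfun r \<in> hardy2"
proof -
  obtain N where N: "\<forall>i j. coeff2 r i j \<noteq> 0 \<longrightarrow> i \<le> N \<and> j \<le> N" using coeff2_bounded[of r] by blast
  show ?thesis
    unfolding polyfun_eq_sum[OF N] case_prod_unfold
    by (intro hardy2_sum hardy2_scale hmono_in_hardy2)
qed

text \<open>The closure is defined by approximation, so idempotence and the linear operations are
  \<epsilon>/2 arguments. For scalars the divisor is |k| + 1, which also covers k = 0.\<close>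

lemma closed_subspace_hclosure:
  assumes "S \<subseteq> hardy2" "(\<lambda>x. 0) \<in> S"
    and add: "\<And>f g. f \<in> S \<Longrightarrow> g \<in> S \<Longrightarrow> (\<lambda>x. f x + g x) \<in> S"
    and scale: "\<And>f k. f \<in> S \<Longrightarrow> (\<lambda>x. k * f x) \<in> S"
  shows "closed_subspace (hclosure S)" and "S \<subseteq> hclosure S"
proof -
  have approx: "\<exists>g\<in>S. hnorm (\<lambda>x. f x - g x) < \<epsilon>" if "f \<in> hclosure S" "\<epsilon> > 0" for f \<epsilon>
    using that by (simp add: hclosure_def)
  have H: "hclosure S \<subseteq> hardy2" by (auto simp: hclosure_def)
  show sub: "S \<subseteq> hclosure S"
  proof
    fix f assume f: "f \<in> S"
    have "hnorm (\<lambda>x. f x - f x) = 0" by (simp add: hnorm_def)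
    then show "f \<in> hclosure S" using f assms(1) by (auto simp: hclosure_def intro!: bexI[of _ f])
  qed
  show "closed_subspace (hclosure S)"
    unfolding closed_subspace_def
  proof (intro conjI ballI allI H)
    show "(\<lambda>x. 0) \<in> hclosure S" using assms(2) sub by auto
  next
    fix f g assume fg: "f \<in> hclosure S" "g \<in> hclosure S"
    have "\<exists>h\<in>S. hnorm (\<lambda>x. f x + g x - h x) < \<epsilon>" if "\<epsilon> > 0" for \<epsilon>
    proof -
      obtain f' where f': "f' \<in> S" "hnorm (\<lambda>x. f x - f' x) < \<epsilon> / 2"
        using approx[OF fg(1) half_gt_zero[OF \<open>\<epsilon> > 0\<close>]] by (rule bexE)
      obtain g' where g': "g' \<in> S" "hnorm (\<lambda>x. g x - g' x) < \<epsilon> / 2"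
        using approx[OF fg(2) half_gt_zero[OF \<open>\<epsilon> > 0\<close>]] by (rule bexE)
      have "hnorm (\<lambda>x. (f x - f' x) + (g x - g' x)) \<le> hnorm (\<lambda>x. f x - f' x) + hnorm (\<lambda>x. g x - g' x)"
        using fg f' g' H assms(1) by (intro hnorm_triangle hardy2_diff) auto
      also have "\<dots> < \<epsilon>" using f' g' by simp
      also have "(\<lambda>x. (f x - f' x) + (g x - g' x)) = (\<lambda>x. f x + g x - (f' x + g' x))"
        by (simp add: algebra_simps)
      finally show ?thesis using add[OF f'(1) g'(1)] by (rule_tac bexI)
    qed
    then show "(\<lambda>x. f x + g x) \<in> hclosure S"
      using fg H by (auto simp: hclosure_def intro!: hardy2_add)
  next
    fix f k assume f: "f \<in> hclosure S"
    have "\<exists>h\<in>S. hnorm (\<lambda>x. k * f x - h x) < \<epsilon>" if "\<epsilon> > 0" for \<epsilon>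
    proof -
      have k1: "cmod k + 1 > 0" by (simp add: add_nonneg_pos)
      then have "\<epsilon> / (cmod k + 1) > 0" using \<open>\<epsilon> > 0\<close> by simp
      then obtain g where g: "g \<in> S" "hnorm (\<lambda>x. f x - g x) < \<epsilon> / (cmod k + 1)"
        using approx[OF f] by (meson bexE)
      have "hnorm (\<lambda>x. k * (f x - g x)) = cmod k * hnorm (\<lambda>x. f x - g x)"
        using f g H assms(1) by (intro hnorm_scale hardy2_diff) auto
      also have "\<dots> \<le> (cmod k + 1) * hnorm (\<lambda>x. f x - g x)" by (intro mult_right_mono) auto
      also have "\<dots> < \<epsilon>" using g(2) unfolding pos_less_divide_eq[OF k1] by (simp only: mult.commute)
      also have "(\<lambda>x. k * (f x - g x)) = (\<lambda>x. k * f x - k * g x)" by (simp add: algebra_simps)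
      finally show ?thesis using scale[OF g(1)] by (rule_tac bexI)
    qed
    then show "(\<lambda>x. k * f x) \<in> hclosure S"
      using f H by (auto simp: hclosure_def intro!: hardy2_scale)
  next
    show "hclosure (hclosure S) \<subseteq> hclosure S"
    proof
      fix f assume f: "f \<in> hclosure (hclosure S)"
      then have fH: "f \<in> hardy2" by (simp add: hclosure_def)
      have "\<exists>h\<in>S. hnorm (\<lambda>x. f x - h x) < \<epsilon>" if "\<epsilon> > 0" for \<epsilon>
      proof -
        have "\<forall>\<epsilon>>0. \<exists>g\<in>hclosure S. hnorm (\<lambda>x. f x - g x) < \<epsilon>"
          using f by (simp add: hclosure_def[of "hclosure S"])
        from this[rule_format, OF half_gt_zero[OF \<open>\<epsilon> > 0\<close>]]
        obtain g where g: "g \<in> hclosure S" "hnorm (\<lambda>x. f x - g x) < \<epsilon> / 2" by (rule bexE)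
        obtain h where h: "h \<in> S" "hnorm (\<lambda>x. g x - h x) < \<epsilon> / 2"
          using approx[OF g(1) half_gt_zero[OF \<open>\<epsilon> > 0\<close>]] by (rule bexE)
        have "hnorm (\<lambda>x. (f x - g x) + (g x - h x)) \<le> hnorm (\<lambda>x. f x - g x) + hnorm (\<lambda>x. g x - h x)"
          using fH g h H assms(1) by (intro hnorm_triangle hardy2_diff) auto
        also have "\<dots> < \<epsilon>" using g h by simp
        finally show ?thesis using h(1) by (intro bexI[of _ h]) simp_all
      qed
      then show "f \<in> hclosure S" using fH by (simp add: hclosure_def)
    qed
  qed
qed

section \<open>Multiplication by monomials and the submodule spanned by monomial multiples\<close>

lemma has_sum_inj_iff:
  assumes "inj h" "\<And>x. x \<notin> range h \<Longrightarrow> G x = 0"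
  shows "((\<lambda>x. G (h x)) has_sum S) UNIV \<longleftrightarrow> (G has_sum S) UNIV"
proof -
  have "((\<lambda>x. G (h x)) has_sum S) UNIV \<longleftrightarrow> (G has_sum S) (range h)"
    using has_sum_reindex[OF assms(1), of G S] by (simp add: o_def)
  also have "\<dots> \<longleftrightarrow> (G has_sum S) UNIV" by (rule has_sum_cong_neutral) (use assms(2) in auto)
  finally show ?thesis .
qed

text \<open>One operator covers three uses: multiplication by z, multiplication by w, and the
  identity (both exponents 0), which serves to test against the submodule itself.\<close>

definition mult_mono :: "nat \<Rightarrow> nat \<Rightarrow> bifun \<Rightarrow> bifun" where
  "mult_mono a b f = (\<lambda>(z, w). z ^ a * w ^ b * f (z, w))"

lemma mult_z_eq: "mult_z = mult_mono 1 0" and mult_w_eq: "mult_w = mult_mono 0 1"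
  by (auto simp: fun_eq_iff mult_z_def mult_w_def mult_mono_def)

lemma
  assumes "f \<in> hardy2"
  shows mult_mono_in_hardy2: "mult_mono a b f \<in> hardy2" and hnorm_mult_mono: "hnorm (mult_mono a b f) = hnorm f"
proof -
  define h where "h = (\<lambda>(i, j). (i + a, j + b))"
  have inj: "inj h" by (auto simp: inj_def h_def)
  define d where "d = (\<lambda>(i, j). if a \<le> i \<and> b \<le> j then taylor f (i - a, j - b) else 0)"
  have dh: "d (h x) = taylor f x" for x by (cases x) (simp add: d_def h_def)
  have d0: "d x = 0" if "x \<notin> range h" for x
  proof (cases x)
    case (Pair i j)
    have "h (i - a, j - b) = x" if "a \<le> i" "b \<le> j" using that Pair by (simp add: h_def)
    then have "\<not> (a \<le> i \<and> b \<le> j)" using that by (metis rangeI)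
    then show ?thesis using Pair by (auto simp: d_def)
  qed
  have ht: "has_taylor (mult_mono a b f) d"
    unfolding has_taylor_def
  proof (intro allI impI)
    fix z w assume zw: "(z, w) \<in> bidisc"
    then have "((\<lambda>(i, j). taylor f (i, j) * z ^ i * w ^ j) has_sum f (z, w)) UNIV"
      using has_taylor_taylor[OF assms] by (auto simp: has_taylor_def)
    from has_sum_cmult_right[OF this, of "z ^ a * w ^ b"]
    have "((\<lambda>x. taylor f x * z ^ fst (h x) * w ^ snd (h x)) has_sum mult_mono a b f (z, w)) UNIV"
      by (simp add: case_prod_unfold h_def mult_mono_def power_add mult_ac)
    then have "((\<lambda>x. d x * z ^ fst x * w ^ snd x) has_sum mult_mono a b f (z, w)) UNIV"
      by (subst has_sum_inj_iff[OF inj, symmetric]) (simp_all add: dh d0)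
    then show "((\<lambda>(i, j). d (i, j) * z ^ i * w ^ j) has_sum mult_mono a b f (z, w)) UNIV"
      by (simp add: case_prod_unfold)
  qed
  have hs: "((\<lambda>x. (cmod (d x))\<^sup>2) has_sum (hnorm f)\<^sup>2) UNIV"
    using hinner_self_has_sum[OF assms] by (subst has_sum_inj_iff[OF inj, symmetric]) (simp_all add: dh d0)
  then have "l2 d UNIV" unfolding l2_def by (rule has_sum_imp_summable)
  moreover have "mult_mono a b f x = 0" if "x \<notin> bidisc" for x
    using hardy2_outside[OF assms that] by (cases x) (simp add: mult_mono_def)
  ultimately show m: "mult_mono a b f \<in> hardy2" by (rule hardy2I[OF ht])
  have "(hnorm (mult_mono a b f))\<^sup>2 = (hnorm f)\<^sup>2"
    using hinner_self_has_sum[OF m] hs unfolding taylor_eqI[OF ht] by (rule has_sum_unique)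
  then show "hnorm (mult_mono a b f) = hnorm f" by (rule power2_eq_imp_eq) simp_all
qed

text \<open>Multiplication by a monomial is isometric, so it carries approximation in
  \<open>S\<close> to approximation of the product. The summand 1 in the denominator guards against
  a vanishing norm.\<close>

lemma mult_mono_perp_hclosure:
  assumes "S \<subseteq> hardy2" "e \<in> hardy2" "\<And>g. g \<in> S \<Longrightarrow> hinner e (mult_mono a b g) = 0" "g \<in> hclosure S"
  shows "hinner e (mult_mono a b g) = 0"
proof (rule ccontr)
  assume nz: "hinner e (mult_mono a b g) \<noteq> 0"
  have gH: "g \<in> hardy2" using assms(4) by (simp add: hclosure_def)
  define \<epsilon> where "\<epsilon> = cmod (hinner e (mult_mono a b g)) / (hnorm e + 1)"
  have e1: "hnorm e + 1 > 0" by (simp add: add_nonneg_pos)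
  have "\<epsilon> > 0" using nz e1 by (simp add: \<epsilon>_def)
  then have "\<exists>h\<in>S. hnorm (\<lambda>x. g x - h x) < \<epsilon>" using assms(4) by (simp add: hclosure_def)
  then obtain h where h: "h \<in> S" "hnorm (\<lambda>x. g x - h x) < \<epsilon>" by (rule bexE)
  have hH: "h \<in> hardy2" using h assms(1) by auto
  have dH: "(\<lambda>x. g x - h x) \<in> hardy2" by (rule hardy2_diff[OF gH hH])
  have "mult_mono a b (\<lambda>x. g x - h x) = (\<lambda>x. mult_mono a b g x - mult_mono a b h x)"
    by (auto simp: mult_mono_def algebra_simps)
  then have "hinner e (mult_mono a b g) = hinner e (mult_mono a b (\<lambda>x. g x - h x))"
    using assms(3)[OF h(1)] by (simp add: hinner_diff_right mult_mono_in_hardy2 gH hH assms(2))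
  then have "cmod (hinner e (mult_mono a b g)) \<le> hnorm e * hnorm (\<lambda>x. g x - h x)"
    using hinner_cauchy_schwarz[OF assms(2) mult_mono_in_hardy2[OF dH, of a b]]
    by (simp add: hnorm_mult_mono[OF dH])
  also have "\<dots> \<le> hnorm e * \<epsilon>" using h by (intro mult_left_mono) auto
  also have "\<dots> < (hnorm e + 1) * \<epsilon>" using \<open>\<epsilon> > 0\<close> by simp
  also have "\<dots> = cmod (hinner e (mult_mono a b g))" using e1 by (simp add: \<epsilon>_def)
  finally show False by simp
qed

definition polymono :: "complex poly poly \<Rightarrow> nat \<Rightarrow> nat \<Rightarrow> bifun" where
  "polymono p i j = polyfun (p * monom (monom 1 i) j)"

lemma polymono_eq: "polymono p i j (z, w) = polyfun p (z, w) * z ^ i * w ^ j"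
  by (simp add: polymono_def polyfun_def eval2_mult eval2_monom)

lemma mult_mono_polymono: "mult_mono a b (polymono p i j) = polymono p (i + a) (j + b)"
  by (auto simp: mult_mono_def polymono_eq power_add)

lemma polyfun_mult_eq_sum:
  assumes "\<forall>i j. coeff2 r i j \<noteq> 0 \<longrightarrow> i \<le> N \<and> j \<le> N"
  shows "polyfun (p * r) = (\<lambda>x. \<Sum>(i, j)\<in>{..N} \<times> {..N}. coeff2 r i j * polymono p i j x)"
proof
  fix x :: "complex \<times> complex"
  obtain z w where x: "x = (z, w)" by (cases x)
  have "polyfun (p * r) x = polyfun p (z, w) * eval2 r z w"
    by (simp add: x polyfun_def eval2_mult)
  also have "\<dots> = (\<Sum>(i, j)\<in>{..N} \<times> {..N}. coeff2 r i j * polymono p i j x)"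
    using eval2_altdef[of r N z w] assms
    by (simp add: x polymono_eq sum_distrib_left case_prod_unfold mult_ac)
  finally show "polyfun (p * r) x = (\<Sum>(i, j)\<in>{..N} \<times> {..N}. coeff2 r i j * polymono p i j x)" .
qed

lemma polymono_in_hardy2: "polymono p i j \<in> hardy2"
  unfolding polymono_def by (rule polyfun_in_hardy2)

lemma
  shows closed_subspace_submodule_gen: "closed_subspace (submodule_gen p)"
    and range_subset_submodule_gen: "range (\<lambda>r. polyfun (p * r)) \<subseteq> submodule_gen p"
proof -
  have 1: "range (\<lambda>r. polyfun (p * r)) \<subseteq> hardy2" by (auto intro: polyfun_in_hardy2)
  have 2: "(\<lambda>x. 0) \<in> range (\<lambda>r. polyfun (p * r))"
    by (rule range_eqI[of _ _ 0]) (auto simp: polyfun_def eval2_def)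
  have 3: "(\<lambda>x. f x + g x) \<in> range (\<lambda>r. polyfun (p * r))"
    if "f \<in> range (\<lambda>r. polyfun (p * r))" "g \<in> range (\<lambda>r. polyfun (p * r))" for f g
  proof -
    from that obtain r r' where "f = polyfun (p * r)" "g = polyfun (p * r')" by auto
    then have "(\<lambda>x. f x + g x) = polyfun (p * (r + r'))"
      by (auto simp: polyfun_def eval2_def distrib_left)
    then show ?thesis by blast
  qed
  have 4: "(\<lambda>x. k * f x) \<in> range (\<lambda>r. polyfun (p * r))" if "f \<in> range (\<lambda>r. polyfun (p * r))" for f k
  proof -
    from that obtain r where "f = polyfun (p * r)" by auto
    then have "(\<lambda>x. k * f x) = polyfun (p * (r * [:[:k:]:]))"
      by (auto simp: polyfun_def eval2_def)
    then show ?thesis by blast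
  qed
  show "closed_subspace (submodule_gen p)" "range (\<lambda>r. polyfun (p * r)) \<subseteq> submodule_gen p"
    unfolding submodule_gen_def by (rule closed_subspace_hclosure[OF 1 2 3 4]; assumption)+
qed

lemma polymono_in_submodule_gen: "polymono p i j \<in> submodule_gen p"
  using range_subset_submodule_gen[of p] by (auto simp: polymono_def)

lemma mult_mono_submodule_gen_subset: "mult_mono a b ` submodule_gen p \<subseteq> hardy2"
  using closed_subspaceD(1)[OF closed_subspace_submodule_gen] mult_mono_in_hardy2 by blast

text \<open>Linearity and continuity reduce orthogonality to z^a w^b [p] to the countable family of
  monomial multiples of \<open>p\<close>. Membership in [p] minus z [p] or w [p] is always checked
  in this form.\<close>

lemma perp_mult_mono_submodule_gen_iff:
  assumes "e \<in> hardy2"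
  shows "(\<forall>g\<in>mult_mono a b ` submodule_gen p. hinner e g = 0)
    \<longleftrightarrow> (\<forall>i j. hinner e (polymono p (i + a) (j + b)) = 0)" (is "?L \<longleftrightarrow> ?R")
proof
  assume ?L
  then show ?R using polymono_in_submodule_gen by (metis imageI mult_mono_polymono)
next
  assume R: ?R
  have "hinner e (mult_mono a b g) = 0" if "g \<in> range (\<lambda>r. polyfun (p * r))" for g
  proof -
    from that obtain r where g: "g = polyfun (p * r)" by auto
    obtain N where N: "\<forall>i j. coeff2 r i j \<noteq> 0 \<longrightarrow> i \<le> N \<and> j \<le> N" using coeff2_bounded[of r] by blast
    have eq: "mult_mono a b g
        = (\<lambda>x. \<Sum>x'\<in>{..N} \<times> {..N}. coeff2 r (fst x') (snd x') * mult_mono a b (polymono p (fst x') (snd x')) x)"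
      unfolding g polyfun_mult_eq_sum[OF N]
      by (auto simp: mult_mono_def sum_distrib_left case_prod_unfold mult_ac)
    have "hinner e (mult_mono a b g) = (\<Sum>x'\<in>{..N} \<times> {..N}.
        hinner e (\<lambda>x. coeff2 r (fst x') (snd x') * mult_mono a b (polymono p (fst x') (snd x')) x))"
      unfolding eq by (intro hinner_sum_right hardy2_scale mult_mono_in_hardy2 polymono_in_hardy2 assms)
    also have "\<dots> = 0"
      by (intro sum.neutral ballI)
        (simp add: hinner_scale_right polymono_in_hardy2 mult_mono_polymono R)
    finally show ?thesis .
  qed
  moreover have "range (\<lambda>r. polyfun (p * r)) \<subseteq> hardy2" by (auto intro: polyfun_in_hardy2)
  ultimately show ?L
    using mult_mono_perp_hclosure[OF _ assms] unfolding submodule_gen_def by blast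
qed

lemma submodule_gen_eq_zeroD:
  assumes "g \<in> submodule_gen p" "\<And>i j. hinner g (polymono p i j) = 0"
  shows "g = (\<lambda>x. 0)"
proof -
  have gH: "g \<in> hardy2" using closed_subspace_submodule_gen assms(1) by (rule closed_subspaceD)
  have "\<forall>h\<in>mult_mono 0 0 ` submodule_gen p. hinner g h = 0"
    unfolding perp_mult_mono_submodule_gen_iff[OF gH] using assms(2) by simp
  moreover have "mult_mono 0 0 g = g" by (auto simp: mult_mono_def)
  ultimately have "hinner g g = 0" using assms(1) by (metis imageI)
  then show ?thesis by (rule hinner_self_eq_zeroD[OF gH])
qed

text \<open>Where W is nonzero this is multiplicativity of evaluation at Z / W. At W = 0 only the
  coefficients in the top degrees m, n and m + n remain.\<close>

lemma homog_eval_mult: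
  assumes "degree A \<le> m" "degree B \<le> n"
  shows "homog_eval m A Z W * homog_eval n B Z W = homog_eval (m + n) (A * B) Z W"
proof (cases "W = 0")
  case True
  have "homog_eval k P Z 0 = coeff P k * Z ^ k" for k P
  proof -
    have "homog_eval k P Z 0 = (\<Sum>i\<in>{k}. coeff P i * Z ^ i * 0 ^ (k - i))"
      unfolding homog_eval_def by (rule sum.mono_neutral_right) auto
    then show ?thesis by simp
  qed
  then show ?thesis using True coeff_mult_degree_le[OF assms] by (simp add: power_add)
next
  case False
  have "degree (A * B) \<le> m + n" using degree_mult_le[of A B] assms by linarith
  then show ?thesis using assms False by (simp add: homog_eval_eq power_add)
qed

lemma
  assumes "homogeneous d q"
  shows degree_dehomogenize: "degree (poly q [:1:]) \<le> d"
    and eval2_homogeneous: "eval2 q Z W = homog_eval d (poly q [:1:]) Z W"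
proof -
  have supp: "coeff2 q i j = 0" if "i + j \<noteq> d" for i j
    using assms that by (auto simp: homogeneous_def)
  have dq: "degree q \<le> d"
    by (rule degree_le) (auto intro!: poly_eqI supp simp: coeff2_def[symmetric])
  have "poly q [:1:] = (\<Sum>j\<le>degree q. coeff q j)"
    by (simp add: poly_altdef one_pCons[symmetric])
  also have "\<dots> = (\<Sum>j\<le>d. coeff q j)"
    by (rule sum.mono_neutral_left) (use dq in \<open>auto simp: coeff_eq_0\<close>)
  finally have cQ: "coeff (poly q [:1:]) k = (\<Sum>j\<le>d. coeff2 q k j)" for k
    by (simp add: coeff_sum coeff2_def)
  show "degree (poly q [:1:]) \<le> d"
    by (rule degree_le) (auto simp: cQ supp intro!: sum.neutral)
  have "eval2 q Z W = (\<Sum>(i, j)\<in>{..d} \<times> {..d}. coeff2 q i j * Z ^ i * W ^ j)"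
    by (rule eval2_altdef) (use supp in force)
  also have "\<dots> = (\<Sum>i\<le>d. \<Sum>j\<le>d. coeff2 q i j * Z ^ i * W ^ j)"
    by (simp add: sum.cartesian_product)
  also have "\<dots> = (\<Sum>i\<le>d. \<Sum>j\<le>d. coeff2 q i j * Z ^ i * W ^ (d - i))"
    using supp by (intro sum.cong refl) (metis add_diff_cancel_left' mult_zero_left)
  also have "\<dots> = homog_eval d (poly q [:1:]) Z W"
    by (simp add: homog_eval_def cQ sum_distrib_right)
  finally show "eval2 q Z W = homog_eval d (poly q [:1:]) Z W" .
qed

text \<open>Purely formal on coefficients; it is used to discard the residue classes on which the
  expansion of P_z P_w vanishes.\<close>

lemma hsum_reindex:
  assumes "inj_on h J" "h ` J \<subseteq> I" "\<And>i. i \<in> I - h ` J \<Longrightarrow> x i = 0"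
  shows "hsum I x u = hsum J (\<lambda>j. x (h j)) (\<lambda>j. u (h j))"
proof -
  have "(\<Sum>\<^sub>\<infinity>i\<in>I. x i * taylor (u i) k) = (\<Sum>\<^sub>\<infinity>j\<in>J. x (h j) * taylor (u (h j)) k)" for k
  proof -
    have "(\<Sum>\<^sub>\<infinity>i\<in>I. x i * taylor (u i) k) = (\<Sum>\<^sub>\<infinity>i\<in>h ` J. x i * taylor (u i) k)"
      by (rule infsum_cong_neutral) (use assms in auto)
    then show ?thesis by (simp add: infsum_reindex[OF assms(1)] o_def)
  qed
  then show ?thesis by (simp add: hsum_def)
qed

section \<open>Quasi-homogeneous polynomials\<close>

lemma hinner_hmono_sums:
  "hinner (\<lambda>x. \<Sum>k\<in>K. c k * hmono (g k) (h k) x) (\<lambda>x. \<Sum>l\<in>K'. c' l * hmono (g' l) (h' l) x)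
    = (\<Sum>k\<in>K. \<Sum>l\<in>K'. c k * cnj (c' l) * (if g k = g' l \<and> h k = h' l then 1 else 0))"
proof -
  have m: "(\<lambda>x. k * hmono i j x) \<in> hardy2" for k i j by (intro hardy2_scale hmono_in_hardy2)
  have r: "(\<lambda>x. \<Sum>l\<in>K'. c' l * hmono (g' l) (h' l) x) \<in> hardy2" by (intro hardy2_sum m)
  have "hinner (\<lambda>x. \<Sum>k\<in>K. c k * hmono (g k) (h k) x) (\<lambda>x. \<Sum>l\<in>K'. c' l * hmono (g' l) (h' l) x)
      = (\<Sum>k\<in>K. hinner (\<lambda>x. c k * hmono (g k) (h k) x) (\<lambda>x. \<Sum>l\<in>K'. c' l * hmono (g' l) (h' l) x))"
    by (intro hinner_sum_left m r)
  also have "\<dots> = (\<Sum>k\<in>K. \<Sum>l\<in>K'. hinner (\<lambda>x. c k * hmono (g k) (h k) x) (\<lambda>x. c' l * hmono (g' l) (h' l) x))"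
    by (intro sum.cong refl hinner_sum_right m)
  finally show ?thesis
    by (simp only: hinner_scale_left[OF hmono_in_hardy2] hinner_scale_right[OF hmono_in_hardy2]
        hinner_hmono mult.assoc)
qed

lemma mult_add_eq_iff:
  fixes i j k l n :: nat
  assumes "i < n" "j < n"
  shows "i + n * k = j + n * l \<longleftrightarrow> i = j \<and> k = l"
proof
  assume eq: "i + n * k = j + n * l"
  then have "(i + n * k) mod n = (j + n * l) mod n" "(i + n * k) div n = (j + n * l) div n" by simp_all
  then show "i = j \<and> k = l" using assms by simp
qed simp

text \<open>The final proof instantiates this twice: for \<open>p\<close> with its reduction, and
  for \<open>q\<close> with s = t = 1 and a = b = 0.\<close>

locale quasi_homogeneous_reduction =
  fixes s t a b d :: nat and p q :: "complex poly poly"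
  assumes s: "s \<ge> 1" and t: "t \<ge> 1" and p: "p \<noteq> 0" and red: "reduction s t p a b d q"
begin

definition Q :: "complex poly" where "Q = poly q [:1:]"

lemma hom: "homogeneous d q"
  using red by (simp add: reduction_def)

lemma degree_Q: "degree Q \<le> d"
  unfolding Q_def by (rule degree_dehomogenize[OF hom])

lemma eval2_p: "eval2 p z w = z ^ a * w ^ b * homog_eval d Q (z ^ t) (w ^ s)"
  using red by (simp add: reduction_def eval2_homogeneous[OF hom] Q_def)

lemma Q_nonzero: "Q \<noteq> 0"
proof
  assume "Q = 0"
  then have "p = 0" by (intro eval2_eq_zeroD) (simp add: eval2_p homog_eval_def)
  then show False using p by simp
qed

sublocale opuc "wip Q" "(cmod (lead_coeff Q))\<^sup>2 / Re (cip Q Q)"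
  by (rule opuc_wip[OF Q_nonzero])

text \<open>\<open>G m \<sigma> \<rho> A\<close> is \<open>p z\<^sup>\<sigma> w\<^sup>\<rho> W\<^sup>m A(Z / W)\<close> with \<open>Z = z\<^sup>t\<close>, \<open>W = w\<^sup>s\<close>.\<close>

definition G :: "nat \<Rightarrow> nat \<Rightarrow> nat \<Rightarrow> complex poly \<Rightarrow> bifun" where
  "G m \<sigma> \<rho> A = (\<lambda>(z, w). polyfun p (z, w) * z ^ \<sigma> * w ^ \<rho> * homog_eval m A (z ^ t) (w ^ s))"

text \<open>Homogenization turns the product with \<open>p\<close> into the one-variable product
  \<open>Q * A\<close>. The factor z^a w^b only translates all exponents.\<close>

lemma G_eq_hmono_sum:
  assumes "degree A \<le> m"
  shows "G m \<sigma> \<rho> A = (\<lambda>x. \<Sum>k\<le>d + m. coeff (Q * A) k * hmono (a + (\<sigma> + t * k)) (b + (\<rho> + s * (d + m - k))) x)"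
proof
  fix x :: "complex \<times> complex"
  obtain z w where x: "x = (z, w)" by (cases x)
  show "G m \<sigma> \<rho> A x = (\<Sum>k\<le>d + m. coeff (Q * A) k * hmono (a + (\<sigma> + t * k)) (b + (\<rho> + s * (d + m - k))) x)"
  proof (cases "(z, w) \<in> bidisc")
    case True
    then have "G m \<sigma> \<rho> A x = z ^ a * w ^ b * z ^ \<sigma> * w ^ \<rho> *
        (homog_eval d Q (z ^ t) (w ^ s) * homog_eval m A (z ^ t) (w ^ s))"
      by (simp add: x G_def polyfun_def eval2_p)
    also have "homog_eval d Q (z ^ t) (w ^ s) * homog_eval m A (z ^ t) (w ^ s)
        = (\<Sum>k\<le>d + m. coeff (Q * A) k * (z ^ t) ^ k * (w ^ s) ^ (d + m - k))"
      by (simp only: homog_eval_mult[OF degree_Q assms]) (simp only: homog_eval_def)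
    also have "z ^ a * w ^ b * z ^ \<sigma> * w ^ \<rho> * \<dots>
        = (\<Sum>k\<le>d + m. coeff (Q * A) k * hmono (a + (\<sigma> + t * k)) (b + (\<rho> + s * (d + m - k))) x)"
      unfolding sum_distrib_left x hmono_def power_add power_mult using True by (simp add: mult_ac)
    finally show ?thesis .
  qed (simp add: x G_def polyfun_def hmono_def)
qed

text \<open>Division with remainder by t and s separates residue and quotient of each exponent.
  Equal quotients in z give k = l, and equality of d + m - k and d + n - l then forces m =
  n.\<close>

lemma hinner_G:
  assumes "degree A \<le> m" "degree B \<le> n" "\<sigma> < t" "\<sigma>' < t" "\<rho> < s" "\<rho>' < s"
  shows "hinner (G m \<sigma> \<rho> A) (G n \<sigma>' \<rho>' B)
    = (if m = n \<and> \<sigma> = \<sigma>' \<and> \<rho> = \<rho>' then cip (Q * A) (Q * B) else 0)"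
proof -
  have "hinner (G m \<sigma> \<rho> A) (G n \<sigma>' \<rho>' B) = (\<Sum>k\<le>d + m. \<Sum>l\<le>d + n. coeff (Q * A) k * cnj (coeff (Q * B) l) *
      (if a + (\<sigma> + t * k) = a + (\<sigma>' + t * l) \<and>
          b + (\<rho> + s * (d + m - k)) = b + (\<rho>' + s * (d + n - l)) then 1 else 0))"
    unfolding G_eq_hmono_sum[OF assms(1)] G_eq_hmono_sum[OF assms(2)] by (rule hinner_hmono_sums)
  also have "\<dots> = (\<Sum>k\<le>d + m. \<Sum>l\<le>d + n. if k = l then
      (if m = n \<and> \<sigma> = \<sigma>' \<and> \<rho> = \<rho>' then coeff (Q * A) k * cnj (coeff (Q * B) k) else 0) else 0)"
    unfolding add_left_cancel mult_add_eq_iff[OF assms(3,4)] mult_add_eq_iff[OF assms(5,6)]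
    by (intro sum.cong refl) auto
  also have "\<dots> = (if m = n \<and> \<sigma> = \<sigma>' \<and> \<rho> = \<rho>' then cip (Q * A) (Q * B) else 0)"
  proof (cases "m = n \<and> \<sigma> = \<sigma>' \<and> \<rho> = \<rho>'")
    case True
    have "degree (Q * A) \<le> d + n"
      using degree_mult_le[of Q A] degree_Q assms(1) True by linarith
    then show ?thesis using True by (simp add: cip_eq)
  next
    case False
    show ?thesis by (simp only: if_not_P[OF False] if_cancel sum.neutral_const)
  qed
  finally show ?thesis .
qed

lemma G_eq_polymono_sum:
  "G m \<sigma> \<rho> A = (\<lambda>x. \<Sum>k\<le>m. coeff A k * polymono p (\<sigma> + t * k) (\<rho> + s * (m - k)) x)"
proof
  fix x :: "complex \<times> complex"
  obtain z w where x: "x = (z, w)" by (cases x)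
  show "G m \<sigma> \<rho> A x = (\<Sum>k\<le>m. coeff A k * polymono p (\<sigma> + t * k) (\<rho> + s * (m - k)) x)"
    unfolding x G_def polymono_eq homog_eval_def power_add power_mult
    by (simp add: sum_distrib_left mult_ac)
qed

text \<open>Every monomial multiple of \<open>p\<close> is of the form \<open>G\<close> with a
  monomial as polynomial, so \<open>hinner_G\<close> also computes inner products with the
  generators of [p].\<close>

lemma polymono_eq_G: "polymono p i j = G (i div t + j div s) (i mod t) (j mod s) (monom 1 (i div t))"
proof -
  have "G (i div t + j div s) (i mod t) (j mod s) (monom 1 (i div t))
    = (\<lambda>x. \<Sum>k\<le>i div t + j div s. if i div t = k
        then polymono p (i mod t + t * k) (j mod s + s * (i div t + j div s - k)) x else 0)"
    unfolding G_eq_polymono_sum by (intro ext sum.cong refl) simp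
  also have "\<dots> = polymono p i j" by simp
  finally show ?thesis ..
qed

lemma G_in_hardy2: "G m \<sigma> \<rho> A \<in> hardy2"
  unfolding G_eq_polymono_sum by (intro hardy2_sum hardy2_scale polymono_in_hardy2)

lemma G_in_submodule: "G m \<sigma> \<rho> A \<in> submodule_gen p"
  unfolding G_eq_polymono_sum
  by (intro closed_subspace_sum closed_subspaceD(5) closed_subspace_submodule_gen polymono_in_submodule_gen)

definition N :: real where "N = hnorm (polyfun p)"

text \<open>\<open>p\<close> itself is \<open>G\<close> with all exponents 0 and polynomial 1, so
  its norm is that of \<open>Q\<close>, the normalization of the weighted measure.\<close>

lemma N_sq: "N\<^sup>2 = Re (cip Q Q)" and N_pos: "N > 0"
proof -
  have "polyfun p = G 0 0 0 1" by (auto simp: G_def homog_eval_def)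
  then have "hinner (polyfun p) (polyfun p) = cip Q Q"
    using hinner_G[of 1 0 1 0 0 0 0 0] s t by simp
  then have "complex_of_real (N\<^sup>2) = cip Q Q" by (simp only: N_def hinner_self[OF polyfun_in_hardy2])
  then show *: "N\<^sup>2 = Re (cip Q Q)" by (metis Re_complex_of_real)
  then have "N\<^sup>2 > 0" using cip_self_pos[OF Q_nonzero] by simp
  moreover have "N \<ge> 0" by (simp add: N_def)
  ultimately show "N > 0" by (simp add: less_le)
qed

definition K :: complex where "K = 1 / of_real N"

lemma K_nonzero: "K \<noteq> 0" and K_norm: "K * (cnj K * of_real (N\<^sup>2)) = 1"
  using N_pos by (simp_all add: K_def power2_eq_square)

lemma cip_eq_wip: "cip (Q * A) (Q * B) = of_real (N\<^sup>2) * wip Q A B"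
  using N_pos by (simp add: wip_eq N_sq[symmetric])

abbreviation e :: "nat \<times> nat \<Rightarrow> bifun" where "e \<equiv> basis_e s t p onp"
abbreviation f :: "nat \<times> nat \<Rightarrow> bifun" where "f \<equiv> basis_f s t p onp"
abbreviation M :: "bifun set" where "M \<equiv> submodule_gen p"

lemma e_eq: "e (m, \<rho>) = (\<lambda>x. K * G m 0 \<rho> (star_poly m (onp m)) x)"
  and f_eq: "f (m, \<sigma>) = (\<lambda>x. K * G m \<sigma> 0 (onp m) x)"
  by (auto simp: basis_e_def basis_f_def G_def N_def K_def)

lemma degree_onp: "degree (onp m) \<le> m"
  using is_onp_onp[of m] by (simp add: is_onp_def)

lemma hinner_normalized_G:
  assumes "degree A \<le> m" "degree B \<le> n" "\<sigma> < t" "\<sigma>' < t" "\<rho> < s" "\<rho>' < s"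
  shows "hinner (\<lambda>x. K * G m \<sigma> \<rho> A x) (\<lambda>x. K * G n \<sigma>' \<rho>' B x)
    = (if m = n \<and> \<sigma> = \<sigma>' \<and> \<rho> = \<rho>' then wip Q A B else 0)"
proof -
  have "K * (cnj K * cip (Q * A) (Q * B)) = wip Q A B"
    unfolding cip_eq_wip using K_norm by (metis mult.assoc mult_1)
  then show ?thesis
    by (simp add: hinner_scale_left hinner_scale_right G_in_hardy2 hardy2_scale hinner_G[OF assms])
qed

lemma onp_lead_nonzero: "coeff (onp m) m \<noteq> 0"
  by (metis onp_lead of_real_eq_0_iff less_irrefl)

lemma e_in: "i \<in> UNIV \<times> {..<s} \<Longrightarrow> e i \<in> M" and f_in: "j \<in> UNIV \<times> {..<t} \<Longrightarrow> f j \<in> M"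
  by (auto simp: e_eq f_eq intro!: closed_subspaceD(5)[OF closed_subspace_submodule_gen] G_in_submodule)

lemma e_orthonormal: "orthonormal (UNIV \<times> {..<s}) e"
  unfolding orthonormal_def using t
  by (auto simp: e_eq hinner_normalized_G degree_star_poly is_onp_star_self[OF is_onp_onp]
      intro!: hardy2_scale G_in_hardy2)

lemma f_orthonormal: "orthonormal (UNIV \<times> {..<t}) f"
  unfolding orthonormal_def using s
  by (auto simp: f_eq hinner_normalized_G degree_onp onp_orthonormal
      intro!: hardy2_scale G_in_hardy2)

definition c :: "nat \<Rightarrow> complex" where "c m = wip Q (onp m) (star_poly m (onp m))"

text \<open>The w-residue of \<open>f\<close> and the z-residue of \<open>e\<close> are always 0, so
  the residues can agree only for \<sigma> = \<rho> = 0.\<close>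

lemma hinner_f_e:
  assumes "\<sigma> < t" "\<rho> < s"
  shows "hinner (f (m, \<sigma>)) (e (n, \<rho>)) = (if m = n \<and> \<sigma> = 0 \<and> \<rho> = 0 then c m else 0)"
  using assms s t
  by (auto simp: e_eq f_eq hinner_normalized_G degree_onp degree_star_poly c_def)

lemma cmod_c: "cmod (c n) = (case n of 0 \<Rightarrow> 1 | Suc m \<Rightarrow> cmod (verb m))"
  using onp_star_diagonal by (auto simp: c_def split: nat.splits)

lemma c_tendsto: "c \<longlonglongrightarrow> 0"
proof (rule LIMSEQ_imp_Suc)
  have "(\<lambda>m. - cnj (verb m)) \<longlonglongrightarrow> - cnj 0" by (intro tendsto_intros verb_tendsto_zero)
  then show "(\<lambda>m. c (Suc m)) \<longlonglongrightarrow> 0" by (simp add: c_def onp_star_diagonal)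
qed

section \<open>The two orthonormal bases\<close>

lemma hinner_scaled_G_polymono:
  assumes "degree A \<le> m" "\<sigma> < t" "\<rho> < s"
    and "m = i div t + j div s \<Longrightarrow> \<sigma> = i mod t \<Longrightarrow> \<rho> = j mod s \<Longrightarrow> wip Q A (monom 1 (i div t)) = 0"
  shows "hinner (\<lambda>x. K * G m \<sigma> \<rho> A x) (polymono p i j) = 0"
proof -
  have "degree (monom (1::complex) (i div t)) \<le> i div t + j div s"
    by (rule order_trans[OF degree_monom_le]) simp
  moreover have "i mod t < t" "j mod s < s" using s t by simp_all
  ultimately have "hinner (G m \<sigma> \<rho> A) (polymono p i j) = 0"
    using assms by (auto simp: polymono_eq_G[of i j] hinner_G cip_eq_wip)
  then show ?thesis by (simp add: hinner_scale_left[OF G_in_hardy2])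
qed

text \<open>Maximality: an element orthogonal to z [p] sees only the term k = 0 of \<open>e\<close>,
  a nonzero multiple of p w^j. Orthogonality to all \<open>e\<close> therefore makes it orthogonal
  to all generators.\<close>

lemma e_basis: "orthonormal_basis (UNIV \<times> {..<s}) e (ominus M (mult_z ` M))"
  unfolding orthonormal_basis_def
proof (intro conjI ballI impI)
  fix x assume x: "x \<in> (UNIV :: nat set) \<times> {..<s}"
  then obtain m \<rho> where m: "x = (m, \<rho>)" "\<rho> < s" by auto
  have "hinner (e x) (polymono p (i + 1) (j + 0)) = 0" for i j
    unfolding m(1) e_eq
  proof (rule hinner_scaled_G_polymono)
    assume eq: "m = (i + 1) div t + (j + 0) div s" and "0 = (i + 1) mod t"
    then have "t dvd i + 1" by (simp add: mod_eq_0_iff_dvd)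
    then have "t \<le> i + 1" by (rule dvd_imp_le) simp
    \<comment> \<open>The extra factor z raises the power of zeta to at least 1, exactly the range
      in which phi_m* is orthogonal to monomials.\<close>
    then have "0 < (i + 1) div t" using t by (intro div_greater_zero_iff[THEN iffD2]) auto
    with eq show "wip Q (star_poly m (onp m)) (monom 1 ((i + 1) div t)) = 0"
      by (intro is_onp_star_monom[OF is_onp_onp]) simp_all
  qed (use t m(2) degree_star_poly in auto)
  then show "e x \<in> ominus M (mult_z ` M)"
    using perp_mult_mono_submodule_gen_iff[OF orthonormalD(1)[OF e_orthonormal x], of 1 0 p] e_in[OF x]
    unfolding ominus_def mult_z_eq by simp
next
  fix x y assume "x \<in> (UNIV :: nat set) \<times> {..<s}" "y \<in> (UNIV :: nat set) \<times> {..<s}"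
  then show "hinner (e x) (e y) = (if x = y then 1 else 0)" by (rule orthonormalD(2)[OF e_orthonormal])
next
  fix g assume g: "g \<in> ominus M (mult_z ` M)" and perp: "\<forall>x\<in>UNIV \<times> {..<s}. hinner g (e x) = 0"
  then have gM: "g \<in> M" by (simp add: ominus_def)
  have gH: "g \<in> hardy2" by (rule closed_subspaceD(1)[OF closed_subspace_submodule_gen gM])
  have z: "hinner g (polymono p (Suc i) j) = 0" for i j
    using g perp_mult_mono_submodule_gen_iff[OF gH, of 1 0 p] by (simp add: ominus_def mult_z_eq)
  have w: "hinner g (polymono p 0 j) = 0" for j
  proof -
    define m \<rho> where "m = j div s" and "\<rho> = j mod s"
    have "\<rho> < s" using s by (simp add: \<rho>_def)
    have j: "\<rho> + s * m = j" by (simp add: m_def \<rho>_def)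
    let ?A = "star_poly m (onp m)"
    have "0 = hinner g (\<lambda>x. K * G m 0 \<rho> ?A x)"
      using perp \<open>\<rho> < s\<close> e_eq[of m \<rho>] by (metis SigmaI UNIV_I lessThan_iff)
    then have "0 = hinner g (G m 0 \<rho> ?A)"
      using K_nonzero by (simp add: hinner_scale_right[OF G_in_hardy2])
    also have "\<dots> = (\<Sum>k\<le>m. hinner g (\<lambda>x. coeff ?A k * polymono p (0 + t * k) (\<rho> + s * (m - k)) x))"
      unfolding G_eq_polymono_sum by (intro hinner_sum_right hardy2_scale polymono_in_hardy2 gH)
    also have "\<dots> = (\<Sum>k\<le>m. cnj (coeff ?A k) * hinner g (polymono p (0 + t * k) (\<rho> + s * (m - k))))"
      by (simp only: hinner_scale_right[OF polymono_in_hardy2])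
    also have "\<dots> = (\<Sum>k\<in>{0}. cnj (coeff ?A k) * hinner g (polymono p (0 + t * k) (\<rho> + s * (m - k))))"
    proof (rule sum.mono_neutral_right)
      show "\<forall>k\<in>{..m} - {0}. cnj (coeff ?A k) * hinner g (polymono p (0 + t * k) (\<rho> + s * (m - k))) = 0"
      proof
        fix k assume "k \<in> {..m} - {0}"
        then have "t * k \<noteq> 0" using t by simp
        then obtain i where "t * k = Suc i" using not0_implies_Suc by blast
        then show "cnj (coeff ?A k) * hinner g (polymono p (0 + t * k) (\<rho> + s * (m - k))) = 0"
          by (simp add: z)
      qed
    qed auto
    \<comment> \<open>The constant term of phi_m* is the conjugated leading coefficient of phi_m,
      hence nonzero.\<close>
    finally show ?thesis by (simp add: j coeff_star_poly onp_lead_nonzero)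
  qed
  have "hinner g (polymono p i j) = 0" for i j
    by (cases i) (simp_all add: z w)
  then show "g = (\<lambda>x. 0)" by (rule submodule_gen_eq_zeroD[OF gM])
qed

text \<open>Mirror image for w: modulo w [p] only the term k = m of \<open>f\<close> remains, and
  its coefficient is the leading coefficient of phi_m.\<close>

lemma f_basis: "orthonormal_basis (UNIV \<times> {..<t}) f (ominus M (mult_w ` M))"
  unfolding orthonormal_basis_def
proof (intro conjI ballI impI)
  fix x assume x: "x \<in> (UNIV :: nat set) \<times> {..<t}"
  then obtain m \<sigma> where m: "x = (m, \<sigma>)" "\<sigma> < t" by auto
  have "hinner (f x) (polymono p (i + 0) (j + 1)) = 0" for i j
    unfolding m(1) f_eq
  proof (rule hinner_scaled_G_polymono)
    assume eq: "m = (i + 0) div t + (j + 1) div s" and "0 = (j + 1) mod s"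
    then have "s dvd j + 1" by (simp add: mod_eq_0_iff_dvd)
    then have "s \<le> j + 1" by (rule dvd_imp_le) simp
    \<comment> \<open>The positive quotient in w leaves a power of zeta strictly below m, where
      phi_m is orthogonal to monomials.\<close>
    then have "0 < (j + 1) div s" using s by (intro div_greater_zero_iff[THEN iffD2]) auto
    with eq show "wip Q (onp m) (monom 1 ((i + 0) div t)) = 0"
      using is_onp_onp[of m] by (simp add: is_onp_def)
  qed (use s m(2) degree_onp in auto)
  then show "f x \<in> ominus M (mult_w ` M)"
    using perp_mult_mono_submodule_gen_iff[OF orthonormalD(1)[OF f_orthonormal x], of 0 1 p] f_in[OF x]
    unfolding ominus_def mult_w_eq by simp
next
  fix x y assume "x \<in> (UNIV :: nat set) \<times> {..<t}" "y \<in> (UNIV :: nat set) \<times> {..<t}"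
  then show "hinner (f x) (f y) = (if x = y then 1 else 0)" by (rule orthonormalD(2)[OF f_orthonormal])
next
  fix g assume g: "g \<in> ominus M (mult_w ` M)" and perp: "\<forall>x\<in>UNIV \<times> {..<t}. hinner g (f x) = 0"
  then have gM: "g \<in> M" by (simp add: ominus_def)
  have gH: "g \<in> hardy2" by (rule closed_subspaceD(1)[OF closed_subspace_submodule_gen gM])
  have w: "hinner g (polymono p i (Suc j)) = 0" for i j
    using g perp_mult_mono_submodule_gen_iff[OF gH, of 0 1 p] by (simp add: ominus_def mult_w_eq)
  have z: "hinner g (polymono p i 0) = 0" for i
  proof -
    define m \<sigma> where "m = i div t" and "\<sigma> = i mod t"
    have "\<sigma> < t" using t by (simp add: \<sigma>_def)
    have i: "\<sigma> + t * m = i" by (simp add: m_def \<sigma>_def)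
    let ?A = "onp m"
    have "0 = hinner g (\<lambda>x. K * G m \<sigma> 0 ?A x)"
      using perp \<open>\<sigma> < t\<close> f_eq[of m \<sigma>] by (metis SigmaI UNIV_I lessThan_iff)
    then have "0 = hinner g (G m \<sigma> 0 ?A)"
      using K_nonzero by (simp add: hinner_scale_right[OF G_in_hardy2])
    also have "\<dots> = (\<Sum>k\<le>m. hinner g (\<lambda>x. coeff ?A k * polymono p (\<sigma> + t * k) (0 + s * (m - k)) x))"
      unfolding G_eq_polymono_sum by (intro hinner_sum_right hardy2_scale polymono_in_hardy2 gH)
    also have "\<dots> = (\<Sum>k\<le>m. cnj (coeff ?A k) * hinner g (polymono p (\<sigma> + t * k) (0 + s * (m - k))))"
      by (simp only: hinner_scale_right[OF polymono_in_hardy2])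
    also have "\<dots> = (\<Sum>k\<in>{m}. cnj (coeff ?A k) * hinner g (polymono p (\<sigma> + t * k) (0 + s * (m - k))))"
    proof (rule sum.mono_neutral_right)
      show "\<forall>k\<in>{..m} - {m}. cnj (coeff ?A k) * hinner g (polymono p (\<sigma> + t * k) (0 + s * (m - k))) = 0"
      proof
        fix k assume "k \<in> {..m} - {m}"
        then have "s * (m - k) \<noteq> 0" using s by simp
        then obtain j where "s * (m - k) = Suc j" using not0_implies_Suc by blast
        then show "cnj (coeff ?A k) * hinner g (polymono p (\<sigma> + t * k) (0 + s * (m - k))) = 0"
          by (simp add: w)
      qed
    qed auto
    finally show ?thesis by (simp add: i onp_lead_nonzero)
  qed
  have "hinner g (polymono p i j) = 0" for i j
    by (cases j) (simp_all add: z w)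
  then show "g = (\<lambda>x. 0)" by (rule submodule_gen_eq_zeroD[OF gM])
qed

section \<open>The matrix of \<open>P_z P_w\<close> and its singular values\<close>

lemma closed_E: "closed_subspace (ominus M (mult_z ` M))"
  and closed_F: "closed_subspace (ominus M (mult_w ` M))"
  unfolding mult_z_eq mult_w_eq
  by (intro closed_subspace_ominus closed_subspace_submodule_gen mult_mono_submodule_gen_subset)+

lemma M_hardy2: "g \<in> M \<Longrightarrow> g \<in> hardy2"
  by (rule closed_subspaceD(1)[OF closed_subspace_submodule_gen])

lemma P_w_in: "g \<in> M \<Longrightarrow> P_w M g \<in> hardy2"
  unfolding P_w_def using closed_subspaceD(1)[OF closed_F proj_in[OF closed_F f_basis M_hardy2]] .

lemma hinner_P_w_e:
  assumes "g \<in> M" "\<rho> < s"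
  shows "hinner (P_w M g) (e (n, \<rho>)) = (if \<rho> = 0 then c n * hinner g (f (n, 0)) else 0)"
proof -
  have gH: "g \<in> hardy2" by (rule M_hardy2[OF assms(1)])
  have eH: "e (n, \<rho>) \<in> hardy2" using e_orthonormal assms(2) by (simp add: orthonormal_def)
  have "((\<lambda>i. hinner g (f i) * hinner (f i) (e (n, \<rho>))) has_sum hinner (P_w M g) (e (n, \<rho>))) (UNIV \<times> {..<t})"
    unfolding P_w_def proj_orthonormal_basis[OF closed_F f_basis gH]
    by (rule hinner_hsum_has_sum[OF f_orthonormal l2_bessel[OF f_orthonormal gH] eH])
  moreover have "((\<lambda>i. hinner g (f i) * hinner (f i) (e (n, \<rho>))) has_sum
      (if \<rho> = 0 then c n * hinner g (f (n, 0)) else 0)) (UNIV \<times> {..<t})"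
    using t assms(2)
    by (intro has_sum_finite_neutralI[of "{(n, 0)}"]) (auto simp: hinner_f_e split: if_splits)
  ultimately show ?thesis by (rule has_sum_unique)
qed

lemma P_z_P_w_eq:
  assumes "g \<in> M"
  shows "P_z M (P_w M g) = hsum UNIV (\<lambda>n. c n * hinner g (f (n, 0))) (\<lambda>n. e (n, 0))"
proof -
  have "P_z M (P_w M g) = hsum (UNIV \<times> {..<s}) (\<lambda>i. hinner (P_w M g) (e i)) e"
    unfolding P_z_def by (rule proj_orthonormal_basis[OF closed_E e_basis P_w_in[OF assms]])
  \<comment> \<open>By \<open>hinner_P_w_e\<close> the coefficients with \<rho> different from 0
    vanish.\<close>
  also have "\<dots> = hsum UNIV (\<lambda>n. hinner (P_w M g) (e (n, 0))) (\<lambda>n. e (n, 0))"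
    by (rule hsum_reindex) (use s in \<open>auto simp: inj_on_def hinner_P_w_e[OF assms] image_iff\<close>)
  finally show ?thesis using s by (simp add: hinner_P_w_e[OF assms])
qed

lemma singular_values:
  "nonzero_singular_values M (P_z M \<circ> P_w M) (\<lambda>n. case n of 0 \<Rightarrow> 1 | Suc m \<Rightarrow> cmod (verb m))"
proof -
  interpret diagonal_operator M "P_z M \<circ> P_w M" c "\<lambda>n. e (n, 0)" "\<lambda>n. f (n, 0)"
  proof
    show "orthonormal UNIV (\<lambda>n. e (n, 0))" "orthonormal UNIV (\<lambda>n. f (n, 0))"
      using e_orthonormal f_orthonormal s t by (auto simp: orthonormal_def)
  qed (use s t in \<open>auto simp: P_z_P_w_eq closed_subspace_submodule_gen c_tendsto intro!: e_in f_in\<close>)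
  show ?thesis using nonzero_singular_values by (simp add: cmod_c)
qed

text \<open>\<open>e\<close> lies in the range of P_z, so P_z may be dropped from the inner product.
  What is left vanishes through the residue \<rho>, or for \<rho> = 0 by orthogonality of
  \<open>f (m, \<sigma>)\<close> to \<open>f (n, 0)\<close>.\<close>

lemma block_zero:
  assumes "\<rho> < s" "\<sigma> < t" "(\<rho>, \<sigma>) \<noteq> (0, 0)"
  shows "hinner ((P_z M \<circ> P_w M) (f (m, \<sigma>))) (e (n, \<rho>)) = 0"
proof -
  have fM: "f (m, \<sigma>) \<in> M" using assms by (intro f_in) auto
  have "e (n, \<rho>) \<in> ominus M (mult_z ` M)"
    using e_basis assms(1) by (simp add: orthonormal_basis_def)
  then have "hinner (P_z M (P_w M (f (m, \<sigma>)))) (e (n, \<rho>)) = hinner (P_w M (f (m, \<sigma>))) (e (n, \<rho>))"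
    unfolding P_z_def by (rule hinner_proj[OF closed_E e_basis P_w_in[OF fM]])
  also have "\<dots> = 0"
    using assms t by (auto simp: hinner_P_w_e[OF fM] orthonormalD(2)[OF f_orthonormal])
  finally show ?thesis by simp
qed

end

theorem corollary9p3:
  fixes s t a b d :: nat and p q :: "complex poly poly"
    and \<mu> :: "complex measure" and \<phi> :: "nat \<Rightarrow> complex poly" and \<alpha> :: "nat \<Rightarrow> complex"
    and T :: "complex poly poly \<Rightarrow> bifun \<Rightarrow> bifun"
    and e f :: "nat \<times> nat \<Rightarrow> bifun"
  assumes "s \<ge> 1" and "t \<ge> 1" and "coprime s t"
    and "quasi_homogeneous s t p"
    and "reduction s t p a b d q"
    and "\<mu> = weighted_measure (poly q [:1:])"
    and "\<phi> = orthonormal_polys \<mu>"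
    and "\<alpha> = verblunsky \<mu>"
    and "T = (\<lambda>r. P_z (submodule_gen r) \<circ> P_w (submodule_gen r))"
    and "e = basis_e s t p \<phi>"
    and "f = basis_f s t p \<phi>"
  shows "nonzero_singular_values (submodule_gen p) (T p)
           (\<lambda>n. case n of 0 \<Rightarrow> 1 | Suc m \<Rightarrow> cmod (\<alpha> m)) \<and>
         nonzero_singular_values (submodule_gen q) (T q)
           (\<lambda>n. case n of 0 \<Rightarrow> 1 | Suc m \<Rightarrow> cmod (\<alpha> m)) \<and>
         orthonormal_basis (UNIV \<times> {..<s}) e
           (ominus (submodule_gen p) (mult_z ` submodule_gen p)) \<and>
         orthonormal_basis (UNIV \<times> {..<t}) f
           (ominus (submodule_gen p) (mult_w ` submodule_gen p)) \<and>
         (\<forall>\<rho><s. \<forall>\<sigma><t. (\<rho>, \<sigma>) \<noteq> (0, 0) \<longrightarrow>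
           (\<forall>m n. hinner (T p (f (m, \<sigma>))) (e (n, \<rho>)) = 0))"
proof -
  interpret p: quasi_homogeneous_reduction s t a b d p q
    by standard (use assms in \<open>auto simp: quasi_homogeneous_def\<close>)
  have "q \<noteq> 0" using p.Q_nonzero by (auto simp: p.Q_def)
  \<comment> \<open>\<open>q\<close> is its own reduction for weights 1, 1, with the same
    dehomogenization \<open>Q\<close> as for \<open>p\<close>; hence both submodules have the same
    Verblunsky coefficients.\<close>
  moreover have "reduction 1 1 q 0 0 d q" using p.hom by (simp add: reduction_def)
  ultimately interpret q: quasi_homogeneous_reduction 1 1 0 0 d q q by unfold_locales auto
  have \<phi>: "\<phi> = opuc.onp (wip p.Q)"
    using orthonormal_polys_weighted[OF p.Q_nonzero] assms by (simp add: p.Q_def)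
  have \<alpha>: "\<alpha> = opuc.verb (wip p.Q)"
    using verblunsky_weighted[OF p.Q_nonzero] assms by (simp add: p.Q_def)
  have "nonzero_singular_values (submodule_gen q) (T q)
      (\<lambda>n. case n of 0 \<Rightarrow> 1 | Suc m \<Rightarrow> cmod (\<alpha> m))"
    unfolding \<alpha> assms(9) by (rule q.singular_values)
  moreover have "nonzero_singular_values (submodule_gen p) (T p)
      (\<lambda>n. case n of 0 \<Rightarrow> 1 | Suc m \<Rightarrow> cmod (\<alpha> m))"
    unfolding \<alpha> assms(9) by (rule p.singular_values)
  moreover have "e = p.e" "f = p.f" by (simp_all only: assms(10,11) \<phi>)
  ultimately show ?thesis
    using p.e_basis p.f_basis p.block_zero unfolding assms(9) by blast
qed

end
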